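(* Let $1<p<N$, let $\Omega\subset\mathbb{R}^N$ be a bounded, strictly convex, open set with $C^2$ boundary, and let $f:\overline{\Omega}\times\mathbb{R}\to\mathbb{R}$ be a Carathéodory function. Assume: (H0) $|f(x,s)|\le |a(x)|\,\tilde f(s)$, where $a\in L^r(\Omega)$ with $r>N/p$, and $\tilde f:\mathbb{R}\to[0,+\infty)$ is continuous, satisfies $\tilde f(s)>0$ for $|s|>s_0$ (for some $s_0\ge 0$), and $$\lim_{s\to\pm\infty}\frac{\tilde f(s)}{|s|^{p^*_{N/r}-1}}=0;$$ (H1) there is a constant $c_0>0$ such that $$\limsup_{s\to+\infty}\frac{\max_{[-s,s]}\tilde f}{\max\{\tilde f(-s),\tilde f(s)\}}\le c_0 .$$ Let $\{u_k\}\subset W_0^{1,p}(\Omega)$ be any sequence of weak solutions of $-\Delta_p u=f(x,u)$ in $\Omega$, $u=0$ on $\partial\Omega$, such that there exists a constant $C_0>0$ with $\|u_k\|_{p^*}\le C_0$ for all $k$. Then there exists a constant $C>0$ such that $\|u_k\|_\infty\le C$ for all $k$.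
   Context: $\Delta_p u=\operatorname{div}(|\nabla u|^{p-2}\nabla u)$ is the $p$-Laplacian. $p^*=\frac{Np}{N-p}$ is the critical Sobolev exponent, $(p^* )'=\frac{p^*}{p^*-1}$, and $p^*_{N/r}:=p^*\left(1-\frac1r\right)$. $\|\cdot\|_q$ denotes the norm of $L^q(\Omega)$. $f$ is Carathéodory: $f(\cdot,s)$ is measurable for all $s\in\mathbb{R}$ and $f(x,\cdot)$ is continuous for almost all $x\in\Omega$. A weak solution is $u\in W_0^{1,p}(\Omega)$ such that $f(\cdot,u)\in L^{(p^* )'}(\Omega)$ and $\int_\Omega|\nabla u|^{p-2}\nabla u\cdot\nabla\varphi\,dx=\int_\Omega f(x,u)\varphi\,dx$ for all $\varphi\in W_0^{1,p}(\Omega)$. *)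

theory Defs
  imports "HOL-Analysis.Analysis" "HOL-Probability.Essential_Supremum"
begin

section \<open>Lebesgue spaces\<close>

text \<open>The norm takes the value \<open>\<infinity>\<close> exactly outside of \<open>L\<^sup>q(\<Omega>)\<close>, so that a bound
  \<open>Lnorm \<Omega> q u \<le> C\<close> with \<open>C\<close> finite includes membership. The exponent ranges over
  \<open>[1, \<infinity>]\<close>.\<close>

definition Lnorm :: "'a::euclidean_space set \<Rightarrow> ereal \<Rightarrow> ('a \<Rightarrow> 'b::euclidean_space) \<Rightarrow> ereal" where
  "Lnorm \<Omega> q u =
    (if u \<notin> borel_measurable (lebesgue_on \<Omega>) then \<infinity>
     else if q = \<infinity> then esssup (lebesgue_on \<Omega>) (\<lambda>x. ereal (norm (u x)))
     else if integrable (lebesgue_on \<Omega>) (\<lambda>x. norm (u x) powr real_of_ereal q)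
       then ereal ((\<integral>x. norm (u x) powr real_of_ereal q \<partial>(lebesgue_on \<Omega>)) powr (1 / real_of_ereal q))
     else \<infinity>)"

definition L_space :: "'a::euclidean_space set \<Rightarrow> ereal \<Rightarrow> ('a \<Rightarrow> 'b::euclidean_space) set" where
  "L_space \<Omega> q = {u. Lnorm \<Omega> q u < \<infinity>}"

section \<open>Smooth functions and test functions\<close>

primrec Ck :: "nat \<Rightarrow> ('a::euclidean_space \<Rightarrow> real) \<Rightarrow> bool" where
  "Ck 0 f \<longleftrightarrow> continuous_on UNIV f"
| "Ck (Suc k) f \<longleftrightarrow> (\<forall>x. f differentiable (at x)) \<and>
     (\<forall>b\<in>Basis. Ck k (\<lambda>x. frechet_derivative f (at x) b))"

definition test_functions :: "'a::euclidean_space set \<Rightarrow> ('a \<Rightarrow> real) set" where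
  "test_functions \<Omega> = {\<phi>. (\<forall>k. Ck k \<phi>) \<and>
     compact (closure {x. \<phi> x \<noteq> 0}) \<and> closure {x. \<phi> x \<noteq> 0} \<subseteq> \<Omega>}"

definition classical_grad :: "('a::euclidean_space \<Rightarrow> real) \<Rightarrow> 'a \<Rightarrow> 'a" where
  "classical_grad \<phi> x = (\<Sum>b\<in>Basis. frechet_derivative \<phi> (at x) b *\<^sub>R b)"

section \<open>Sobolev spaces\<close>

definition locally_integrable :: "'a::euclidean_space set \<Rightarrow> ('a \<Rightarrow> 'b::euclidean_space) \<Rightarrow> bool" where
  "locally_integrable \<Omega> u \<longleftrightarrow> (\<forall>K. compact K \<and> K \<subseteq> \<Omega> \<longrightarrow> integrable (lebesgue_on K) u)"

definition has_weak_grad :: "'a::euclidean_space set \<Rightarrow> ('a \<Rightarrow> real) \<Rightarrow> ('a \<Rightarrow> 'a) \<Rightarrow> bool" where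
  "has_weak_grad \<Omega> u g \<longleftrightarrow> locally_integrable \<Omega> u \<and> locally_integrable \<Omega> g \<and>
     (\<forall>\<phi>\<in>test_functions \<Omega>. \<forall>b\<in>Basis.
        (\<integral>x. u x * frechet_derivative \<phi> (at x) b \<partial>(lebesgue_on \<Omega>)) =
        - (\<integral>x. (g x \<bullet> b) * \<phi> x \<partial>(lebesgue_on \<Omega>)))"

text \<open>A weak gradient on an open set is unique up to a null set; the choice of the
  representative is immaterial wherever \<open>weak_grad\<close> is used below.\<close>

definition weak_grad :: "'a::euclidean_space set \<Rightarrow> ('a \<Rightarrow> real) \<Rightarrow> 'a \<Rightarrow> 'a" where
  "weak_grad \<Omega> u = (SOME g. has_weak_grad \<Omega> u g)"

definition W1 :: "'a::euclidean_space set \<Rightarrow> real \<Rightarrow> ('a \<Rightarrow> real) set" where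
  "W1 \<Omega> p = {u. u \<in> L_space \<Omega> p \<and> (\<exists>g. has_weak_grad \<Omega> u g) \<and> weak_grad \<Omega> u \<in> L_space \<Omega> p}"

text \<open>The closure of the test functions in \<open>W1 \<Omega> p\<close>.\<close>

definition W1_0 :: "'a::euclidean_space set \<Rightarrow> real \<Rightarrow> ('a \<Rightarrow> real) set" where
  "W1_0 \<Omega> p = {u \<in> W1 \<Omega> p. \<exists>\<phi>. (\<forall>n::nat. \<phi> n \<in> test_functions \<Omega>) \<and>
     (\<lambda>n. Lnorm \<Omega> p (\<lambda>x. u x - \<phi> n x)) \<longlonglongrightarrow> 0 \<and>
     (\<lambda>n. Lnorm \<Omega> p (\<lambda>x. weak_grad \<Omega> u x - classical_grad (\<phi> n) x)) \<longlonglongrightarrow> 0}"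

section \<open>Domains\<close>

definition strictly_convex :: "'a::euclidean_space set \<Rightarrow> bool" where
  "strictly_convex S \<longleftrightarrow>
     (\<forall>x\<in>closure S. \<forall>y\<in>closure S. x \<noteq> y \<longrightarrow> open_segment x y \<subseteq> interior S)"

text \<open>Near each boundary point, \<open>\<Omega>\<close> is the strict epigraph, in the direction of a unit
  vector \<open>e\<close>, of a \<open>C\<^sup>2\<close> function of the variables orthogonal to \<open>e\<close>. Here \<open>\<gamma>\<close> is defined on
  the whole space but evaluated only on the orthogonal complement of \<open>e\<close>.\<close>

definition C2_boundary :: "'a::euclidean_space set \<Rightarrow> bool" where
  "C2_boundary \<Omega> \<longleftrightarrow> (\<forall>x0\<in>frontier \<Omega>. \<exists>\<rho>>0. \<exists>e \<gamma>. norm e = 1 \<and> Ck 2 \<gamma> \<and>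
     \<Omega> \<inter> ball x0 \<rho> = {x \<in> ball x0 \<rho>. \<gamma> (x - (x \<bullet> e) *\<^sub>R e) < x \<bullet> e})"

section \<open>The boundary value problem\<close>

definition sobolev_exponent :: "real \<Rightarrow> real \<Rightarrow> real" where
  "sobolev_exponent N p = N * p / (N - p)"

definition conjugate_exponent :: "real \<Rightarrow> real" where
  "conjugate_exponent q = q / (q - 1)"

definition caratheodory :: "'a::euclidean_space set \<Rightarrow> ('a \<Rightarrow> real \<Rightarrow> real) \<Rightarrow> bool" where
  "caratheodory \<Omega> f \<longleftrightarrow> (\<forall>s. (\<lambda>x. f x s) \<in> borel_measurable (lebesgue_on \<Omega>)) \<and>
     (AE x in lebesgue_on \<Omega>. continuous_on UNIV (f x))"

text \<open>Weak solutions of \<open>-\<Delta>\<^sub>p u = f(x,u)\<close> in \<open>\<Omega>\<close>, \<open>u = 0\<close> on the boundary. If the weak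
  gradient vanishes at a point, the integrand on the left is 0 there, also for \<open>p < 2\<close>.\<close>

definition p_laplace_weak_solution ::
    "'a::euclidean_space set \<Rightarrow> real \<Rightarrow> ('a \<Rightarrow> real \<Rightarrow> real) \<Rightarrow> ('a \<Rightarrow> real) \<Rightarrow> bool" where
  "p_laplace_weak_solution \<Omega> p f u \<longleftrightarrow> u \<in> W1_0 \<Omega> p \<and>
     (\<lambda>x. f x (u x)) \<in> L_space \<Omega> (conjugate_exponent (sobolev_exponent (DIM('a)) p)) \<and>
     (\<forall>\<phi>\<in>W1_0 \<Omega> p.
        (\<integral>x. (norm (weak_grad \<Omega> u x) powr (p - 2) *\<^sub>R weak_grad \<Omega> u x) \<bullet> weak_grad \<Omega> \<phi> x
          \<partial>(lebesgue_on \<Omega>)) =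
        (\<integral>x. f x (u x) * \<phi> x \<partial>(lebesgue_on \<Omega>)))"

end

theory Submission
  imports Defs
begin

text \<open>Test the equation with a smooth truncation of \<open>u\<close> that vanishes for \<open>\<bar>u\<bar> \<le> k\<close>. As the truncation has
  slope in \<open>[0, 1]\<close>, the Sobolev inequality bounds its norm in \<open>L\<^sup>q\<close>, where \<open>q = p\<^sup>*\<close>, by the integral
  of \<open>\<bar>f(x, u) u\<bar>\<close> over \<open>{\<bar>u\<bar> > k}\<close>. For large \<open>k\<close> the growth condition bounds this integrand by
  \<open>\<epsilon> \<bar>a\<bar> \<bar>u\<bar>\<^sup>t\<close> with \<open>t = q (1 - 1/r)\<close>, which the inequality of Hoelder pairs exactly with \<open>a \<in> L\<^sup>r\<close>
  and \<open>u \<in> L\<^sup>q\<close>. Hence \<open>\<Phi>(k)\<close>, the integral of \<open>\<bar>u\<bar>\<^sup>q\<close> over \<open>{\<bar>u\<bar> > k}\<close>, satisfies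
  \<open>\<Phi>(k') \<le> (2k'/(k' - k))\<^sup>q (\<epsilon> const)\<^bsup>q/p\<^esup> \<Phi>(k)\<^sup>\<sigma>\<close> with \<open>\<sigma> = (q/p)(1 - 1/r) > 1\<close> because \<open>r > N/p\<close>.
  As \<open>\<epsilon>\<close> is arbitrary and \<open>\<Phi>\<close> is bounded uniformly in the solution, the De Giorgi iteration between
  the levels \<open>k\<^sub>0\<close> and \<open>2k\<^sub>0\<close> ends with \<open>\<Phi>(2k\<^sub>0) = 0\<close>.\<close>

section \<open>Calculus of smooth functions\<close>

text \<open>The growth exponent is exactly critical: Hoelder returns the same quantity \<Phi>(k)
  that stands on the left, and a bound in \<open>L\<^sup>q\<close> alone makes no \<Phi>(k) small
  uniformly over the solutions. A superlinear recursion with a fixed constant would therefore lack a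
  small starting value; all smallness must sit in \<epsilon>. It is fixed before the level:
  \<epsilon> from \<open>C\<^sub>0\<close>, \<open>a\<close> and the exponents, then
  \<open>k\<^sub>0\<close> from the decay of the quotient. This order makes the final bound common
  to all solutions. \<Phi> carries the weight \<open>|u|\<close> to the power \<open>q\<close>, not
  just the measure of the level set, so that it recurs on both sides; the price is the factor in
  \<open>k' / (k' - k)\<close>, which grows only geometrically along dyadic levels. Two features of
  the definitions shape the rest. The gradient of a Sobolev function is an arbitrarily chosen
  representative, so uniqueness up to null sets precedes every computation with it. And Sobolev
  functions vanishing at the boundary are limits of smooth functions, so the truncation is taken
  smooth: composed with a test function it gives a test function again.\<close>

lemma Ck_Suc_imp: "Ck (Suc k) f \<Longrightarrow> Ck k f"
proof (induction k arbitrary: f)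
  case 0
  then show ?case
    by (auto intro!: continuous_at_imp_continuous_on differentiable_imp_continuous_within)
next
  case (Suc k)
  then show ?case by simp
qed

lemma Ck_const: "Ck k (\<lambda>x. c)"
  by (induction k arbitrary: c) (simp_all add: frechet_derivative_const)

lemma Ck_add:
  assumes "Ck k f" "Ck k g" shows "Ck k (\<lambda>x. f x + g x)"
  using assms
proof (induction k arbitrary: f g)
  case 0
  then show ?case by (auto intro: continuous_on_add)
next
  case (Suc k)
  have "frechet_derivative (\<lambda>x. f x + g x) (at x) =
      (\<lambda>b. frechet_derivative f (at x) b + frechet_derivative g (at x) b)" for x
    using Suc.prems by (intro frechet_derivative_at[symmetric] derivative_intros)
      (auto simp: frechet_derivative_works[symmetric])
  then show ?case using Suc by (auto intro: differentiable_add)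
qed

lemma Ck_mult:
  assumes "Ck k f" "Ck k g" shows "Ck k (\<lambda>x. f x * g x)"
  using assms
proof (induction k arbitrary: f g)
  case 0
  then show ?case by (auto intro: continuous_on_mult)
next
  case (Suc k)
  have *: "frechet_derivative (\<lambda>x. f x * g x) (at x) =
      (\<lambda>b. f x * frechet_derivative g (at x) b + frechet_derivative f (at x) b * g x)" for x
    using Suc.prems by (intro frechet_derivative_at[symmetric] derivative_intros)
      (auto simp: frechet_derivative_works[symmetric])
  show ?case unfolding Ck.simps *
    using Suc.prems Ck_Suc_imp[OF Suc.prems(1)] Ck_Suc_imp[OF Suc.prems(2)]
    by (auto intro!: differentiable_mult Ck_add Suc.IH)
qed

lemma Ck_prod:
  assumes "finite I" "\<And>i. i \<in> I \<Longrightarrow> Ck k (f i)" shows "Ck k (\<lambda>x. \<Prod>i\<in>I. f i x)"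
  using assms by (induction I rule: finite_induct) (auto intro: Ck_const Ck_mult)

lemma Ck_inner: "Ck k (\<lambda>x. x \<bullet> b)"
proof (cases k)
  case (Suc n)
  have "frechet_derivative (\<lambda>x. x \<bullet> b) (at x) = (\<lambda>x. x \<bullet> b)" for x
    by (intro frechet_derivative_at[symmetric] derivative_intros)
  moreover have "(\<lambda>x. x \<bullet> b) differentiable (at x)" for x
    unfolding differentiable_def by (auto intro!: derivative_eq_intros exI)
  ultimately show ?thesis using Suc by (simp add: Ck_const)
qed (auto intro!: continuous_intros)

text \<open>By the chain rule each directional derivative is \<open>D'(f x)\<close> times a
  derivative of \<open>f\<close>. The first factor is again a composition with the same inner
  function, so the induction generalises over \<open>D\<close> only.\<close>

lemma Ck_compose:
  fixes D :: "real \<Rightarrow> real" and f :: "'a::euclidean_space \<Rightarrow> real"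
  assumes "Ck k D" "Ck k f"
  shows "Ck k (\<lambda>x. D (f x))"
  using assms
proof (induction k arbitrary: D)
  case 0
  then show ?case by (simp add: continuous_on_compose2[of UNIV D UNIV f])
next
  case (Suc k)
  have hd: "((\<lambda>x. D (f x)) has_derivative
      (\<lambda>b. frechet_derivative D (at (f x)) 1 * frechet_derivative f (at x) b)) (at x)" for x
  proof -
    have "(f has_derivative frechet_derivative f (at x)) (at x)"
      using Suc.prems(2) by (simp add: frechet_derivative_works)
    moreover have D: "(D has_derivative frechet_derivative D (at (f x))) (at (f x))"
      using Suc.prems(1) by (simp add: frechet_derivative_works)
    ultimately have "((\<lambda>x. D (f x)) has_derivative (\<lambda>b. frechet_derivative D (at (f x)) (frechet_derivative f (at x) b))) (at x)"
      by (rule has_derivative_compose)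
    also have "(\<lambda>b. frechet_derivative D (at (f x)) (frechet_derivative f (at x) b)) =
        (\<lambda>b. frechet_derivative D (at (f x)) 1 * frechet_derivative f (at x) b)"
    proof (rule ext)
      fix b
      show "frechet_derivative D (at (f x)) (frechet_derivative f (at x) b) =
          frechet_derivative D (at (f x)) 1 * frechet_derivative f (at x) b"
        using linear_scale[OF has_derivative_linear[OF D], of "frechet_derivative f (at x) b" 1] by simp
    qed
    finally show ?thesis .
  qed
  have "Ck k f" by (rule Ck_Suc_imp[OF Suc.prems(2)])
  then have "Ck k (\<lambda>x. frechet_derivative D (at (f x)) 1)"
    using Suc.prems(1) by (intro Suc.IH[of "\<lambda>s. frechet_derivative D (at s) 1"]) simp_all
  then have "Ck k (\<lambda>x. frechet_derivative D (at (f x)) 1 * frechet_derivative f (at x) b)" if "b \<in> Basis" for b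
    using that Suc.prems by (intro Ck_mult) auto
  moreover have "(\<lambda>x. D (f x)) differentiable (at x)" for x
    using hd unfolding differentiable_def by blast
  moreover have "frechet_derivative (\<lambda>x. D (f x)) (at x) =
     (\<lambda>b. frechet_derivative D (at (f x)) 1 * frechet_derivative f (at x) b)" for x
    by (rule frechet_derivative_at[OF hd, symmetric])
  ultimately show ?case by simp
qed

text \<open>A family closed under differentiation up to linear combinations; each derivative lowers
  the power of \<open>x\<close>, hence integer exponents. The member \<open>j = 0\<close> yields
  bump functions, \<open>j = 1\<close> the smooth substitute for the positive part, and
  \<open>j = - 1\<close> enters the slope of the latter.\<close>

definition flat_exp :: "int \<Rightarrow> real \<Rightarrow> real" where
  "flat_exp j x = (if x > 0 then x powi j * exp (- 1 / x) else 0)"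

text \<open>The substitution \<open>t = 1 / x\<close> moves the limit to infinity, where
  \<open>exp (- t)\<close> beats every power of \<open>t\<close>.\<close>

lemma tendsto_flat_exp_right: "((\<lambda>x. x powi j * exp (- 1 / x)) \<longlongrightarrow> 0) (at_right (0::real))"
proof -
  have "((\<lambda>t. inverse t powi j * exp (- t)) \<longlongrightarrow> 0) (at_top :: real filter)"
  proof (cases "j \<ge> 0")
    case True
    have "((\<lambda>t. inverse t ^ nat j * exp (- t)) \<longlongrightarrow> 0) (at_top :: real filter)"
    proof (rule Lim_null_comparison)
      show "\<forall>\<^sub>F t in at_top. norm (inverse t ^ nat j * exp (- t)) \<le> exp (-t::real)"
        using eventually_ge_at_top[of 1]
        by eventually_elim (auto simp: power_le_one inverse_le_1_iff intro!: mult_left_le_one_le)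
      show "((\<lambda>t. exp (-t::real)) \<longlongrightarrow> 0) at_top"
        by (intro filterlim_compose[OF exp_at_bot] filterlim_uminus_at_bot_at_top)
    qed
    then show ?thesis using True by (simp add: power_int_def)
  next
    case False
    have "((\<lambda>t. t ^ nat (-j) / exp t) \<longlongrightarrow> 0) (at_top :: real filter)"
      by (rule tendsto_power_div_exp_0)
    then show ?thesis using False by (simp add: power_int_def exp_minus divide_inverse)
  qed
  from filterlim_compose[OF this filterlim_inverse_at_top_right]
  show ?thesis by (simp add: divide_inverse)
qed

text \<open>Only 0 needs care: there the difference quotient is the member with exponent
  \<open>j - 1\<close>, which tends to 0 from the right. The factor \<open>1 *\<close> gives both
  summands the shape constant times member of the family, which \<open>Ck_flat_exp\<close>
  exploits.\<close>

lemma flat_exp_derivative: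
  "(flat_exp j has_real_derivative (of_int j * flat_exp (j - 1) x + 1 * flat_exp (j - 2) x)) (at x)"
proof -
  consider "x > 0" | "x < 0" | "x = 0" by linarith
  then show ?thesis
  proof cases
    case 1
    have "((\<lambda>x. x powi j * exp (- 1 / x)) has_real_derivative
       (of_int j * x powi (j - 1)) * exp (- 1 / x) + exp (- 1 / x) * (1 / (x * x)) * x powi j) (at x)"
      using 1 by (auto intro!: derivative_eq_intros)
    moreover have "x powi (j - 2) = x powi j / (x * x)"
      using 1 by (simp add: power_int_diff power2_eq_square)
    ultimately have "((\<lambda>x. x powi j * exp (- 1 / x)) has_real_derivative
       of_int j * flat_exp (j - 1) x + 1 * flat_exp (j - 2) x) (at x)"
      using 1 by (simp add: flat_exp_def mult_ac divide_inverse)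
    then show ?thesis
      by (rule has_field_derivative_transform_within_open[where S="{0<..}"])
        (use 1 in \<open>auto simp: flat_exp_def\<close>)
  next
    case 2
    have "((\<lambda>x. 0) has_real_derivative of_int j * flat_exp (j - 1) x + 1 * flat_exp (j - 2) x) (at x)"
      using 2 by (simp add: flat_exp_def)
    then show ?thesis
      by (rule has_field_derivative_transform_within_open[where S="{..<0}"])
        (use 2 in \<open>auto simp: flat_exp_def\<close>)
  next
    case 3
    have "((\<lambda>y. flat_exp j y / y) \<longlongrightarrow> 0) (at_right 0)"
      using tendsto_flat_exp_right[of "j - 1"]
      by (rule Lim_transform_eventually)
       (auto simp: eventually_at_filter flat_exp_def power_int_diff)
    moreover have "((\<lambda>y. flat_exp j y / y) \<longlongrightarrow> 0) (at_left 0)"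
      by (rule Lim_transform_eventually[OF tendsto_const])
       (auto simp: eventually_at_filter flat_exp_def)
    ultimately have "((\<lambda>y. flat_exp j y / y) \<longlongrightarrow> 0) (at 0)"
      by (simp add: filterlim_split_at)
    then show ?thesis using 3
      by (simp add: has_field_derivative_iff flat_exp_def)
  qed
qed

lemma Ck_flat_exp: "Ck k (flat_exp j)"
proof (induction k arbitrary: j)
  case 0
  then show ?case
    using flat_exp_derivative[of j] DERIV_isCont by (auto intro!: continuous_at_imp_continuous_on)
next
  case (Suc k)
  have hd: "(flat_exp j has_derivative (*) (of_int j * flat_exp (j - 1) x + 1 * flat_exp (j - 2) x)) (at x)" for x
    using flat_exp_derivative[of j x] by (simp add: has_field_derivative_def)
  have "Ck k (\<lambda>x. of_int j * flat_exp (j - 1) x + 1 * flat_exp (j - 2) x)"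
    by (rule Ck_add[OF Ck_mult[OF Ck_const Suc.IH] Ck_mult[OF Ck_const Suc.IH]])
  moreover have "flat_exp j differentiable (at x)" for x
    using hd unfolding differentiable_def by blast
  moreover have "frechet_derivative (flat_exp j) (at x) 1 = of_int j * flat_exp (j - 1) x + 1 * flat_exp (j - 2) x" for x
    using frechet_derivative_at[OF hd[of x]] by (metis mult.right_neutral)
  ultimately show ?case by simp
qed

section \<open>Test functions\<close>

lemma test_function_Ck: "\<phi> \<in> test_functions \<Omega> \<Longrightarrow> Ck k \<phi>"
  by (simp add: test_functions_def)

lemma test_function_has_derivative:
  "\<phi> \<in> test_functions \<Omega> \<Longrightarrow> (\<phi> has_derivative frechet_derivative \<phi> (at x)) (at x)"
  using test_function_Ck[of \<phi> \<Omega> "Suc 0"] by (simp add: frechet_derivative_works)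

lemma continuous_on_test_function: "\<phi> \<in> test_functions \<Omega> \<Longrightarrow> continuous_on UNIV \<phi>"
  using test_function_Ck[of \<phi> \<Omega> 0] by simp

lemma continuous_on_test_function_derivative:
  "\<phi> \<in> test_functions \<Omega> \<Longrightarrow> b \<in> Basis \<Longrightarrow> continuous_on UNIV (\<lambda>x. frechet_derivative \<phi> (at x) b)"
  using test_function_Ck[of \<phi> \<Omega> "Suc 0"] by simp

lemma continuous_on_classical_grad:
  "\<phi> \<in> test_functions \<Omega> \<Longrightarrow> continuous_on UNIV (classical_grad \<phi>)"
  unfolding classical_grad_def[abs_def]
  by (intro continuous_on_sum continuous_on_scaleR continuous_on_test_function_derivative continuous_on_const)

lemma test_function_support:
  assumes "\<phi> \<in> test_functions \<Omega>"
  obtains K where "compact K" "K \<subseteq> \<Omega>" "\<And>x. x \<notin> K \<Longrightarrow> \<phi> x = 0"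
    "\<And>x. x \<notin> K \<Longrightarrow> frechet_derivative \<phi> (at x) = (\<lambda>_. 0)"
proof
  let ?K = "closure {x. \<phi> x \<noteq> 0}"
  show "compact ?K" "?K \<subseteq> \<Omega>" using assms by (auto simp: test_functions_def)
  show *: "\<phi> x = 0" if "x \<notin> ?K" for x
    using that closure_subset[of "{x. \<phi> x \<noteq> 0}"] by auto
  show "frechet_derivative \<phi> (at x) = (\<lambda>_. 0)" if "x \<notin> ?K" for x
  proof (rule frechet_derivative_at[symmetric])
    have "((\<lambda>_. 0) has_derivative (\<lambda>_. 0)) (at x)" by simp
    then show "(\<phi> has_derivative (\<lambda>_. 0)) (at x)"
    proof (rule has_derivative_transform_within_open)
      show "open (- ?K)" by (intro open_Compl closed_closure)
      show "x \<in> - ?K" using that by blast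
      show "0 = \<phi> y" if "y \<in> - ?K" for y using *[of y] that by simp
    qed
  qed
qed

lemma integrable_continuous_compact_support:
  fixes f :: "'a::euclidean_space \<Rightarrow> 'b::{banach, second_countable_topology}"
  assumes "continuous_on UNIV f" "compact K" "\<And>x. x \<notin> K \<Longrightarrow> f x = 0"
  shows "integrable lborel f"
proof -
  have "(\<lambda>x. indicator K x *\<^sub>R f x) = f"
    using assms(3) by (auto simp: indicator_def)
  then show ?thesis
    using borel_integrable_compact[OF assms(2) continuous_on_subset[OF assms(1)]] by simp
qed

lemma bounded_continuous_compact_support:
  fixes f :: "'a::euclidean_space \<Rightarrow> 'b::real_normed_vector"
  assumes "continuous_on UNIV f" "compact K" "\<And>x. x \<notin> K \<Longrightarrow> f x = 0"
  obtains B where "B > 0" "\<And>x. norm (f x) \<le> B"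
proof -
  have "bounded (f ` K)"
    using assms by (intro compact_imp_bounded compact_continuous_image continuous_on_subset[OF assms(1)]) auto
  then obtain B where "B > 0" "\<And>x. x \<in> K \<Longrightarrow> norm (f x) \<le> B"
    by (auto simp: bounded_pos)
  moreover have "norm (f x) \<le> B" if "x \<notin> K" for x
    using assms(3)[OF that] \<open>B > 0\<close> by simp
  ultimately show ?thesis using that by blast
qed

lemma integral_lebesgue_on_eq_lborel:
  fixes f :: "'a::euclidean_space \<Rightarrow> 'b::{banach, second_countable_topology}"
  assumes "\<Omega> \<in> sets lebesgue" "f \<in> borel_measurable borel" "\<And>x. x \<notin> \<Omega> \<Longrightarrow> f x = 0"
  shows "integral\<^sup>L (lebesgue_on \<Omega>) f = integral\<^sup>L lborel f"
    and "integrable (lebesgue_on \<Omega>) f \<longleftrightarrow> integrable lborel f"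
proof -
  have *: "(\<lambda>x. indicator \<Omega> x *\<^sub>R f x) = f"
    using assms(3) by (auto simp: indicator_def)
  show "integral\<^sup>L (lebesgue_on \<Omega>) f = integral\<^sup>L lborel f"
    using assms by (simp add: integral_restrict_space * integral_completion)
  show "integrable (lebesgue_on \<Omega>) f \<longleftrightarrow> integrable lborel f"
    using assms by (simp add: integrable_restrict_space * integrable_completion)
qed

section \<open>Integration by parts for test functions\<close>

lemma has_derivative_along_line:
  assumes "(F has_derivative F') (at (x + t *\<^sub>R b))"
  shows "((\<lambda>t. F (x + t *\<^sub>R b)) has_real_derivative F' b) (at t)"
proof -
  have "((\<lambda>t. x + t *\<^sub>R b) has_derivative (\<lambda>h. h *\<^sub>R b)) (at t)"
    by (auto intro!: derivative_eq_intros)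
  from has_derivative_compose[OF this assms]
  have "((\<lambda>t. F (x + t *\<^sub>R b)) has_derivative (\<lambda>h. F' (h *\<^sub>R b))) (at t)" .
  moreover have "(\<lambda>h. F' (h *\<^sub>R b)) = (*) (F' b)"
    using linear_scale[OF has_derivative_linear[OF assms]] by (simp add: fun_eq_iff)
  ultimately show ?thesis by (simp add: has_field_derivative_def)
qed

text \<open>Translation invariance makes the integrals of the difference quotients vanish.\<close>

lemma integral_derivative_compact_support:
  fixes F :: "'a::euclidean_space \<Rightarrow> real"
  assumes d: "\<And>x. (F has_derivative F' x) (at x)" and c: "continuous_on UNIV (\<lambda>x. F' x b)"
    and K: "compact K" "\<And>x. x \<notin> K \<Longrightarrow> F x = 0" "\<And>x. x \<notin> K \<Longrightarrow> F' x b = 0"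
    and b: "norm b = 1"
  shows "(\<integral>x. F' x b \<partial>lborel) = 0"
proof -
  define D where "D n x = (F (x + inverse (real (Suc n)) *\<^sub>R b) - F x) * real (Suc n)" for n x
  obtain B where B: "B > 0" "\<And>x. \<bar>F' x b\<bar> \<le> B"
    using bounded_continuous_compact_support[OF c K(1) K(3)] by auto
  obtain R where R: "K \<subseteq> cball 0 R"
    using compact_imp_bounded[OF K(1)] by (auto simp: bounded_iff subset_iff)
  have cF: "continuous_on UNIV F"
    using d by (intro continuous_at_imp_continuous_on ballI has_derivative_continuous) auto
  have iF: "integrable lborel F"
    by (rule integrable_continuous_compact_support[OF cF K(1,2)])
  have [measurable]: "F \<in> borel_measurable borel" "(\<lambda>x. F' x b) \<in> borel_measurable borel"
    using cF c by (auto intro: borel_measurable_continuous_onI)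
  have tr: "integrable lborel (\<lambda>x. F (x + c))" "(\<integral>x. F (x + c) \<partial>lborel) = (\<integral>x. F x \<partial>lborel)" for c
  proof -
    have "integrable (distr lborel borel ((+) c)) F"
      by (simp add: lborel_distr_plus iF)
    then show "integrable lborel (\<lambda>x. F (x + c))"
      by (subst (asm) integrable_distr_eq) (auto simp: add.commute)
    have "(\<integral>x. F x \<partial>(distr lborel borel ((+) c))) = (\<integral>x. F (x + c) \<partial>lborel)"
      by (subst integral_distr) (auto simp: add.commute)
    then show "(\<integral>x. F (x + c) \<partial>lborel) = (\<integral>x. F x \<partial>lborel)"
      by (simp add: lborel_distr_plus)
  qed
  have lim: "(\<lambda>n. D n x) \<longlonglongrightarrow> F' x b" for x
  proof -
    have "((\<lambda>t. F (x + t *\<^sub>R b)) has_real_derivative F' x b) (at 0)"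
      by (rule has_derivative_along_line) (simp add: d)
    then have "((\<lambda>h. (F (x + h *\<^sub>R b) - F x) / h) \<longlongrightarrow> F' x b) (at 0)"
      by (simp add: has_field_derivative_iff)
    moreover have "filterlim (\<lambda>n. inverse (real (Suc n))) (at 0) sequentially"
      using LIMSEQ_inverse_real_of_nat by (auto simp: filterlim_at)
    ultimately have "(\<lambda>n. (F (x + inverse (real (Suc n)) *\<^sub>R b) - F x) / inverse (real (Suc n))) \<longlonglongrightarrow> F' x b"
      by (rule filterlim_compose)
    then show ?thesis by (simp add: D_def divide_inverse)
  qed
  \<comment> \<open>By the mean value theorem \<open>D n x\<close> is a value of the derivative at
    distance less than 1 from \<open>x\<close>. This gives the bound \<open>B\<close> and a common
    support of radius \<open>R + 1\<close>.\<close>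
  have bd: "norm (D n x) \<le> B * indicator (cball 0 (R + 1)) x" for n x
  proof -
    let ?h = "inverse (real (Suc n))"
    have h: "0 < ?h" "?h \<le> 1" by (auto simp: field_simps)
    obtain z where z: "0 < z" "z < ?h" "F (x + ?h *\<^sub>R b) - F (x + 0 *\<^sub>R b) = (?h - 0) * F' (x + z *\<^sub>R b) b"
      using MVT2[OF h(1), of "\<lambda>t. F (x + t *\<^sub>R b)" "\<lambda>t. F' (x + t *\<^sub>R b) b"]
        has_derivative_along_line[OF d] by blast
    then have "F (x + ?h *\<^sub>R b) - F x = ?h * F' (x + z *\<^sub>R b) b" by simp
    then have D: "D n x = F' (x + z *\<^sub>R b) b"
      by (simp add: D_def)
    show ?thesis
    proof (cases "x \<in> cball 0 (R + 1)")
      case True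
      then show ?thesis using B(2) by (simp add: D)
    next
      case False
      have "norm x \<le> norm (x + z *\<^sub>R b) + z"
        using norm_triangle_ineq4[of "x + z *\<^sub>R b" "z *\<^sub>R b"] z b by simp
      then have "x + z *\<^sub>R b \<notin> K"
        using False R z h by auto
      then show ?thesis using K(3) False by (simp add: D)
    qed
  qed
  have [measurable]: "D n \<in> borel_measurable borel" for n
    unfolding D_def by measurable
  have "(\<lambda>n. \<integral>x. D n x \<partial>lborel) \<longlonglongrightarrow> (\<integral>x. F' x b \<partial>lborel)"
    by (rule integral_dominated_convergence[where w="\<lambda>x. B * indicator (cball 0 (R + 1)) x"])
      (use lim bd in \<open>auto intro!: emeasure_bounded_finite\<close>)
  moreover have "(\<integral>x. D n x \<partial>lborel) = 0" for n
    unfolding D_def using tr iF by (simp add: integral_diff)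
  ultimately show ?thesis by (simp add: LIMSEQ_const_iff)
qed

text \<open>The derivative of the compactly supported product integrates to 0. Thus the classical
  gradient of a test function is a weak gradient, an identity that survives limits in
  \<open>L\<^sup>p\<close>.\<close>

lemma test_function_integration_by_parts:
  fixes \<phi> \<psi> :: "'a::euclidean_space \<Rightarrow> real"
  assumes \<phi>: "\<phi> \<in> test_functions \<Omega>" and \<psi>: "\<psi> \<in> test_functions \<Omega>" and b: "b \<in> Basis"
    and \<Omega>: "open \<Omega>"
  shows "(\<integral>x. \<phi> x * frechet_derivative \<psi> (at x) b \<partial>(lebesgue_on \<Omega>)) =
    - (\<integral>x. frechet_derivative \<phi> (at x) b * \<psi> x \<partial>(lebesgue_on \<Omega>))"
proof -
  obtain K where K: "compact K" "K \<subseteq> \<Omega>" "\<And>x. x \<notin> K \<Longrightarrow> \<phi> x = 0"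
    "\<And>x. x \<notin> K \<Longrightarrow> frechet_derivative \<phi> (at x) = (\<lambda>_. 0)"
    using test_function_support[OF \<phi>] by metis
  note cont = continuous_on_test_function[OF \<phi>] continuous_on_test_function_derivative[OF \<phi> b]
    continuous_on_test_function[OF \<psi>] continuous_on_test_function_derivative[OF \<psi> b]
  have c1: "continuous_on UNIV (\<lambda>x. \<phi> x * frechet_derivative \<psi> (at x) b)"
    and c2: "continuous_on UNIV (\<lambda>x. frechet_derivative \<phi> (at x) b * \<psi> x)"
    by (intro continuous_on_mult cont)+
  have "(\<integral>x. \<phi> x * frechet_derivative \<psi> (at x) b + frechet_derivative \<phi> (at x) b * \<psi> x \<partial>lborel) = 0"
    by (rule integral_derivative_compact_support[where F="\<lambda>x. \<phi> x * \<psi> x" and K=K])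
      (use K b continuous_on_add[OF c1 c2] in
       \<open>auto intro!: has_derivative_mult test_function_has_derivative[OF \<phi>] test_function_has_derivative[OF \<psi>]\<close>)
  moreover have "integrable lborel (\<lambda>x. \<phi> x * frechet_derivative \<psi> (at x) b)"
    "integrable lborel (\<lambda>x. frechet_derivative \<phi> (at x) b * \<psi> x)"
    using c1 c2 K by (auto intro!: integrable_continuous_compact_support)
  ultimately have "(\<integral>x. \<phi> x * frechet_derivative \<psi> (at x) b \<partial>lborel) +
     (\<integral>x. frechet_derivative \<phi> (at x) b * \<psi> x \<partial>lborel) = 0"
    by simp
  moreover have "(\<integral>x. \<phi> x * frechet_derivative \<psi> (at x) b \<partial>(lebesgue_on \<Omega>)) =
     (\<integral>x. \<phi> x * frechet_derivative \<psi> (at x) b \<partial>lborel)"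
    using K \<Omega> c1 by (intro integral_lebesgue_on_eq_lborel) (auto intro: borel_measurable_continuous_onI)
  moreover have "(\<integral>x. frechet_derivative \<phi> (at x) b * \<psi> x \<partial>(lebesgue_on \<Omega>)) =
     (\<integral>x. frechet_derivative \<phi> (at x) b * \<psi> x \<partial>lborel)"
  proof (rule integral_lebesgue_on_eq_lborel)
    show "frechet_derivative \<phi> (at x) b * \<psi> x = 0" if "x \<notin> \<Omega>" for x
    proof -
      have "x \<notin> K" using that K(2) by blast
      then show ?thesis by (simp add: K(4))
    qed
  qed (use \<Omega> c2 in \<open>auto intro: borel_measurable_continuous_onI\<close>)
  ultimately show ?thesis by simp
qed

section \<open>The fundamental lemma of the calculus of variations\<close>

lemma box_bump:
  fixes c d :: "'a::euclidean_space"
  assumes "cbox c d \<subseteq> \<Omega>"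
  obtains \<phi> where "\<And>n::nat. \<phi> n \<in> test_functions \<Omega>" "\<And>n x. x \<notin> box c d \<Longrightarrow> \<phi> n x = 0"
    "\<And>n x. \<bar>\<phi> n x\<bar> \<le> 1" "\<And>x. x \<in> box c d \<Longrightarrow> (\<lambda>n. \<phi> n x) \<longlonglongrightarrow> 1"
proof -
  \<comment> \<open>Inside the box every factor has the form \<open>exp (- 1 / (n * s))\<close> with
    \<open>s > 0\<close> and tends to 1; outside, some factor is 0. Differences are written as sums
    and multiples to match \<open>Ck_add\<close> and \<open>Ck_mult\<close>.\<close>
  define \<phi> where "\<phi> n x = (\<Prod>b\<in>Basis. flat_exp 0 (real n * (x \<bullet> b + - c \<bullet> b)) *
    flat_exp 0 (real n * (d \<bullet> b + (-1) * (x \<bullet> b))))" for n and x :: 'a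
  have smooth: "Ck k (\<phi> n)" for k n
    unfolding \<phi>_def by (intro Ck_prod Ck_mult Ck_compose[OF Ck_flat_exp] Ck_add Ck_inner Ck_const finite_Basis)
  have supp: "\<phi> n x = 0" if "x \<notin> box c d" for n x
  proof -
    obtain b where "b \<in> Basis" "x \<bullet> b \<le> c \<bullet> b \<or> d \<bullet> b \<le> x \<bullet> b"
      using \<open>x \<notin> box c d\<close> by (auto simp: box_def not_less)
    then have "\<exists>b\<in>Basis. flat_exp 0 (real n * (x \<bullet> b + - c \<bullet> b)) * flat_exp 0 (real n * (d \<bullet> b + (-1) * (x \<bullet> b))) = 0"
      by (intro bexI[of _ b]) (auto simp: flat_exp_def zero_less_mult_iff)
    then show ?thesis unfolding \<phi>_def by (simp add: prod_zero_iff)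
  qed
  have "closure {x. \<phi> n x \<noteq> 0} \<subseteq> cbox c d" for n
    using supp box_subset_cbox[of c d] by (intro closure_minimal) auto
  then have "\<phi> n \<in> test_functions \<Omega>" for n
    using smooth assms compact_cbox[of c d] unfolding test_functions_def
    by (simp add: compact_eq_bounded_closed) (meson bounded_cbox bounded_subset order_trans)
  moreover have flat: "\<bar>flat_exp 0 y\<bar> \<le> 1" for y by (simp add: flat_exp_def)
  have "\<bar>\<phi> n x\<bar> \<le> 1" for n x
    unfolding \<phi>_def abs_prod abs_mult
    by (intro prod_le_1 conjI mult_nonneg_nonneg abs_ge_zero mult_le_one flat)
  moreover have "(\<lambda>n. \<phi> n x) \<longlonglongrightarrow> 1" if "x \<in> box c d" for x
  proof -
    have *: "(\<lambda>n. flat_exp 0 (real n * s)) \<longlonglongrightarrow> 1" if "s > 0" for s :: real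
    proof -
      have "(\<lambda>n. - inverse s * inverse (real n)) \<longlonglongrightarrow> - inverse s * 0"
        by (intro tendsto_intros lim_inverse_n)
      then have "(\<lambda>n. exp (- inverse s * inverse (real n))) \<longlonglongrightarrow> 1"
        by (auto dest: tendsto_exp)
      then show ?thesis
        by (rule Lim_transform_eventually)
          (use that in \<open>auto simp: flat_exp_def divide_inverse intro!: eventually_sequentiallyI[of 1]\<close>)
    qed
    have "(\<lambda>n. \<phi> n x) \<longlonglongrightarrow> (\<Prod>b\<in>(Basis::'a set). 1 * 1)"
      unfolding \<phi>_def by (intro tendsto_prod tendsto_mult *) (use that in \<open>auto simp: box_def\<close>)
    then show ?thesis by simp
  qed
  ultimately show ?thesis using that supp by blast
qed

text \<open>A Dynkin argument: open boxes are stable under intersection and generate the Borel sets,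
  and the sets with integral 0 are closed under complements and countable disjoint unions.
  Complements require that the total integral is 0, which follows by exhausting the space with
  boxes.\<close>

lemma AE_zero_if_box_integrals_zero:
  fixes f :: "'a::euclidean_space \<Rightarrow> real"
  assumes int: "integrable lborel f" and box: "\<And>d e. (LINT x:box d e|lborel. f x) = 0"
  shows "AE x in lborel. f x = 0"
proof (rule sigma_finite_measure.density_zero[OF sigma_finite_lborel int])
  fix A assume "A \<in> sets (lborel :: 'a measure)"
  then have A: "A \<in> sigma_sets UNIV (range (\<lambda>(a, b). box a b :: 'a set))"
    by (simp add: borel_eq_box)
  have *: "set_integrable lborel X f" if "X \<in> sigma_sets UNIV (range (\<lambda>(a, b). box a b :: 'a set))" for X
    unfolding set_integrable_def using that int
    by (intro integrable_mult_indicator) (simp_all add: borel_eq_box)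
  have UNIV: "integral\<^sup>L lborel f = 0"
  proof -
    let ?A = "\<lambda>n::nat. box (- (real n *\<^sub>R One)) (real n *\<^sub>R One) :: 'a set"
    have "(\<lambda>n. \<integral>x. indicator (?A n) x *\<^sub>R f x \<partial>lborel) \<longlonglongrightarrow> integral\<^sup>L lborel f"
    proof (rule integral_dominated_convergence[where w="\<lambda>x. norm (f x)"])
      show "AE x in lborel. (\<lambda>n. indicator (?A n) x *\<^sub>R f x) \<longlonglongrightarrow> f x"
      proof (rule AE_I2)
        fix x :: 'a
        have "\<exists>n. x \<in> ?A n"
          using UN_box_eq_UNIV by blast
        then obtain n where n: "x \<in> ?A n" by blast
        have "?A n \<subseteq> ?A m" if "n \<le> m" for m
          using that by (intro subset_box_imp) auto
        then have "x \<in> ?A m" if "n \<le> m" for m using n that by blast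
        then show "(\<lambda>n. indicator (?A n) x *\<^sub>R f x) \<longlonglongrightarrow> f x"
          by (intro tendsto_eventually eventually_sequentiallyI[of n]) simp
      qed
    qed (use int in \<open>auto simp: indicator_def\<close>)
    then show ?thesis
      using box by (simp add: set_lebesgue_integral_def LIMSEQ_const_iff)
  qed
  have "Int_stable (range (\<lambda>(a, b). box a b :: 'a set))"
    by (auto simp: Int_stable_def box_Int_box)
  from this subset_UNIV[of "range (\<lambda>(a, b). box a b :: 'a set)", folded Pow_UNIV] A show "set_lebesgue_integral lborel A f = 0"
  proof (induction rule: sigma_sets_induct_disjoint)
    case (compl A)
    have "(LINT x:UNIV - A|lborel. f x) = (\<integral>x. f x - indicator A x *\<^sub>R f x \<partial>lborel)"
      unfolding set_lebesgue_integral_def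
      by (rule Bochner_Integration.integral_cong) (auto simp: indicator_def)
    also have "\<dots> = 0"
      using *[OF compl(1)] compl(2) int UNIV by (simp add: set_integrable_def set_lebesgue_integral_def)
    finally show ?case .
  next
    case (union A)
    have "(\<Union>i. A i) \<in> sigma_sets UNIV (range (\<lambda>(a, b). box a b :: 'a set))"
      using union(2) by (intro sigma_sets.Union) auto
    then have "(LINT x:(\<Union>i. A i)|lborel. f x) = (\<Sum>i. LINT x:A i|lborel. f x)"
      using union(1,2) *
      by (intro lebesgue_integral_countable_add)
         (auto simp: borel_eq_box disjoint_family_on_def)
    then show ?case using union(3) by simp
  qed (use box in \<open>auto simp: set_lebesgue_integral_def\<close>)
qed

text \<open>Bumps converge boundedly to the indicator of a box, so \<open>g\<close> has integral 0
  over every box whose closed box lies in \<Omega>. This forces \<open>g = 0\<close> almost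
  everywhere on each such box, and countably many of their closed boxes cover \<Omega>, the faces
  being negligible.\<close>

lemma fundamental_lemma_calculus_of_variations:
  fixes g :: "'a::euclidean_space \<Rightarrow> real"
  assumes \<Omega>: "open \<Omega>" and g: "locally_integrable \<Omega> g"
    and zero: "\<And>\<phi>. \<phi> \<in> test_functions \<Omega> \<Longrightarrow> (\<integral>x. g x * \<phi> x \<partial>(lebesgue_on \<Omega>)) = 0"
  shows "AE x in lebesgue_on \<Omega>. g x = 0"
proof -
  have gi: "integrable lebesgue (\<lambda>x. indicator (cbox a c) x *\<^sub>R g x)" if "cbox a c \<subseteq> \<Omega>" for a c
    using g that unfolding locally_integrable_def
    by (subst integrable_restrict_space[symmetric]) auto
  have box0: "(\<integral>x. indicator (box d e) x *\<^sub>R g x \<partial>lebesgue) = 0" if de: "cbox d e \<subseteq> \<Omega>" for d e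
  proof -
    obtain \<phi> where \<phi>: "\<And>n::nat. \<phi> n \<in> test_functions \<Omega>" "\<And>n x. x \<notin> box d e \<Longrightarrow> \<phi> n x = 0"
      "\<And>n x. \<bar>\<phi> n x\<bar> \<le> 1" "\<And>x. x \<in> box d e \<Longrightarrow> (\<lambda>n. \<phi> n x) \<longlonglongrightarrow> 1"
      using box_bump[OF de] by blast
    have eq: "indicator \<Omega> x *\<^sub>R (g x * \<phi> n x) = (indicator (cbox d e) x *\<^sub>R g x) * \<phi> n x" for n x
      using \<phi>(2)[of x n] de box_subset_cbox[of d e] by (auto simp: indicator_def)
    have [measurable]: "\<phi> n \<in> borel_measurable lebesgue" for n
      using borel_measurable_continuous_onI[OF continuous_on_test_function[OF \<phi>(1)[of n]]]
      by (intro measurable_completion) simp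
    have gm: "(\<lambda>x. indicator (cbox d e) x *\<^sub>R g x) \<in> borel_measurable lebesgue"
      using gi[OF de] by simp
    have bm: "(\<lambda>x. indicator (box d e) x *\<^sub>R g x) \<in> borel_measurable lebesgue"
    proof -
      have "(\<lambda>x. indicator (box d e) x *\<^sub>R g x) = (\<lambda>x. indicator (box d e) x *\<^sub>R (indicator (cbox d e) x *\<^sub>R g x))"
        using box_subset_cbox[of d e] by (auto simp: indicator_def fun_eq_iff)
      also have "\<dots> \<in> borel_measurable lebesgue"
        by (intro borel_measurable_scaleR[OF borel_measurable_indicator gm]) auto
      finally show ?thesis .
    qed
    have "(\<lambda>n. \<integral>x. (indicator (cbox d e) x *\<^sub>R g x) * \<phi> n x \<partial>lebesgue) \<longlonglongrightarrow>
       (\<integral>x. indicator (box d e) x *\<^sub>R g x \<partial>lebesgue)"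
    proof (rule integral_dominated_convergence[where w="\<lambda>x. norm (indicator (cbox d e) x *\<^sub>R g x)"])
      show "AE x in lebesgue. (\<lambda>n. (indicator (cbox d e) x *\<^sub>R g x) * \<phi> n x) \<longlonglongrightarrow> indicator (box d e) x *\<^sub>R g x"
      proof (rule AE_I2)
        fix x
        show "(\<lambda>n. (indicator (cbox d e) x *\<^sub>R g x) * \<phi> n x) \<longlonglongrightarrow> indicator (box d e) x *\<^sub>R g x"
        proof (cases "x \<in> box d e")
          case True
          then show ?thesis
            using tendsto_mult_left[OF \<phi>(4)[OF True], of "g x"] box_subset_cbox[of d e] by auto
        qed (simp add: \<phi>(2))
      qed
      show "AE x in lebesgue. norm ((indicator (cbox d e) x *\<^sub>R g x) * \<phi> n x) \<le> norm (indicator (cbox d e) x *\<^sub>R g x)" for n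
        using \<phi>(3)[of n] by (auto simp: abs_mult intro!: mult_left_le)
      show "(\<lambda>x. (indicator (cbox d e) x *\<^sub>R g x) * \<phi> n x) \<in> borel_measurable lebesgue" for n
        using gm by measurable
    qed (use gi[OF de] bm in auto)
    moreover have "(\<integral>x. (indicator (cbox d e) x *\<^sub>R g x) * \<phi> n x \<partial>lebesgue) = 0" for n
      using zero[OF \<phi>(1)[of n]] \<Omega> by (simp add: integral_restrict_space eq del: real_scaleR_def)
    ultimately show ?thesis by (simp add: LIMSEQ_const_iff)
  qed
  have ae_box: "AE x in lebesgue. x \<in> box a c \<longrightarrow> g x = 0" if ac: "cbox a c \<subseteq> \<Omega>" for a c
  proof -
    define H where "H x = indicator (box a c) x * (indicator (cbox a c) x *\<^sub>R g x)" for x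
    have H: "integrable lebesgue H"
      unfolding H_def using integrable_mult_indicator[OF _ gi[OF ac], of "box a c"] by simp
    \<comment> \<open>The Dynkin argument runs on Borel sets, whereas \<open>H\<close> is only
      Lebesgue measurable; hence a Borel representative.\<close>
    obtain H' where H'[measurable]: "H' \<in> borel_measurable lborel" and ae: "AE x in lborel. H x = H' x"
      using completion_ex_borel_measurable_real[of H lborel] H by auto
    have ael: "AE x in lebesgue. H x = H' x" by (rule AE_completion[OF ae])
    have mH': "H' \<in> borel_measurable lebesgue" by (rule measurable_completion) simp
    have "integrable lebesgue H'"
      using H mH' ael by (subst integrable_cong_AE[of _ _ H]) auto
    then have int: "integrable lborel H'" by (simp add: integrable_completion)
    have "AE x in lborel. H' x = 0"
    proof (rule AE_zero_if_box_integrals_zero[OF int])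
      fix d e :: 'a
      obtain d' e' where de': "box d e \<inter> box a c = box d' e'" by (simp add: box_Int_box)
      have "(LINT x:box d e|lborel. H' x) = (\<integral>x. indicator (box d e) x *\<^sub>R H' x \<partial>lebesgue)"
        unfolding set_lebesgue_integral_def by (subst integral_completion) auto
      also have "\<dots> = (\<integral>x. indicator (box d e) x *\<^sub>R H x \<partial>lebesgue)"
        using H mH' ael by (intro integral_cong_AE borel_measurable_scaleR[OF borel_measurable_indicator]) auto
      also have "\<dots> = (\<integral>x. indicator (box d' e') x *\<^sub>R g x \<partial>lebesgue)"
        using box_subset_cbox[of a c] de'[symmetric]
        by (intro Bochner_Integration.integral_cong) (auto simp: H_def indicator_def)
      also have "\<dots> = 0"
      \<comment> \<open>If the open box is empty, the closed one may be degenerate and leave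
        \<Omega>; otherwise it is the closure of the open box and stays in
        \<open>cbox a c\<close>.\<close>
      proof (cases "box d' e' = {}")
        case False
        have "cbox d' e' = closure (box d' e')" using False by (simp add: closure_box)
        also have "\<dots> \<subseteq> cbox a c"
          using de' box_subset_cbox[of a c] by (intro closure_minimal) auto
        finally show ?thesis using box0 ac by blast
      qed simp
      finally show "(LINT x:box d e|lborel. H' x) = 0" .
    qed
    then have "AE x in lborel. H x = 0" using ae by eventually_elim simp
    then have "AE x in lebesgue. H x = 0" by (rule AE_completion)
    then show ?thesis
      by eventually_elim (use box_subset_cbox[of a c] in \<open>auto simp: H_def\<close>)
  qed
  obtain D where D: "countable D" "D \<subseteq> Pow \<Omega>" "\<And>X. X \<in> D \<Longrightarrow> \<exists>a b. X = cbox a b" "\<Union>D = \<Omega>"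
    using open_countable_Union_open_cbox[OF \<Omega>] by metis
  have ae_cbox: "AE x in lebesgue. x \<in> X \<longrightarrow> g x = 0" if X: "X \<in> D" for X
  proof -
    obtain a c where ac: "X = cbox a c" using D(3)[OF X] by blast
    have "negligible (cbox a c - box a c)" by (rule negligible_frontier_interval)
    then have "AE x in lebesgue. x \<notin> cbox a c - box a c"
      by (intro AE_not_in) (simp add: negligible_iff_null_sets)
    moreover have "AE x in lebesgue. x \<in> box a c \<longrightarrow> g x = 0"
      using ac D(2) X by (intro ae_box) blast
    ultimately show ?thesis unfolding ac by eventually_elim blast
  qed
  have "AE x in lebesgue. \<forall>X\<in>D. x \<in> X \<longrightarrow> g x = 0"
    using ae_cbox by (subst AE_ball_countable[OF D(1)]) blast
  then have "AE x in lebesgue. x \<in> \<Omega> \<longrightarrow> g x = 0"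
    by eventually_elim (use D(4) in blast)
  then show ?thesis using \<Omega> by (simp add: AE_restrict_space_iff)
qed

section \<open>Uniqueness of weak gradients\<close>

lemma integrable_mult_test_function:
  assumes \<Omega>: "open \<Omega>" and g: "locally_integrable \<Omega> g" and c: "continuous_on UNIV \<phi>"
    and K: "compact K" "K \<subseteq> \<Omega>" "\<And>x. x \<notin> K \<Longrightarrow> \<phi> x = 0"
  shows "integrable (lebesgue_on \<Omega>) (\<lambda>x. (g x :: real) * \<phi> x)"
proof -
  obtain B where B: "\<And>x. \<bar>\<phi> x\<bar> \<le> B"
    using bounded_continuous_compact_support[OF c K(1,3)] by auto
  have "integrable (lebesgue_on K) g"
    using g K by (simp add: locally_integrable_def)
  then have gi: "integrable lebesgue (\<lambda>x. indicator K x *\<^sub>R g x)"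
    using K compact_imp_closed[OF K(1)] by (subst (asm) integrable_restrict_space) auto
  have "\<phi> \<in> borel_measurable lebesgue"
    using borel_measurable_continuous_onI[OF c] by (intro measurable_completion) simp
  then have i: "integrable lebesgue (\<lambda>x. \<phi> x * (indicator K x *\<^sub>R g x))"
  proof (intro Bochner_Integration.integrable_bound[OF integrable_mult_right[OF gi, of B]] AE_I2)
    show "norm (\<phi> x * (indicator K x *\<^sub>R g x)) \<le> norm (B * (indicator K x *\<^sub>R g x))" for x
      unfolding norm_mult by (intro mult_right_mono) (use B[of x] in auto)
  qed (use gi in \<open>auto intro: borel_measurable_times\<close>)
  have "(\<lambda>x. \<phi> x * (indicator K x *\<^sub>R g x)) = (\<lambda>x. indicator \<Omega> x *\<^sub>R (g x * \<phi> x))"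
    using K by (auto simp: indicator_def fun_eq_iff)
  then show ?thesis
    using \<Omega> i by (subst integrable_restrict_space) auto
qed

lemma locally_integrable_diff:
  "locally_integrable \<Omega> f \<Longrightarrow> locally_integrable \<Omega> g \<Longrightarrow> locally_integrable \<Omega> (\<lambda>x. f x - g x)"
  by (simp add: locally_integrable_def)

lemma locally_integrable_inner:
  "locally_integrable \<Omega> f \<Longrightarrow> locally_integrable \<Omega> (\<lambda>x. f x \<bullet> b)"
  by (simp add: locally_integrable_def)

text \<open>The fundamental lemma applies to each coordinate of the difference. Since
  \<open>weak_grad\<close> is an arbitrary choice, this is the only way to replace it by a gradient
  that has been computed.\<close>

lemma has_weak_grad_unique:
  fixes g h :: "'a::euclidean_space \<Rightarrow> 'a"
  assumes \<Omega>: "open \<Omega>" and g: "has_weak_grad \<Omega> u g" and h: "has_weak_grad \<Omega> u h"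
  shows "AE x in lebesgue_on \<Omega>. g x = h x"
proof -
  have "AE x in lebesgue_on \<Omega>. g x \<bullet> b - h x \<bullet> b = 0" if b: "b \<in> Basis" for b
  proof (rule fundamental_lemma_calculus_of_variations[OF \<Omega>])
    have li: "locally_integrable \<Omega> (\<lambda>x. g x \<bullet> b)" "locally_integrable \<Omega> (\<lambda>x. h x \<bullet> b)"
      using g h by (auto simp: has_weak_grad_def intro: locally_integrable_inner)
    then show "locally_integrable \<Omega> (\<lambda>x. g x \<bullet> b - h x \<bullet> b)" by (rule locally_integrable_diff)
    fix \<phi> assume \<phi>: "\<phi> \<in> test_functions \<Omega>"
    obtain K where K: "compact K" "K \<subseteq> \<Omega>" "\<And>x. x \<notin> K \<Longrightarrow> \<phi> x = 0"
      using test_function_support[OF \<phi>] by metis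
    note I = integrable_mult_test_function[OF \<Omega> _ continuous_on_test_function[OF \<phi>] K]
    have "- (\<integral>x. (g x \<bullet> b) * \<phi> x \<partial>(lebesgue_on \<Omega>)) = - (\<integral>x. (h x \<bullet> b) * \<phi> x \<partial>(lebesgue_on \<Omega>))"
      using g h \<phi> b unfolding has_weak_grad_def by simp
    then have "(\<integral>x. (g x \<bullet> b) * \<phi> x \<partial>(lebesgue_on \<Omega>)) = (\<integral>x. (h x \<bullet> b) * \<phi> x \<partial>(lebesgue_on \<Omega>))"
      by simp
    then show "(\<integral>x. (g x \<bullet> b - h x \<bullet> b) * \<phi> x \<partial>(lebesgue_on \<Omega>)) = 0"
      using I[OF li(1)] I[OF li(2)] by (simp add: left_diff_distrib)
  qed
  then have "AE x in lebesgue_on \<Omega>. \<forall>b\<in>Basis. g x \<bullet> b - h x \<bullet> b = 0"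
    by (subst AE_finite_all) auto
  then show ?thesis
    by eventually_elim (auto intro: euclidean_eqI)
qed

lemma has_weak_grad_weak_grad: "has_weak_grad \<Omega> u g \<Longrightarrow> has_weak_grad \<Omega> u (weak_grad \<Omega> u)"
  unfolding weak_grad_def by (rule someI[of "has_weak_grad \<Omega> u"])

lemma weak_grad_AE:
  "open \<Omega> \<Longrightarrow> has_weak_grad \<Omega> u g \<Longrightarrow> AE x in lebesgue_on \<Omega>. weak_grad \<Omega> u x = g x"
  by (rule has_weak_grad_unique[OF _ has_weak_grad_weak_grad])

section \<open>Convergence in Lebesgue spaces\<close>

text \<open>Convergence to 0 in \<open>L\<^sup>p\<close> with membership built in, and with neither
  the root nor extended real values; \<open>Lnorm_tendsto_0_iff\<close> links it to the
  norm.\<close>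

definition Lp_null :: "'a measure \<Rightarrow> real \<Rightarrow> (nat \<Rightarrow> 'a \<Rightarrow> 'b::euclidean_space) \<Rightarrow> bool" where
  "Lp_null M p h \<longleftrightarrow> (\<forall>n. h n \<in> borel_measurable M \<and> integrable M (\<lambda>x. norm (h n x) powr p)) \<and>
     (\<lambda>n. \<integral>x. norm (h n x) powr p \<partial>M) \<longlonglongrightarrow> 0"

lemma powr_add_le:
  assumes "0 \<le> a" "0 \<le> b" "0 \<le> (p::real)"
  shows "(a + b) powr p \<le> 2 powr p * (a powr p + b powr p)"
proof -
  have "(a + b) powr p \<le> (2 * max a b) powr p"
    using assms by (intro powr_mono2) auto
  also have "\<dots> = 2 powr p * (max a b) powr p"
    using assms by (simp add: powr_mult)
  also have "(max a b) powr p \<le> a powr p + b powr p" by (auto simp: max_def)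
  finally show ?thesis by (simp add: mult_left_mono)
qed

lemma integrable_norm_powr_add:
  fixes f g :: "'a \<Rightarrow> 'b::euclidean_space"
  assumes [measurable]: "f \<in> borel_measurable M" "g \<in> borel_measurable M"
    and i: "integrable M (\<lambda>x. norm (f x) powr p)" "integrable M (\<lambda>x. norm (g x) powr p)" and p: "0 \<le> p"
  shows "integrable M (\<lambda>x. norm (f x + g x) powr p)"
    and "(\<integral>x. norm (f x + g x) powr p \<partial>M) \<le>
      2 powr p * ((\<integral>x. norm (f x) powr p \<partial>M) + (\<integral>x. norm (g x) powr p \<partial>M))"
proof -
  have le: "norm (f x + g x) powr p \<le> 2 powr p * (norm (f x) powr p + norm (g x) powr p)" for x
    by (rule order_trans[OF powr_mono2 powr_add_le]) (use p norm_triangle_ineq in auto)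
  have r: "integrable M (\<lambda>x. 2 powr p * (norm (f x) powr p + norm (g x) powr p))"
    using i by simp
  show *: "integrable M (\<lambda>x. norm (f x + g x) powr p)"
    by (rule Bochner_Integration.integrable_bound[OF r]) (use le in auto)
  show "(\<integral>x. norm (f x + g x) powr p \<partial>M) \<le>
      2 powr p * ((\<integral>x. norm (f x) powr p \<partial>M) + (\<integral>x. norm (g x) powr p \<partial>M))"
    using integral_mono[OF * r le] i by simp
qed

lemma Lp_null_add:
  assumes "Lp_null M p f" "Lp_null M p g" "0 \<le> p"
  shows "Lp_null M p (\<lambda>n x. f n x + g n x)"
proof -
  note I = integrable_norm_powr_add[of _ M, OF _ _ _ _ \<open>0 \<le> p\<close>]
  have "(\<lambda>n. \<integral>x. norm (f n x + g n x) powr p \<partial>M) \<longlonglongrightarrow> 0"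
  proof (rule Lim_null_comparison)
    show "\<forall>\<^sub>F n in sequentially. norm (\<integral>x. norm (f n x + g n x) powr p \<partial>M) \<le>
      2 powr p * ((\<integral>x. norm (f n x) powr p \<partial>M) + (\<integral>x. norm (g n x) powr p \<partial>M))"
      using assms by (intro always_eventually allI) (auto simp: Lp_null_def intro!: I(2))
    have "(\<lambda>n. 2 powr p * ((\<integral>x. norm (f n x) powr p \<partial>M) + (\<integral>x. norm (g n x) powr p \<partial>M))) \<longlonglongrightarrow>
       2 powr p * (0 + 0)"
      using assms by (intro tendsto_intros) (auto simp: Lp_null_def)
    then show "(\<lambda>n. 2 powr p * ((\<integral>x. norm (f n x) powr p \<partial>M) + (\<integral>x. norm (g n x) powr p \<partial>M))) \<longlonglongrightarrow> 0"
      by simp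
  qed
  then show ?thesis using assms I(1) by (auto simp: Lp_null_def intro: borel_measurable_add)
qed

lemma Lp_null_dominated:
  assumes f: "Lp_null M p f" and g: "\<And>n. g n \<in> borel_measurable M"
    and le: "\<And>n. AE x in M. norm (g n x) \<le> norm (f n x)" and p: "0 \<le> p"
  shows "Lp_null M p g"
proof -
  have i: "integrable M (\<lambda>x. norm (g n x) powr p)" for n
  proof (rule Bochner_Integration.integrable_bound)
    show "integrable M (\<lambda>x. norm (f n x) powr p)" using f by (simp add: Lp_null_def)
    show "AE x in M. norm (norm (g n x) powr p) \<le> norm (norm (f n x) powr p)"
      using le[of n] by eventually_elim (simp add: powr_mono2 p)
  qed (use g in measurable)
  have "(\<lambda>n. \<integral>x. norm (g n x) powr p \<partial>M) \<longlonglongrightarrow> 0"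
  proof (rule Lim_null_comparison)
    have "(\<integral>x. norm (g n x) powr p \<partial>M) \<le> (\<integral>x. norm (f n x) powr p \<partial>M)" for n
    proof (rule integral_mono_AE[OF i])
      show "AE x in M. norm (g n x) powr p \<le> norm (f n x) powr p"
        using le[of n] by eventually_elim (simp add: powr_mono2 p)
    qed (use f in \<open>simp add: Lp_null_def\<close>)
    then show "\<forall>\<^sub>F n in sequentially. norm (\<integral>x. norm (g n x) powr p \<partial>M) \<le> (\<integral>x. norm (f n x) powr p \<partial>M)"
      by simp
  qed (use f in \<open>simp add: Lp_null_def\<close>)
  then show ?thesis using g i by (simp add: Lp_null_def)
qed

lemma Lp_null_subseq:
  assumes "Lp_null M p f" "strict_mono r"
  shows "Lp_null M p (\<lambda>n. f (r n))"
  using assms LIMSEQ_subseq_LIMSEQ[of _ 0 r] by (auto simp: Lp_null_def comp_def)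

lemma Lp_null_AE_subseq:
  assumes f: "Lp_null M p f" and p: "0 < p"
  obtains r :: "nat \<Rightarrow> nat" where "strict_mono r" "AE x in M. (\<lambda>n. f (r n) x) \<longlonglongrightarrow> 0"
proof -
  have "\<exists>r::nat\<Rightarrow>nat. strict_mono r \<and> (AE x in M. (\<lambda>n. norm (f (r n) x) powr p) \<longlonglongrightarrow> 0)"
    using f by (intro tendsto_L1_AE_subseq) (auto simp: Lp_null_def)
  then obtain r :: "nat \<Rightarrow> nat" where r: "strict_mono r"
    and ae: "AE x in M. (\<lambda>n. norm (f (r n) x) powr p) \<longlonglongrightarrow> 0" by blast
  from ae have "AE x in M. (\<lambda>n. f (r n) x) \<longlonglongrightarrow> 0"
  proof eventually_elim
    case (elim x)
    have "(\<lambda>n. (norm (f (r n) x) powr p) powr (1 / p)) \<longlonglongrightarrow> 0 powr (1 / p)"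
      using elim p by (intro tendsto_powr2) auto
    then show ?case using p by (simp add: powr_powr tendsto_norm_zero_iff)
  qed
  with r show ?thesis using that by blast
qed

lemma Lp_null_dominated_convergence:
  assumes f: "\<And>n. f n \<in> borel_measurable M" and g: "integrable M (\<lambda>x. norm (g x) powr p)"
    and le: "\<And>n. AE x in M. norm (f n x) \<le> norm (g x)" and lim: "AE x in M. (\<lambda>n. f n x) \<longlonglongrightarrow> 0"
    and p: "0 < p"
  shows "Lp_null M p f"
proof -
  have b: "AE x in M. norm (norm (f n x) powr p) \<le> norm (g x) powr p" for n
    using le[of n] by eventually_elim (use p in \<open>simp add: powr_mono2\<close>)
  have l: "AE x in M. (\<lambda>n. norm (f n x) powr p) \<longlonglongrightarrow> 0"
    using lim
  proof eventually_elim
    case (elim x)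
    then have "(\<lambda>n. norm (f n x) powr p) \<longlonglongrightarrow> 0 powr p"
      using p by (intro tendsto_powr2 tendsto_norm_zero) auto
    then show ?case by simp
  qed
  have m: "(\<lambda>x. norm (f n x) powr p) \<in> borel_measurable M" for n
    using f by measurable
  have "(\<lambda>n. \<integral>x. norm (f n x) powr p \<partial>M) \<longlonglongrightarrow> (\<integral>x. 0 \<partial>M)"
    by (rule integral_dominated_convergence[OF _ m g l b]) simp
  moreover have "integrable M (\<lambda>x. norm (f n x) powr p)" for n
    using b[of n] by (intro Bochner_Integration.integrable_bound[OF g m]) auto
  ultimately show ?thesis using f by (simp add: Lp_null_def)
qed

text \<open>Above the threshold \<open>d\<close> the factor \<open>(x / d) powr (p - 1)\<close> is
  at least 1. On a finite measure space this stands in for Hoelder when \<open>L\<^sup>p\<close> is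
  compared with \<open>L\<^sup>1\<close>: the free \<open>d\<close> makes the first summand small,
  convergence in \<open>L\<^sup>p\<close> the second.\<close>

lemma le_one_add_powr:
  assumes "0 \<le> x" "1 \<le> (p::real)" "0 < d"
  shows "x \<le> d + d powr (1 - p) * x powr p"
proof (cases "x \<le> d")
  case True
  then show ?thesis using assms by (simp add: add_increasing2)
next
  case False
  then have "1 \<le> (x / d) powr (p - 1)" using assms by (intro ge_one_powr_ge_zero) auto
  then have "x \<le> x * (x powr (p - 1) / d powr (p - 1))"
    using mult_left_mono[of 1 "(x / d) powr (p - 1)" x] False assms by (simp add: powr_divide)
  also have "\<dots> = d powr (1 - p) * x powr p"
    using False assms by (simp add: powr_diff)
  finally show ?thesis using assms by simp
qed

lemma (in finite_measure) integrable_if_norm_powr: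
  fixes f :: "'a \<Rightarrow> 'b::euclidean_space"
  assumes f: "f \<in> borel_measurable M" "integrable M (\<lambda>x. norm (f x) powr p)" and p: "1 \<le> p"
  shows "integrable M f"
proof (rule Bochner_Integration.integrable_bound[OF _ f(1)])
  show "integrable M (\<lambda>x. 1 + 1 powr (1 - p) * norm (f x) powr p)" using f by simp
  show "AE x in M. norm (f x) \<le> norm (1 + 1 powr (1 - p) * norm (f x) powr p)"
    using le_one_add_powr[OF _ p, of _ 1] by (auto simp: abs_of_nonneg)
qed

lemma (in finite_measure) Lp_null_tendsto_L1:
  fixes h :: "nat \<Rightarrow> 'a \<Rightarrow> 'b::euclidean_space"
  assumes h: "Lp_null M p h" and p: "1 \<le> p"
  shows "(\<lambda>n. \<integral>x. norm (h n x) \<partial>M) \<longlonglongrightarrow> 0"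
proof (rule LIMSEQ_I)
  fix e :: real assume e: "0 < e"
  \<comment> \<open>The total mass contributes less than half of \<open>e\<close>; the added 1 keeps
    the quotient defined when the mass is 0.\<close>
  define d where "d = e / (2 * (measure M (space M) + 1))"
  have mp: "measure M (space M) + 1 > 0" by (simp add: add_nonneg_pos)
  then have d: "0 < d" using e by (simp add: d_def)
  have de: "d * measure M (space M) < e / 2"
    using e mp by (simp add: d_def field_simps)
  have int: "integrable M (h n)" "integrable M (\<lambda>x. norm (h n x) powr p)" for n
    using h p integrable_if_norm_powr[of "h n" p] by (simp_all add: Lp_null_def)
  have "(\<lambda>n. d powr (1 - p) * (\<integral>x. norm (h n x) powr p \<partial>M)) \<longlonglongrightarrow> d powr (1 - p) * 0"
    using h by (intro tendsto_intros) (simp add: Lp_null_def)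
  then have "\<forall>\<^sub>F n in sequentially. d powr (1 - p) * (\<integral>x. norm (h n x) powr p \<partial>M) < e / 2"
    using e by (intro order_tendstoD(2)[where y=0]) auto
  then obtain N where N: "\<And>n. n \<ge> N \<Longrightarrow> d powr (1 - p) * (\<integral>x. norm (h n x) powr p \<partial>M) < e / 2"
    by (auto simp: eventually_sequentially)
  show "\<exists>N. \<forall>n\<ge>N. norm ((\<integral>x. norm (h n x) \<partial>M) - 0) < e"
  proof (intro exI allI impI)
    fix n assume n: "N \<le> n"
    have "(\<integral>x. norm (h n x) \<partial>M) \<le> (\<integral>x. d + d powr (1 - p) * norm (h n x) powr p \<partial>M)"
      using int p d by (intro integral_mono) (auto intro!: le_one_add_powr)
    also have "\<dots> = d * measure M (space M) + d powr (1 - p) * (\<integral>x. norm (h n x) powr p \<partial>M)"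
      using int by (simp add: mult.commute)
    also have "\<dots> < e" using de N[OF n] by simp
    finally show "norm ((\<integral>x. norm (h n x) \<partial>M) - 0) < e" by simp
  qed
qed

lemma (in finite_measure) Lp_null_integral_mult:
  fixes h :: "nat \<Rightarrow> 'a \<Rightarrow> real"
  assumes h: "Lp_null M p h" and p: "1 \<le> p" and z: "z \<in> borel_measurable M" "\<And>x. \<bar>z x\<bar> \<le> B"
  shows "integrable M (\<lambda>x. h n x * z x)" "(\<lambda>n. \<integral>x. h n x * z x \<partial>M) \<longlonglongrightarrow> 0"
proof -
  have int: "integrable M (h n)" for n
    by (rule integrable_if_norm_powr[of _ p]) (use h p in \<open>simp_all add: Lp_null_def\<close>)
  have le: "\<bar>h n x * z x\<bar> \<le> B * \<bar>h n x\<bar>" for n x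
    using z(2)[of x] by (simp add: abs_mult mult.commute mult_right_mono)
  show i: "integrable M (\<lambda>x. h n x * z x)" for n
    using int[of n] z(1)
    by (intro Bochner_Integration.integrable_bound[OF integrable_mult_right[OF integrable_abs[OF int[of n]], of B]])
      (auto intro!: order_trans[OF le])
  show "(\<lambda>n. \<integral>x. h n x * z x \<partial>M) \<longlonglongrightarrow> 0"
  proof (rule Lim_null_comparison)
    have "\<bar>\<integral>x. h n x * z x \<partial>M\<bar> \<le> B * (\<integral>x. norm (h n x) \<partial>M)" for n
    proof -
      have "\<bar>\<integral>x. h n x * z x \<partial>M\<bar> \<le> (\<integral>x. \<bar>h n x * z x\<bar> \<partial>M)" by (rule integral_abs_bound)
      also have "\<dots> \<le> (\<integral>x. B * \<bar>h n x\<bar> \<partial>M)"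
        using i[of n] int[of n] le by (intro integral_mono) auto
      finally show ?thesis by simp
    qed
    then show "\<forall>\<^sub>F n in sequentially. norm (\<integral>x. h n x * z x \<partial>M) \<le> B * (\<integral>x. norm (h n x) \<partial>M)"
      by simp
    show "(\<lambda>n. B * (\<integral>x. norm (h n x) \<partial>M)) \<longlonglongrightarrow> 0"
      using tendsto_mult_left[OF Lp_null_tendsto_L1[OF h p], of B] by simp
  qed
qed

section \<open>The spaces of the definitions in terms of real integrals over bounded open
  sets\<close>

lemma finite_measure_lebesgue_on:
  assumes "open \<Omega>" "bounded (\<Omega> :: 'a::euclidean_space set)"
  shows "finite_measure (lebesgue_on \<Omega>)"
proof
  have "emeasure lborel \<Omega> < \<infinity>" by (rule emeasure_bounded_finite[OF assms(2)])
  then show "emeasure (lebesgue_on \<Omega>) (space (lebesgue_on \<Omega>)) \<noteq> \<infinity>"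
    using assms(1) by (simp add: emeasure_restrict_space)
qed

lemma L_space_iff:
  "u \<in> L_space \<Omega> (ereal p) \<longleftrightarrow> u \<in> borel_measurable (lebesgue_on \<Omega>) \<and>
    integrable (lebesgue_on \<Omega>) (\<lambda>x. norm (u x) powr p)"
  by (simp add: L_space_def Lnorm_def)

lemma Lnorm_eq:
  "u \<in> L_space \<Omega> (ereal p) \<Longrightarrow> Lnorm \<Omega> (ereal p) u =
    ereal ((\<integral>x. norm (u x) powr p \<partial>(lebesgue_on \<Omega>)) powr (1 / p))"
  by (simp add: L_space_iff Lnorm_def)

lemma L_space_diff:
  "u \<in> L_space \<Omega> (ereal p) \<Longrightarrow> v \<in> L_space \<Omega> (ereal p) \<Longrightarrow> 0 \<le> p \<Longrightarrow> (\<lambda>x. u x - v x) \<in> L_space \<Omega> (ereal p)"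
  using integrable_norm_powr_add(1)[of u "lebesgue_on \<Omega>" "\<lambda>x. - v x" p]
  by (simp add: L_space_iff borel_measurable_diff)

lemma Lnorm_tendsto_0_iff:
  assumes h: "\<And>n. h n \<in> L_space \<Omega> (ereal p)" and p: "0 < p"
  shows "(\<lambda>n. Lnorm \<Omega> (ereal p) (h n)) \<longlonglongrightarrow> 0 \<longleftrightarrow> Lp_null (lebesgue_on \<Omega>) p h"
proof -
  define I where "I n = (\<integral>x. norm (h n x) powr p \<partial>(lebesgue_on \<Omega>))" for n
  have I0: "I n \<ge> 0" for n by (simp add: I_def)
  have "(\<lambda>n. Lnorm \<Omega> (ereal p) (h n)) \<longlonglongrightarrow> 0 \<longleftrightarrow> (\<lambda>n. I n powr (1 / p)) \<longlonglongrightarrow> 0"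
    using h by (simp add: Lnorm_eq I_def zero_ereal_def)
  also have "\<dots> \<longleftrightarrow> I \<longlonglongrightarrow> 0"
  proof
    assume "(\<lambda>n. I n powr (1 / p)) \<longlonglongrightarrow> 0"
    then have "(\<lambda>n. (I n powr (1 / p)) powr p) \<longlonglongrightarrow> 0 powr p"
      using p by (intro tendsto_powr2) auto
    then show "I \<longlonglongrightarrow> 0" using p I0 by (simp add: powr_powr)
  next
    assume "I \<longlonglongrightarrow> 0"
    then have "(\<lambda>n. I n powr (1 / p)) \<longlonglongrightarrow> 0 powr (1 / p)"
      using p I0 by (intro tendsto_powr2) auto
    then show "(\<lambda>n. I n powr (1 / p)) \<longlonglongrightarrow> 0" by simp
  qed
  finally show ?thesis using h by (simp add: Lp_null_def I_def[abs_def] L_space_iff)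
qed

lemma borel_measurable_lebesgue_onI:
  "f \<in> borel_measurable borel \<Longrightarrow> f \<in> borel_measurable (lebesgue_on \<Omega>)"
  by (intro measurable_restrict_space1 measurable_completion) simp

lemma L_space_continuous_compact_support:
  fixes f :: "'a::euclidean_space \<Rightarrow> 'b::euclidean_space"
  assumes \<Omega>: "open \<Omega>" "bounded \<Omega>" and f: "continuous_on UNIV f" and K: "compact K" "\<And>x. x \<notin> K \<Longrightarrow> f x = 0"
    and p: "0 \<le> p"
  shows "f \<in> L_space \<Omega> (ereal p)"
proof -
  interpret finite_measure "lebesgue_on \<Omega>" by (rule finite_measure_lebesgue_on[OF \<Omega>])
  obtain B where B: "\<And>x. norm (f x) \<le> B"
    using bounded_continuous_compact_support[OF f K] by metis
  have m: "f \<in> borel_measurable (lebesgue_on \<Omega>)"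
    by (intro borel_measurable_lebesgue_onI borel_measurable_continuous_onI f)
  moreover have "integrable (lebesgue_on \<Omega>) (\<lambda>x. norm (f x) powr p)"
    by (rule integrable_const_bound[where B="B powr p"]) (use m B p in \<open>auto intro!: powr_mono2\<close>)
  ultimately show ?thesis by (simp add: L_space_iff)
qed

lemma test_function_L_space:
  assumes \<Omega>: "open \<Omega>" "bounded \<Omega>" and \<phi>: "\<phi> \<in> test_functions \<Omega>" and p: "0 \<le> p"
  shows "\<phi> \<in> L_space \<Omega> (ereal p)" "classical_grad \<phi> \<in> L_space \<Omega> (ereal p)"
proof -
  obtain K where K: "compact K" "\<And>x. x \<notin> K \<Longrightarrow> \<phi> x = 0"
    "\<And>x. x \<notin> K \<Longrightarrow> frechet_derivative \<phi> (at x) = (\<lambda>_. 0)"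
    using test_function_support[OF \<phi>] by metis
  show "\<phi> \<in> L_space \<Omega> (ereal p)"
    by (rule L_space_continuous_compact_support[OF \<Omega> continuous_on_test_function[OF \<phi>] K(1,2) p])
  show "classical_grad \<phi> \<in> L_space \<Omega> (ereal p)"
    by (rule L_space_continuous_compact_support[OF \<Omega> continuous_on_classical_grad[OF \<phi>] K(1) _ p])
      (simp add: K(3) classical_grad_def)
qed

lemma W1_0_iff:
  assumes \<Omega>: "open \<Omega>" "bounded \<Omega>" and p: "0 < p"
  shows "u \<in> W1_0 \<Omega> p \<longleftrightarrow> u \<in> W1 \<Omega> p \<and> (\<exists>\<phi>. (\<forall>n::nat. \<phi> n \<in> test_functions \<Omega>) \<and>
    Lp_null (lebesgue_on \<Omega>) p (\<lambda>n x. u x - \<phi> n x) \<and>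
    Lp_null (lebesgue_on \<Omega>) p (\<lambda>n x. weak_grad \<Omega> u x - classical_grad (\<phi> n) x))"
proof -
  have "(\<lambda>n. Lnorm \<Omega> p (\<lambda>x. u x - \<phi> n x)) \<longlonglongrightarrow> 0 \<longleftrightarrow> Lp_null (lebesgue_on \<Omega>) p (\<lambda>n x. u x - \<phi> n x)"
    "(\<lambda>n. Lnorm \<Omega> p (\<lambda>x. weak_grad \<Omega> u x - classical_grad (\<phi> n) x)) \<longlonglongrightarrow> 0 \<longleftrightarrow>
      Lp_null (lebesgue_on \<Omega>) p (\<lambda>n x. weak_grad \<Omega> u x - classical_grad (\<phi> n) x)"
    if "u \<in> W1 \<Omega> p" "\<And>n. \<phi> n \<in> test_functions \<Omega>" for \<phi> :: "nat \<Rightarrow> 'a \<Rightarrow> real"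
    using that p test_function_L_space[OF \<Omega>]
    by (auto simp: W1_def intro!: Lnorm_tendsto_0_iff L_space_diff)
  then show ?thesis unfolding W1_0_def by blast
qed

section \<open>The chain rule in Sobolev spaces\<close>

lemma classical_grad_inner: "b \<in> Basis \<Longrightarrow> classical_grad \<phi> x \<bullet> b = frechet_derivative \<phi> (at x) b"
  by (simp add: classical_grad_def inner_sum_left inner_Basis if_distrib sum.delta cong: if_cong)

lemma integrable_lebesgue_on_subset:
  fixes f :: "'a::euclidean_space \<Rightarrow> 'b::{banach, second_countable_topology}"
  assumes "integrable (lebesgue_on S) f" "T \<subseteq> S" "S \<in> sets lebesgue" "T \<in> sets lebesgue"
  shows "integrable (lebesgue_on T) f"
proof -
  have "integrable lebesgue (\<lambda>x. indicator T x *\<^sub>R (indicator S x *\<^sub>R f x))"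
    by (rule integrable_mult_indicator) (use assms in \<open>simp_all add: integrable_restrict_space\<close>)
  moreover have "(\<lambda>x. indicator T x *\<^sub>R (indicator S x *\<^sub>R f x)) = (\<lambda>x. indicator T x *\<^sub>R f x)"
    using assms(2) by (auto simp: indicator_def fun_eq_iff)
  ultimately show ?thesis using assms by (simp add: integrable_restrict_space)
qed

text \<open>Completeness of Lebesgue measure. It makes the chosen weak gradient measurable once it
  agrees almost everywhere with a measurable function.\<close>

lemma borel_measurable_lebesgue_on_AE:
  fixes f g :: "'a::euclidean_space \<Rightarrow> 'b::euclidean_space"
  assumes f: "f \<in> borel_measurable (lebesgue_on S)" and ae: "AE x in lebesgue_on S. f x = g x"
    and S: "S \<in> sets lebesgue"
  shows "g \<in> borel_measurable (lebesgue_on S)"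
proof -
  have "(\<lambda>x. indicator S x *\<^sub>R g x) \<in> borel_measurable lebesgue"
  proof (rule borel_measurable_AE)
    show "(\<lambda>x. indicator S x *\<^sub>R f x) \<in> borel_measurable lebesgue"
      using f S by (simp add: borel_measurable_restrict_space_iff)
    have "AE x in lebesgue. x \<in> S \<longrightarrow> f x = g x"
      using ae S by (simp add: AE_restrict_space_iff)
    then show "AE x in lebesgue. indicator S x *\<^sub>R f x = indicator S x *\<^sub>R g x"
      by eventually_elim (auto simp: indicator_def)
  qed
  then show ?thesis using S by (simp add: borel_measurable_restrict_space_iff)
qed

text \<open>Integration by parts holds for each \<open>\<psi> n\<close>, and both sides pass to the
  limit: the test function and its derivatives are bounded, and on a bounded domain convergence in
  \<open>L\<^sup>p\<close> implies convergence in \<open>L\<^sup>1\<close>.\<close>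

lemma has_weak_grad_Lp_limit:
  fixes w :: "'a::euclidean_space \<Rightarrow> real"
  assumes \<Omega>: "open \<Omega>" "bounded \<Omega>" and p: "1 \<le> p" and \<psi>: "\<And>n. \<psi> n \<in> test_functions \<Omega>"
    and w: "w \<in> L_space \<Omega> (ereal p)" and g: "g \<in> L_space \<Omega> (ereal p)"
    and nw: "Lp_null (lebesgue_on \<Omega>) p (\<lambda>n x. w x - \<psi> n x)"
    and ng: "Lp_null (lebesgue_on \<Omega>) p (\<lambda>n x. g x - classical_grad (\<psi> n) x)"
  shows "has_weak_grad \<Omega> w g"
  unfolding has_weak_grad_def
proof (intro conjI ballI)
  interpret finite_measure "lebesgue_on \<Omega>" by (rule finite_measure_lebesgue_on[OF \<Omega>])
  have iw: "integrable (lebesgue_on \<Omega>) w" and ig: "integrable (lebesgue_on \<Omega>) g"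
    using w g p by (auto simp: L_space_iff intro: integrable_if_norm_powr[of _ p])
  show "locally_integrable \<Omega> w" "locally_integrable \<Omega> g"
    unfolding locally_integrable_def using \<Omega>
    by (auto intro!: integrable_lebesgue_on_subset[OF iw] integrable_lebesgue_on_subset[OF ig] dest: compact_imp_closed)
  fix \<zeta> :: "'a \<Rightarrow> real" and b :: 'a assume \<zeta>: "\<zeta> \<in> test_functions \<Omega>" and b: "b \<in> Basis"
  obtain K where K: "compact K" "K \<subseteq> \<Omega>" "\<And>x. x \<notin> K \<Longrightarrow> \<zeta> x = 0"
    "\<And>x. x \<notin> K \<Longrightarrow> frechet_derivative \<zeta> (at x) = (\<lambda>_. 0)"
    using test_function_support[OF \<zeta>] by metis
  define z where "z x = frechet_derivative \<zeta> (at x) b" for x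
  have cz: "continuous_on UNIV z" "continuous_on UNIV \<zeta>"
    unfolding z_def using continuous_on_test_function_derivative[OF \<zeta> b] continuous_on_test_function[OF \<zeta>] by auto
  obtain B1 B2 where B: "\<And>x. \<bar>z x\<bar> \<le> B1" "\<And>x. \<bar>\<zeta> x\<bar> \<le> B2"
    using bounded_continuous_compact_support[OF cz(1) K(1)] bounded_continuous_compact_support[OF cz(2) K(1,3)] K(4)
    unfolding z_def real_norm_def by metis
  have mz: "z \<in> borel_measurable (lebesgue_on \<Omega>)" "\<zeta> \<in> borel_measurable (lebesgue_on \<Omega>)"
    using cz by (auto intro: borel_measurable_lebesgue_onI borel_measurable_continuous_onI)
  have ng': "Lp_null (lebesgue_on \<Omega>) p (\<lambda>n x. (g x - classical_grad (\<psi> n) x) \<bullet> b)"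
  proof (rule Lp_null_dominated[OF ng])
    show "(\<lambda>x. (g x - classical_grad (\<psi> n) x) \<bullet> b) \<in> borel_measurable (lebesgue_on \<Omega>)" for n
      using ng unfolding Lp_null_def by (intro borel_measurable_inner) auto
  qed (use p Basis_le_norm[OF b] in auto)
  have im: "integrable (lebesgue_on \<Omega>) (\<lambda>x. h x * y x)"
    if "integrable (lebesgue_on \<Omega>) h" "y \<in> borel_measurable (lebesgue_on \<Omega>)" "\<And>x. \<bar>y x\<bar> \<le> B" for h y :: "'a \<Rightarrow> real" and B
  proof (rule Bochner_Integration.integrable_bound[OF integrable_mult_right[OF integrable_abs[OF that(1)], of B]])
    show "AE x in lebesgue_on \<Omega>. norm (h x * y x) \<le> norm (B * \<bar>h x\<bar>)"
    proof (rule AE_I2)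
      fix x
      have "\<bar>h x\<bar> * \<bar>y x\<bar> \<le> \<bar>h x\<bar> * \<bar>B\<bar>" using that(3)[of x] by (intro mult_left_mono) auto
      then show "norm (h x * y x) \<le> norm (B * \<bar>h x\<bar>)" by (simp add: abs_mult mult.commute)
    qed
  qed (use that in measurable)
  have igb: "integrable (lebesgue_on \<Omega>) (\<lambda>x. g x \<bullet> b)" using ig by simp
  have L1: "(\<lambda>n. \<integral>x. \<psi> n x * z x \<partial>(lebesgue_on \<Omega>)) \<longlonglongrightarrow> (\<integral>x. w x * z x \<partial>(lebesgue_on \<Omega>))"
  proof -
    have "(\<integral>x. \<psi> n x * z x \<partial>(lebesgue_on \<Omega>)) =
      (\<integral>x. w x * z x \<partial>(lebesgue_on \<Omega>)) - (\<integral>x. (w x - \<psi> n x) * z x \<partial>(lebesgue_on \<Omega>))" for n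
      using im[OF iw mz(1) B(1)] Lp_null_integral_mult(1)[OF nw p mz(1) B(1)]
      by (subst Bochner_Integration.integral_diff[symmetric]) (auto simp: algebra_simps)
    then show ?thesis
      using tendsto_diff[OF tendsto_const Lp_null_integral_mult(2)[OF nw p mz(1) B(1)]] by simp
  qed
  have L2: "(\<lambda>n. \<integral>x. frechet_derivative (\<psi> n) (at x) b * \<zeta> x \<partial>(lebesgue_on \<Omega>)) \<longlonglongrightarrow>
     (\<integral>x. (g x \<bullet> b) * \<zeta> x \<partial>(lebesgue_on \<Omega>))"
  proof -
    have "(\<integral>x. frechet_derivative (\<psi> n) (at x) b * \<zeta> x \<partial>(lebesgue_on \<Omega>)) = (\<integral>x. (g x \<bullet> b) * \<zeta> x \<partial>(lebesgue_on \<Omega>)) -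
       (\<integral>x. ((g x - classical_grad (\<psi> n) x) \<bullet> b) * \<zeta> x \<partial>(lebesgue_on \<Omega>))" for n
      using im[OF igb mz(2) B(2)] Lp_null_integral_mult(1)[OF ng' p mz(2) B(2)]
      by (subst Bochner_Integration.integral_diff[symmetric])
        (auto simp: inner_diff_left classical_grad_inner[OF b] algebra_simps)
    then show ?thesis
      using tendsto_diff[OF tendsto_const Lp_null_integral_mult(2)[OF ng' p mz(2) B(2)]] by simp
  qed
  have "(\<integral>x. \<psi> n x * z x \<partial>(lebesgue_on \<Omega>)) = - (\<integral>x. frechet_derivative (\<psi> n) (at x) b * \<zeta> x \<partial>(lebesgue_on \<Omega>))" for n
    unfolding z_def by (rule test_function_integration_by_parts[OF \<psi> \<zeta> b \<Omega>(1)])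
  then have "(\<integral>x. w x * z x \<partial>(lebesgue_on \<Omega>)) = - (\<integral>x. (g x \<bullet> b) * \<zeta> x \<partial>(lebesgue_on \<Omega>))"
    using LIMSEQ_unique[OF L1] tendsto_minus[OF L2] by simp
  then show "(\<integral>x. w x * frechet_derivative \<zeta> (at x) b \<partial>(lebesgue_on \<Omega>)) = - (\<integral>x. (g x \<bullet> b) * \<zeta> x \<partial>(lebesgue_on \<Omega>))"
    by (simp add: z_def)
qed

text \<open>A membership criterion in terms of a candidate gradient \<open>g\<close>. Uniqueness
  identifies the chosen gradient with \<open>g\<close> almost everywhere, which carries
  integrability and convergence over to it.\<close>

lemma W1_0I:
  fixes w :: "'a::euclidean_space \<Rightarrow> real"
  assumes \<Omega>: "open \<Omega>" "bounded \<Omega>" and p: "1 \<le> p" and \<psi>: "\<And>n. \<psi> n \<in> test_functions \<Omega>"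
    and w: "w \<in> L_space \<Omega> (ereal p)" and g: "g \<in> L_space \<Omega> (ereal p)"
    and nw: "Lp_null (lebesgue_on \<Omega>) p (\<lambda>n x. w x - \<psi> n x)"
    and ng: "Lp_null (lebesgue_on \<Omega>) p (\<lambda>n x. g x - classical_grad (\<psi> n) x)"
  shows "w \<in> W1_0 \<Omega> p" "AE x in lebesgue_on \<Omega>. weak_grad \<Omega> w x = g x"
proof -
  have wg: "has_weak_grad \<Omega> w g" by (rule has_weak_grad_Lp_limit[OF assms])
  show ae: "AE x in lebesgue_on \<Omega>. weak_grad \<Omega> w x = g x" by (rule weak_grad_AE[OF \<Omega>(1) wg])
  have \<Omega>s: "\<Omega> \<in> sets lebesgue" using \<Omega> by auto
  have m: "weak_grad \<Omega> w \<in> borel_measurable (lebesgue_on \<Omega>)"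
  proof (rule borel_measurable_lebesgue_on_AE)
    show "g \<in> borel_measurable (lebesgue_on \<Omega>)" using g by (simp add: L_space_iff)
    show "AE x in lebesgue_on \<Omega>. g x = weak_grad \<Omega> w x" using ae by eventually_elim simp
  qed (rule \<Omega>s)
  have "integrable (lebesgue_on \<Omega>) (\<lambda>x. norm (weak_grad \<Omega> w x) powr p)"
  proof (rule integrable_cong_AE_imp)
    show "integrable (lebesgue_on \<Omega>) (\<lambda>x. norm (g x) powr p)" using g by (simp add: L_space_iff)
    show "AE x in lebesgue_on \<Omega>. norm (g x) powr p = norm (weak_grad \<Omega> w x) powr p"
      using ae by eventually_elim simp
  qed (use m in measurable)
  then have "w \<in> W1 \<Omega> p" using m w wg by (auto simp: W1_def L_space_iff)
  moreover have "Lp_null (lebesgue_on \<Omega>) p (\<lambda>n x. weak_grad \<Omega> w x - classical_grad (\<psi> n) x)"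
  proof (rule Lp_null_dominated[OF ng])
    show "(\<lambda>x. weak_grad \<Omega> w x - classical_grad (\<psi> n) x) \<in> borel_measurable (lebesgue_on \<Omega>)" for n
      using m test_function_L_space[OF \<Omega> \<psi>[of n], of p] p by (auto simp: L_space_iff)
    show "AE x in lebesgue_on \<Omega>. norm (weak_grad \<Omega> w x - classical_grad (\<psi> n) x) \<le> norm (g x - classical_grad (\<psi> n) x)" for n
      using ae by eventually_elim simp
  qed (use p in simp)
  ultimately show "w \<in> W1_0 \<Omega> p"
    using \<psi> nw p by (subst W1_0_iff[OF \<Omega>]) auto
qed

text \<open>Smoothness of every order keeps test functions inside their class under composition. The
  slope bounds serve twice: they make \<open>G\<close> contracting with
  \<open>|G s| \<le> |s|\<close>, and in the energy inequality they give
  \<open>(G')^p \<le> G'\<close>.\<close>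

locale smooth_contraction =
  fixes G :: "real \<Rightarrow> real"
  assumes smooth: "Ck k G" and zero: "G 0 = 0" and deriv_bounds: "0 \<le> deriv G s" "deriv G s \<le> 1"
begin

lemma has_deriv: "(G has_real_derivative deriv G s) (at s)"
proof -
  have "G differentiable (at s)" using smooth[of "Suc 0"] by simp
  then show ?thesis
    using DERIV_deriv_iff_real_differentiable by blast
qed

lemma frechet_derivative_eq: "frechet_derivative G (at s) = (*) (deriv G s)"
  using frechet_derivative_at[OF has_deriv[unfolded has_field_derivative_def]] by simp

lemma continuous_on_deriv: "continuous_on UNIV (deriv G)"
  using smooth[of "Suc 0"] by (simp add: frechet_derivative_eq)

lemma continuous_on: "continuous_on UNIV G"
  using smooth[of 0] by simp

lemma contraction: "\<bar>G s - G t\<bar> \<le> \<bar>s - t\<bar>"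
  using field_differentiable_bound[of UNIV G "deriv G" 1 s t] has_deriv deriv_bounds
  by (auto simp: abs_of_nonneg)

lemma bound: "\<bar>G s\<bar> \<le> \<bar>s\<bar>"
  using contraction[of s 0] zero by simp

lemma has_derivative_compose_test_function:
  assumes "\<phi> \<in> test_functions \<Omega>"
  shows "((\<lambda>x. G (\<phi> x)) has_derivative (\<lambda>b. deriv G (\<phi> x) * frechet_derivative \<phi> (at x) b)) (at x)"
  using has_derivative_compose[OF test_function_has_derivative[OF assms] has_deriv[unfolded has_field_derivative_def]] .

lemma classical_grad_compose:
  assumes "\<phi> \<in> test_functions \<Omega>"
  shows "classical_grad (\<lambda>x. G (\<phi> x)) x = deriv G (\<phi> x) *\<^sub>R classical_grad \<phi> x"
  by (simp add: classical_grad_def frechet_derivative_at[OF has_derivative_compose_test_function[OF assms], symmetric]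
      scaleR_sum_right)

lemma compose_test_function:
  assumes "\<phi> \<in> test_functions \<Omega>"
  shows "(\<lambda>x. G (\<phi> x)) \<in> test_functions \<Omega>"
proof -
  have sub: "closure {x. G (\<phi> x) \<noteq> 0} \<subseteq> closure {x. \<phi> x \<noteq> 0}"
    using zero by (intro closure_mono) auto
  have "Ck k (\<lambda>x. G (\<phi> x))" for k by (rule Ck_compose[OF smooth test_function_Ck[OF assms]])
  moreover have "compact (closure {x. G (\<phi> x) \<noteq> 0})"
    using sub assms bounded_subset by (auto simp: test_functions_def compact_eq_bounded_closed)
  ultimately show ?thesis using sub assms by (auto simp: test_functions_def)
qed

text \<open>If \<phi>_n tends to \<open>u\<close>, then \<open>G(\<phi>_n)\<close> are test
  functions tending to \<open>G(u)\<close>. The difference of the gradients is \<open>(G'(u) -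
  G'(\<phi>_n)) \<nabla>u + G'(\<phi>_n) (\<nabla>u - \<nabla>\<phi>_n)\<close>: the first term
  vanishes by dominated convergence along an almost everywhere convergent subsequence, the second
  because \<open>G'\<close> is bounded. The approximating sequence is part of the conclusion because
  Sobolev's inequality will be applied to its members.\<close>

lemma W1_0_compose:
  fixes u :: "'a::euclidean_space \<Rightarrow> real"
  assumes \<Omega>: "open \<Omega>" "bounded \<Omega>" and p: "1 \<le> p" and u: "u \<in> W1_0 \<Omega> p"
  obtains \<psi> where "(\<lambda>x. G (u x)) \<in> W1_0 \<Omega> p"
    "AE x in lebesgue_on \<Omega>. weak_grad \<Omega> (\<lambda>x. G (u x)) x = deriv G (u x) *\<^sub>R weak_grad \<Omega> u x"
    "\<And>n::nat. \<psi> n \<in> test_functions \<Omega>" "AE x in lebesgue_on \<Omega>. (\<lambda>n. \<psi> n x) \<longlonglongrightarrow> G (u x)"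
    "Lp_null (lebesgue_on \<Omega>) p (\<lambda>n x. deriv G (u x) *\<^sub>R weak_grad \<Omega> u x - classical_grad (\<psi> n) x)"
proof -
  define g where "g = weak_grad \<Omega> u"
  obtain \<phi> where \<phi>: "\<And>n::nat. \<phi> n \<in> test_functions \<Omega>" and nu: "Lp_null (lebesgue_on \<Omega>) p (\<lambda>n x. u x - \<phi> n x)"
    and ng: "Lp_null (lebesgue_on \<Omega>) p (\<lambda>n x. g x - classical_grad (\<phi> n) x)"
    using u p unfolding g_def by (subst (asm) W1_0_iff[OF \<Omega>]) auto
  have uL: "u \<in> L_space \<Omega> (ereal p)" "g \<in> L_space \<Omega> (ereal p)"
    using u by (auto simp: g_def W1_0_def W1_def)
  obtain r where r: "strict_mono r" and ae: "AE x in lebesgue_on \<Omega>. (\<lambda>n. u x - \<phi> (r n) x) \<longlonglongrightarrow> 0"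
    using Lp_null_AE_subseq[OF nu] p by auto
  define \<psi> where "\<psi> n x = G (\<phi> (r n) x)" for n x
  have \<psi>: "\<psi> n \<in> test_functions \<Omega>" for n
    unfolding \<psi>_def by (rule compose_test_function[OF \<phi>])
  have um: "u \<in> borel_measurable (lebesgue_on \<Omega>)" and gm: "g \<in> borel_measurable (lebesgue_on \<Omega>)"
    using uL by (auto simp: L_space_iff)
  have Gm: "(\<lambda>x. G (u x)) \<in> borel_measurable (lebesgue_on \<Omega>)"
    "(\<lambda>x. deriv G (u x)) \<in> borel_measurable (lebesgue_on \<Omega>)"
    by (intro borel_measurable_continuous_on[OF _ um] continuous_on continuous_on_deriv)+
  have \<phi>m: "\<phi> n \<in> borel_measurable (lebesgue_on \<Omega>)" "classical_grad (\<phi> n) \<in> borel_measurable (lebesgue_on \<Omega>)"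
    "(\<lambda>x. deriv G (\<phi> n x)) \<in> borel_measurable (lebesgue_on \<Omega>)"
    "\<psi> n \<in> borel_measurable (lebesgue_on \<Omega>)" for n
  proof -
    show *: "\<phi> n \<in> borel_measurable (lebesgue_on \<Omega>)" "classical_grad (\<phi> n) \<in> borel_measurable (lebesgue_on \<Omega>)"
      "\<psi> n \<in> borel_measurable (lebesgue_on \<Omega>)"
      using test_function_L_space[OF \<Omega> \<phi>, of p] test_function_L_space[OF \<Omega> \<psi>, of p] p by (auto simp: L_space_iff)
    show "(\<lambda>x. deriv G (\<phi> n x)) \<in> borel_measurable (lebesgue_on \<Omega>)"
      by (rule borel_measurable_continuous_on[OF continuous_on_deriv *(1)])
  qed
  have wL: "(\<lambda>x. G (u x)) \<in> L_space \<Omega> (ereal p)"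
    unfolding L_space_iff
  proof (intro conjI Gm)
    show "integrable (lebesgue_on \<Omega>) (\<lambda>x. norm (G (u x)) powr p)"
    proof (rule Bochner_Integration.integrable_bound)
      show "integrable (lebesgue_on \<Omega>) (\<lambda>x. norm (u x) powr p)" using uL by (simp add: L_space_iff)
    qed (use Gm bound p in \<open>auto intro!: powr_mono2\<close>)
  qed
  have gL: "(\<lambda>x. deriv G (u x) *\<^sub>R g x) \<in> L_space \<Omega> (ereal p)"
    unfolding L_space_iff
  proof
    show m: "(\<lambda>x. deriv G (u x) *\<^sub>R g x) \<in> borel_measurable (lebesgue_on \<Omega>)"
      by (intro borel_measurable_scaleR Gm gm)
    show "integrable (lebesgue_on \<Omega>) (\<lambda>x. norm (deriv G (u x) *\<^sub>R g x) powr p)"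
    proof (rule Bochner_Integration.integrable_bound)
      show "integrable (lebesgue_on \<Omega>) (\<lambda>x. norm (g x) powr p)" using uL by (simp add: L_space_iff)
      show "(\<lambda>x. norm (deriv G (u x) *\<^sub>R g x) powr p) \<in> borel_measurable (lebesgue_on \<Omega>)"
        using m by measurable
    qed (use deriv_bounds p in \<open>auto intro!: powr_mono2 mult_left_le_one_le\<close>)
  qed
  have nw: "Lp_null (lebesgue_on \<Omega>) p (\<lambda>n x. G (u x) - \<psi> n x)"
  proof (rule Lp_null_dominated[OF Lp_null_subseq[OF nu r]])
    show "(\<lambda>x. G (u x) - \<psi> n x) \<in> borel_measurable (lebesgue_on \<Omega>)" for n
      by (intro borel_measurable_diff Gm \<phi>m)
    show "AE x in lebesgue_on \<Omega>. norm (G (u x) - \<psi> n x) \<le> norm (u x - \<phi> (r n) x)" for n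
      using contraction by (auto simp: \<psi>_def)
  qed (use p in simp)
  have n1: "Lp_null (lebesgue_on \<Omega>) p (\<lambda>n x. (deriv G (u x) - deriv G (\<phi> (r n) x)) *\<^sub>R g x)"
  proof (rule Lp_null_dominated_convergence)
    show "integrable (lebesgue_on \<Omega>) (\<lambda>x. norm (g x) powr p)" using uL by (simp add: L_space_iff)
    show "AE x in lebesgue_on \<Omega>. norm ((deriv G (u x) - deriv G (\<phi> (r n) x)) *\<^sub>R g x) \<le> norm (g x)" for n
    proof (rule AE_I2)
      fix x
      have "\<bar>deriv G (u x) - deriv G (\<phi> (r n) x)\<bar> \<le> 1"
        using deriv_bounds[of "u x"] deriv_bounds[of "\<phi> (r n) x"] by linarith
      then show "norm ((deriv G (u x) - deriv G (\<phi> (r n) x)) *\<^sub>R g x) \<le> norm (g x)"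
        by (simp add: mult_left_le_one_le)
    qed
    show "AE x in lebesgue_on \<Omega>. (\<lambda>n. (deriv G (u x) - deriv G (\<phi> (r n) x)) *\<^sub>R g x) \<longlonglongrightarrow> 0"
      using ae
    proof eventually_elim
      case (elim x)
      have "(\<lambda>n. u x - (u x - \<phi> (r n) x)) \<longlonglongrightarrow> u x - 0"
        by (intro tendsto_diff tendsto_const elim)
      then have "(\<lambda>n. \<phi> (r n) x) \<longlonglongrightarrow> u x" by simp
      then have "(\<lambda>n. deriv G (\<phi> (r n) x)) \<longlonglongrightarrow> deriv G (u x)"
        using continuous_on_deriv by (metis UNIV_I continuous_on_eq_continuous_at isCont_tendsto_compose open_UNIV)
      then have "(\<lambda>n. (deriv G (u x) - deriv G (\<phi> (r n) x)) *\<^sub>R g x) \<longlonglongrightarrow> (deriv G (u x) - deriv G (u x)) *\<^sub>R g x"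
        by (intro tendsto_scaleR tendsto_diff tendsto_const)
      then show ?case by simp
    qed
    show "(\<lambda>x. (deriv G (u x) - deriv G (\<phi> (r n) x)) *\<^sub>R g x) \<in> borel_measurable (lebesgue_on \<Omega>)" for n
      by (intro borel_measurable_scaleR borel_measurable_diff Gm \<phi>m gm)
  qed (use p in simp)
  have n2: "Lp_null (lebesgue_on \<Omega>) p (\<lambda>n x. deriv G (\<phi> (r n) x) *\<^sub>R (g x - classical_grad (\<phi> (r n)) x))"
  proof (rule Lp_null_dominated[OF Lp_null_subseq[OF ng r]])
    show "(\<lambda>x. deriv G (\<phi> (r n) x) *\<^sub>R (g x - classical_grad (\<phi> (r n)) x)) \<in> borel_measurable (lebesgue_on \<Omega>)" for n
      by (intro borel_measurable_scaleR borel_measurable_diff gm \<phi>m)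
  qed (use p deriv_bounds in \<open>auto simp: mult_left_le_one_le\<close>)
  have ng': "Lp_null (lebesgue_on \<Omega>) p (\<lambda>n x. deriv G (u x) *\<^sub>R g x - classical_grad (\<psi> n) x)"
    using Lp_null_add[OF n1 n2] p unfolding \<psi>_def
    by (simp add: classical_grad_compose[OF \<phi>] algebra_simps)
  have ae': "AE x in lebesgue_on \<Omega>. (\<lambda>n. \<psi> n x) \<longlonglongrightarrow> G (u x)"
    using ae
  proof eventually_elim
    case (elim x)
    have "(\<lambda>n. u x - (u x - \<phi> (r n) x)) \<longlonglongrightarrow> u x - 0"
      by (intro tendsto_diff tendsto_const elim)
    then have "(\<lambda>n. \<phi> (r n) x) \<longlonglongrightarrow> u x" by simp
    then show ?case unfolding \<psi>_def using has_deriv DERIV_isCont isCont_tendsto_compose by blast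
  qed
  note W = W1_0I[OF \<Omega> p \<psi> wL gL nw ng']
  show ?thesis
    by (rule that[OF W(1) _ \<psi> ae']) (use W(2) ng' in \<open>simp_all add: g_def\<close>)
qed

end

section \<open>Integral inequalities\<close>

lemma Holder_inequality:
  fixes f g :: "'a \<Rightarrow> real"
  assumes ab: "1 < a" "1 < b" "1 / a + 1 / b = 1"
    and [measurable]: "f \<in> borel_measurable M" "g \<in> borel_measurable M"
    and i: "integrable M (\<lambda>x. \<bar>f x\<bar> powr a)" "integrable M (\<lambda>x. \<bar>g x\<bar> powr b)"
  shows "integrable M (\<lambda>x. f x * g x)"
    and "(\<integral>x. \<bar>f x * g x\<bar> \<partial>M) \<le> (\<integral>x. \<bar>f x\<bar> powr a \<partial>M) powr (1 / a) * (\<integral>x. \<bar>g x\<bar> powr b \<partial>M) powr (1 / b)"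
proof -
  have young: "\<bar>s * t\<bar> \<le> \<bar>s\<bar> powr a / a + \<bar>t\<bar> powr b / b" for s t :: real
    using Youngs_inequality[OF ab, of "\<bar>s\<bar>" "\<bar>t\<bar>"] by (simp add: abs_mult)
  show fg: "integrable M (\<lambda>x. f x * g x)"
    by (rule Bochner_Integration.integrable_bound[where f="\<lambda>x. \<bar>f x\<bar> powr a / a + \<bar>g x\<bar> powr b / b"])
      (use i ab young in \<open>auto intro!: order_trans[OF young]\<close>)
  define A B where "A = (\<integral>x. \<bar>f x\<bar> powr a \<partial>M)" and "B = (\<integral>x. \<bar>g x\<bar> powr b \<partial>M)"
  have AB: "0 \<le> A" "0 \<le> B" by (auto simp: A_def B_def)
  show "(\<integral>x. \<bar>f x * g x\<bar> \<partial>M) \<le> A powr (1 / a) * B powr (1 / b)"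
  proof (cases "A = 0 \<or> B = 0")
    case True
    then have "(AE x in M. \<bar>f x\<bar> powr a = 0) \<or> (AE x in M. \<bar>g x\<bar> powr b = 0)"
      using integral_nonneg_eq_0_iff_AE[OF i(1)] integral_nonneg_eq_0_iff_AE[OF i(2)] by (auto simp: A_def B_def)
    then have "AE x in M. \<bar>f x * g x\<bar> = 0" by auto
    then have "(\<integral>x. \<bar>f x * g x\<bar> \<partial>M) = 0" by (rule integral_eq_zero_AE)
    then show ?thesis using True by auto
  next
    case False
    then have AB: "0 < A" "0 < B" using AB by auto
    define s t where "s = A powr (1 / a)" and "t = B powr (1 / b)"
    have st: "0 < s" "0 < t" "s powr a = A" "t powr b = B"
      using AB ab by (auto simp: s_def t_def powr_powr)
    have le: "\<bar>f x * g x\<bar> / (s * t) \<le> \<bar>f x\<bar> powr a / A / a + \<bar>g x\<bar> powr b / B / b" for x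
      using young[of "f x / s" "g x / t"] st ab by (simp add: abs_mult powr_divide)
    have "(\<integral>x. \<bar>f x * g x\<bar> / (s * t) \<partial>M) \<le> (\<integral>x. \<bar>f x\<bar> powr a / A / a + \<bar>g x\<bar> powr b / B / b \<partial>M)"
      using fg i le by (intro integral_mono) auto
    also have "\<dots> = A / A / a + B / B / b" using i by (simp add: A_def B_def)
    also have "\<dots> = 1" using AB ab by simp
    finally show ?thesis using st by (simp add: s_def t_def)
  qed
qed

section \<open>Hoelder's inequality for several factors and the Loomis-Whitney inequality\<close>

lemma weighted_AM_GM:
  fixes x w :: "'i \<Rightarrow> real"
  assumes S: "finite S" and w: "\<And>i. i \<in> S \<Longrightarrow> 0 \<le> w i" "(\<Sum>i\<in>S. w i) = 1" and x: "\<And>i. i \<in> S \<Longrightarrow> 0 < x i"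
  shows "(\<Prod>i\<in>S. x i powr w i) \<le> (\<Sum>i\<in>S. w i * x i)"
proof -
  have "S \<noteq> {}" using w(2) by auto
  then have "exp (\<Sum>i\<in>S. w i *\<^sub>R ln (x i)) \<le> (\<Sum>i\<in>S. w i * exp (ln (x i)))"
    by (intro convex_on_sum[OF S _ exp_convex w(2)] w(1)) auto
  moreover have "exp (\<Sum>i\<in>S. w i *\<^sub>R ln (x i)) = (\<Prod>i\<in>S. x i powr w i)"
    unfolding exp_sum[OF S] by (rule prod.cong) (auto simp: powr_def dest: x)
  ultimately show ?thesis using x by simp
qed

text \<open>A class stable under products, arbitrary real powers and marginals, and integrable over
  finite measures. Inside it the Loomis-Whitney induction meets neither zeros nor questions of
  integrability; a nonnegative bounded function enters it after a constant \<open>d > 0\<close> is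
  added.\<close>

definition bounded_positive :: "'a measure \<Rightarrow> ('a \<Rightarrow> real) \<Rightarrow> bool" where
  "bounded_positive M f \<longleftrightarrow> f \<in> borel_measurable M \<and> (\<exists>d>0. \<exists>B. \<forall>x\<in>space M. d \<le> f x \<and> f x \<le> B)"

lemma bounded_positive_pos: "bounded_positive M f \<Longrightarrow> x \<in> space M \<Longrightarrow> 0 < f x"
  by (force simp: bounded_positive_def)

lemma bounded_positive_powr:
  assumes "bounded_positive M f" shows "bounded_positive M (\<lambda>x. f x powr a)"
proof -
  obtain d B where d: "0 < d" "\<And>x. x \<in> space M \<Longrightarrow> d \<le> f x \<and> f x \<le> B" and [measurable]: "f \<in> borel_measurable M"
    using assms by (auto simp: bounded_positive_def)
  \<comment> \<open>On an empty space \<open>B\<close> may be negative; the maximum with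
    \<open>d\<close> is positive in any case.\<close>
  define B' where "B' = max d B"
  have B': "0 < B'" "\<And>x. x \<in> space M \<Longrightarrow> f x \<le> B'" using d by (auto simp: B'_def le_max_iff_disj)
  have "min (d powr a) (B' powr a) \<le> f x powr a \<and> f x powr a \<le> max (d powr a) (B' powr a)" if x: "x \<in> space M" for x
    using d(2)[OF x] d(1) B'(2)[OF x] powr_mono2[of a "d" "f x"] powr_mono2[of a "f x" B']
      powr_mono2'[of a "d" "f x"] powr_mono2'[of a "f x" B']
    by (cases "0 \<le> a") (auto simp: min_le_iff_disj le_max_iff_disj)
  moreover have "0 < min (d powr a) (B' powr a)" using d B' by simp
  ultimately show ?thesis unfolding bounded_positive_def
    by (intro conjI exI[of _ "min (d powr a) (B' powr a)"] exI[of _ "max (d powr a) (B' powr a)"] ballI) auto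
qed

lemma bounded_positive_mult:
  assumes "bounded_positive M f" "bounded_positive M g" shows "bounded_positive M (\<lambda>x. f x * g x)"
proof -
  obtain d B where d: "0 < d" "\<And>x. x \<in> space M \<Longrightarrow> d \<le> f x \<and> f x \<le> B" and [measurable]: "f \<in> borel_measurable M"
    using assms(1) by (auto simp: bounded_positive_def)
  obtain d' B' where d': "0 < d'" "\<And>x. x \<in> space M \<Longrightarrow> d' \<le> g x \<and> g x \<le> B'" and [measurable]: "g \<in> borel_measurable M"
    using assms(2) by (auto simp: bounded_positive_def)
  have "d * d' \<le> f x * g x \<and> f x * g x \<le> B * B'" if "x \<in> space M" for x
    using d(2)[OF that] d'(2)[OF that] d(1) d'(1) by (intro conjI mult_mono) auto
  moreover have "0 < d * d'" using d d' by simp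
  ultimately show ?thesis unfolding bounded_positive_def
    by (intro conjI exI[of _ "d * d'"] exI[of _ "B * B'"]) auto
qed

lemma bounded_positive_const: "0 < c \<Longrightarrow> bounded_positive M (\<lambda>x. c)"
  by (auto simp: bounded_positive_def)

lemma bounded_positive_prod:
  assumes "finite I" "\<And>i. i \<in> I \<Longrightarrow> bounded_positive M (f i)"
  shows "bounded_positive M (\<lambda>x. \<Prod>i\<in>I. f i x)"
  using assms by (induction I rule: finite_induct) (auto intro: bounded_positive_mult bounded_positive_const)

lemma bounded_positive_compose:
  assumes "bounded_positive M f" "h \<in> N \<rightarrow>\<^sub>M M" shows "bounded_positive N (\<lambda>x. f (h x))"
  using assms measurable_space[OF assms(2)] measurable_compose[OF assms(2), of f borel]
  unfolding bounded_positive_def by blast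

lemma (in finite_measure) bounded_positive_integrable:
  assumes "bounded_positive M f" shows "integrable M f"
proof -
  obtain d B where d: "0 < d" "\<And>x. x \<in> space M \<Longrightarrow> d \<le> f x \<and> f x \<le> B" and m: "f \<in> borel_measurable M"
    using assms by (auto simp: bounded_positive_def)
  then show ?thesis by (intro integrable_const_bound[OF _ m, of B] AE_I2) force
qed

lemma (in finite_measure) bounded_positive_integral:
  assumes f: "bounded_positive (N \<Otimes>\<^sub>M M) f" and pos: "0 < measure M (space M)"
  shows "bounded_positive N (\<lambda>x. \<integral>y. f (x, y) \<partial>M)"
proof -
  obtain d B where d: "0 < d" "\<And>z. z \<in> space (N \<Otimes>\<^sub>M M) \<Longrightarrow> d \<le> f z \<and> f z \<le> B"
    and m[measurable]: "f \<in> borel_measurable (N \<Otimes>\<^sub>M M)"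
    using f by (auto simp: bounded_positive_def)
  have "d * measure M (space M) \<le> (\<integral>y. f (x, y) \<partial>M) \<and> (\<integral>y. f (x, y) \<partial>M) \<le> B * measure M (space M)"
    if x: "x \<in> space N" for x
  proof -
    have b: "d \<le> f (x, y) \<and> f (x, y) \<le> B" if "y \<in> space M" for y
      using d(2)[of "(x, y)"] x that by (simp add: space_pair_measure)
    have i: "integrable M (\<lambda>y. f (x, y))"
      by (intro bounded_positive_integrable bounded_positive_compose[OF f]) (use x in measurable)
    have "(\<integral>y. d \<partial>M) \<le> (\<integral>y. f (x, y) \<partial>M)"
      by (rule integral_mono) (use i b in auto)
    moreover have "(\<integral>y. f (x, y) \<partial>M) \<le> (\<integral>y. B \<partial>M)"
      by (rule integral_mono) (use i b in auto)
    ultimately have "(\<integral>y. d \<partial>M) \<le> (\<integral>y. f (x, y) \<partial>M)" "(\<integral>y. f (x, y) \<partial>M) \<le> (\<integral>y. B \<partial>M)" .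
    then show ?thesis by (simp add: mult.commute)
  qed
  moreover have "0 < d * measure M (space M)" using d pos by simp
  moreover have "(\<lambda>x. \<integral>y. f (x, y) \<partial>M) \<in> borel_measurable N" by measurable
  ultimately show ?thesis unfolding bounded_positive_def by blast
qed

text \<open>Each factor is divided by its integral \<open>c i\<close>. The weighted inequality of
  the means bounds the normalised product pointwise by a convex combination whose integral is
  1.\<close>

lemma (in finite_measure) Holder_inequality_prod:
  fixes f :: "'i \<Rightarrow> 'a \<Rightarrow> real"
  assumes S: "finite S" and w: "\<And>i. i \<in> S \<Longrightarrow> 0 \<le> w i" "(\<Sum>i\<in>S. w i) = 1"
    and f: "\<And>i. i \<in> S \<Longrightarrow> bounded_positive M (f i)" and pos: "0 < measure M (space M)"
  shows "(\<integral>x. (\<Prod>i\<in>S. f i x powr w i) \<partial>M) \<le> (\<Prod>i\<in>S. (\<integral>x. f i x \<partial>M) powr w i)"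
proof -
  define c where "c i = (\<integral>x. f i x \<partial>M)" for i
  have c: "0 < c i" if i: "i \<in> S" for i
  proof -
    obtain d B where d: "0 < d" "\<And>x. x \<in> space M \<Longrightarrow> d \<le> f i x \<and> f i x \<le> B"
      using f[OF i] by (auto simp: bounded_positive_def)
    have "(\<integral>x. d \<partial>M) \<le> c i"
      unfolding c_def using bounded_positive_integrable[OF f[OF i]] d by (intro integral_mono) auto
    moreover have "0 < (\<integral>x. d \<partial>M)" using d pos by simp
    ultimately show ?thesis by linarith
  qed
  have C: "0 < (\<Prod>i\<in>S. c i powr w i)" using c by (intro prod_pos) force
  have le: "(\<Prod>i\<in>S. f i x powr w i) / (\<Prod>i\<in>S. c i powr w i) \<le> (\<Sum>i\<in>S. w i * (f i x / c i))" if x: "x \<in> space M" for x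
  proof -
    have "(\<Prod>i\<in>S. f i x powr w i) / (\<Prod>i\<in>S. c i powr w i) = (\<Prod>i\<in>S. (f i x / c i) powr w i)"
      unfolding prod_dividef[symmetric]
      using bounded_positive_pos[OF f x] c by (intro prod.cong refl) (simp add: powr_divide less_imp_le)
    also have "\<dots> \<le> (\<Sum>i\<in>S. w i * (f i x / c i))"
      using bounded_positive_pos[OF f x] c by (intro weighted_AM_GM S w) auto
    finally show ?thesis .
  qed
  have ip: "integrable M (\<lambda>x. \<Prod>i\<in>S. f i x powr w i)"
    by (intro bounded_positive_integrable bounded_positive_prod S bounded_positive_powr f)
  have "(\<integral>x. (\<Prod>i\<in>S. f i x powr w i) / (\<Prod>i\<in>S. c i powr w i) \<partial>M) \<le> (\<integral>x. (\<Sum>i\<in>S. w i * (f i x / c i)) \<partial>M)"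
    using ip bounded_positive_integrable[OF f] le by (intro integral_mono) auto
  also have "\<dots> = (\<Sum>i\<in>S. w i * (c i / c i))"
    unfolding c_def using bounded_positive_integrable[OF f]
    by (subst Bochner_Integration.integral_sum) (simp_all only: integrable_mult_right integrable_divide_zero
      integral_mult_right_zero integral_divide_zero)
  also have "\<dots> = (\<Sum>i\<in>S. w i)" using c by (intro sum.cong refl) force
  also have "\<dots> = 1" by (rule w(2))
  finally show ?thesis using C by (simp add: c_def[abs_def])
qed

lemma finite_measure_PiM:
  assumes "finite_measure M" "finite I" shows "finite_measure (PiM I (\<lambda>_. M))"
proof
  interpret M: finite_measure M by fact
  interpret product_sigma_finite "\<lambda>_. M" by standard
  have "emeasure (PiM I (\<lambda>_. M)) (PiE I (\<lambda>_. space M)) = (\<Prod>i\<in>I. emeasure M (space M))"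
    by (rule emeasure_PiM) (use assms in auto)
  also have "\<dots> \<noteq> \<infinity>"
    using M.emeasure_finite by (simp only: ennreal_prod_eq_top infinity_ennreal_def) auto
  finally show "emeasure (PiM I (\<lambda>_. M)) (space (PiM I (\<lambda>_. M))) \<noteq> \<infinity>" by (simp add: space_PiM)
qed

lemma bounded_positive_marginal:
  assumes M: "finite_measure M" and pos: "0 < measure M (space M)" and f: "bounded_positive (PiM (insert i J) (\<lambda>_. M)) f"
  shows "bounded_positive (PiM J (\<lambda>_. M)) (\<lambda>x. \<integral>t. f (x(i := t)) \<partial>M)"
proof -
  interpret finite_measure M by (rule M)
  have "(\<lambda>z. (fst z)(i := snd z)) \<in> PiM J (\<lambda>_. M) \<Otimes>\<^sub>M M \<rightarrow>\<^sub>M PiM (insert i J) (\<lambda>_. M)"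
    by (rule measurable_fun_upd[where J=J]) auto
  from bounded_positive_integral[OF bounded_positive_compose[OF f this] pos] show ?thesis
    by (simp only: fst_conv snd_conv)
qed

text \<open>The induction of van Doorn and Macbeth: Hoelder's inequality in one variable removes that
  variable from the product, at the price of replacing \<open>f\<close> by its marginal.\<close>

lemma loomis_whitney_marginals:
  fixes M :: "'b measure" and q :: real
  assumes M: "finite_measure M" and pos: "0 < measure M (space M)" and q: "0 \<le> q"
    and I: "finite I" "(real (card I) - 1) * q \<le> 1" and f: "bounded_positive (PiM I (\<lambda>_. M)) f"
  shows "(\<integral>x. f x powr (1 - (real (card I) - 1) * q) * (\<Prod>i\<in>I. (\<integral>t. f (x(i := t)) \<partial>M) powr q) \<partial>PiM I (\<lambda>_. M))
    \<le> (\<integral>x. f x \<partial>PiM I (\<lambda>_. M)) powr (1 + q)"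
  using I f
proof (induction I arbitrary: f rule: finite_induct)
  case empty
  \<comment> \<open>Without variables the exponent is \<open>1 - (0 - 1) * q = 1 + q\<close>, and
    both sides agree on the one-point space.\<close>
  show ?case by (simp add: PiM_empty lebesgue_integral_count_space_finite add.commute)
next
  case (insert i J f)
  interpret M: finite_measure M by (rule M)
  interpret product_sigma_finite "\<lambda>_. M" by standard
  let ?P = "\<lambda>I. PiM I (\<lambda>_::'a. M)"
  interpret PJ: finite_measure "?P J" by (rule finite_measure_PiM[OF M insert(1)])
  interpret PiJ: finite_measure "?P (insert i J)" by (rule finite_measure_PiM[OF M]) (use insert in simp)
  interpret MM: finite_measure "M \<Otimes>\<^sub>M M" by (rule finite_measure_pair_measure[OF M M])
  interpret MM: pair_sigma_finite M M by standard
  note f = insert.prems(2)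
  define n where "n = card J"
  have nq: "real n * q \<le> 1" using insert.prems(1) insert.hyps by (simp add: n_def)
  have card: "real (card (insert i J)) - 1 = real n" using insert.hyps by (simp add: n_def)
  define F where "F x = (\<integral>t. f (x(i := t)) \<partial>M)" for x
  have F: "bounded_positive (?P J) F"
    unfolding F_def by (rule bounded_positive_marginal[OF M pos f])
  have fi: "bounded_positive M (\<lambda>y. f (x(i := y)))" if "x \<in> space (?P J)" for x

    by (rule bounded_positive_compose[OF f], rule measurable_fun_upd[where J=J]) (use that in auto)
  have space_upd: "x(j := t) \<in> space (?P J)" if "x \<in> space (?P J)" "j \<in> J" "t \<in> space M" for x j t
    using that by (auto simp: space_PiM PiE_iff extensional_def)
  have f2: "bounded_positive (M \<Otimes>\<^sub>M M) (\<lambda>z. f (x(j := snd z, i := fst z)))"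
    if "x \<in> space (?P J)" "j \<in> J" for x j
  proof (rule bounded_positive_compose[OF f])
    show "(\<lambda>z. x(j := snd z, i := fst z)) \<in> M \<Otimes>\<^sub>M M \<rightarrow>\<^sub>M ?P (insert i J)"
      by (rule measurable_fun_upd[where J=J], simp, rule measurable_fun_upd[where J=J]) (use that in auto)
  qed
  have f3: "bounded_positive M (\<lambda>y. \<integral>t. f (x(j := t, i := y)) \<partial>M)" if "x \<in> space (?P J)" "j \<in> J" for x j
    using M.bounded_positive_integral[OF f2[OF that] pos] by (simp only: fst_conv snd_conv)
  have fub: "(\<integral>y. (\<integral>t. f (x(j := t, i := y)) \<partial>M) \<partial>M) = (\<integral>t. F (x(j := t)) \<partial>M)"
    if "x \<in> space (?P J)" "j \<in> J" for x j
    unfolding F_def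
    using MM.Fubini_integral[of "\<lambda>y t. f (x(j := t, i := y))"] MM.bounded_positive_integrable[OF f2[OF that]]
    unfolding case_prod_beta' by (simp only:)
  define H where "H x = f x powr (1 - real n * q) * (\<Prod>k\<in>insert i J. (\<integral>t. f (x(k := t)) \<partial>M) powr q)" for x
  have H: "bounded_positive (?P (insert i J)) H"
  proof -
    have "bounded_positive (?P (insert i J)) (\<lambda>x. \<integral>t. f (x(k := t)) \<partial>M)" if k: "k \<in> insert i J" for k
      using bounded_positive_marginal[OF M pos, of k "insert i J" f] f k by (simp add: insert_absorb)
    then show ?thesis unfolding H_def
      using insert.hyps by (intro bounded_positive_mult bounded_positive_prod bounded_positive_powr f) auto
  qed
  have "(\<integral>x. H x \<partial>?P (insert i J)) = (\<integral>x. (\<integral>y. H (x(i := y)) \<partial>M) \<partial>?P J)"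
    by (rule product_integral_insert[OF insert.hyps PiJ.bounded_positive_integrable[OF H]])
  also have "\<dots> \<le> (\<integral>x. F x powr (1 - (real n - 1) * q) * (\<Prod>j\<in>J. (\<integral>t. F (x(j := t)) \<partial>M) powr q) \<partial>?P J)"
  proof (rule integral_mono)
    fix x assume x: "x \<in> space (?P J)"
    \<comment> \<open>The marginal in the variable \<open>i\<close> does not depend on
      \<open>y\<close>, so its power leaves the inner integral; the other marginals still
      do.\<close>
    have Hx: "H (x(i := y)) = F x powr q * (f (x(i := y)) powr (1 - real n * q) *
       (\<Prod>j\<in>J. (\<integral>t. f (x(j := t, i := y)) \<partial>M) powr q))" for y
    proof -
      have "(\<Prod>j\<in>J. (\<integral>t. f (x(i := y, j := t)) \<partial>M) powr q) = (\<Prod>j\<in>J. (\<integral>t. f (x(j := t, i := y)) \<partial>M) powr q)"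
      proof (rule prod.cong[OF refl])
        fix j assume "j \<in> J"
        then have "x(i := y, j := t) = x(j := t, i := y)" for t using insert.hyps by (intro fun_upd_twist) auto
        then show "(\<integral>t. f (x(i := y, j := t)) \<partial>M) powr q = (\<integral>t. f (x(j := t, i := y)) \<partial>M) powr q" by simp
      qed
      then show ?thesis using insert.hyps by (simp add: H_def F_def)
    qed
    \<comment> \<open>Hoelder is applied in \<open>y\<close> to \<open>f\<close> with weight
      \<open>1 - n * q\<close> and to the \<open>n\<close> remaining marginals with weight
      \<open>q\<close> each; the weights add up to 1. By Fubini, integrating a marginal of
      \<open>f\<close> over \<open>y\<close> gives the corresponding marginal of
      \<open>F\<close>.\<close>
    define h where "h k y = (if k = i then f (x(i := y)) else (\<integral>t. f (x(k := t, i := y)) \<partial>M))" for k y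
    define w where "w k = (if k = i then 1 - real n * q else q)" for k
    have neq: "j \<noteq> i" if "j \<in> J" for j using that insert.hyps by auto
    have "(\<integral>y. f (x(i := y)) powr (1 - real n * q) * (\<Prod>j\<in>J. (\<integral>t. f (x(j := t, i := y)) \<partial>M) powr q) \<partial>M) =
      (\<integral>y. (\<Prod>k\<in>insert i J. h k y powr w k) \<partial>M)"
      using insert.hyps neq by (simp add: h_def w_def cong: prod.cong)
    also have "\<dots> \<le> (\<Prod>k\<in>insert i J. (\<integral>y. h k y \<partial>M) powr w k)"
    proof (rule M.Holder_inequality_prod[OF _ _ _ _ pos])
      show "(\<Sum>k\<in>insert i J. w k) = 1"
        using insert.hyps neq by (simp add: w_def n_def cong: sum.cong)
      show "bounded_positive M (h k)" if "k \<in> insert i J" for k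
        using that neq fi[OF x] f3[OF x, of k] unfolding h_def by (cases "k = i") auto
    qed (use insert.hyps nq q in \<open>auto simp: w_def\<close>)
    also have "\<dots> = F x powr (1 - real n * q) * (\<Prod>j\<in>J. (\<integral>t. F (x(j := t)) \<partial>M) powr q)"
      using insert.hyps neq fub[OF x] by (simp add: h_def w_def F_def[symmetric] cong: prod.cong)
    finally have "(\<integral>y. H (x(i := y)) \<partial>M) \<le> F x powr q * (F x powr (1 - real n * q) * (\<Prod>j\<in>J. (\<integral>t. F (x(j := t)) \<partial>M) powr q))"
      unfolding Hx by (simp add: mult_left_mono)
    \<comment> \<open>The exponents \<open>q\<close> and \<open>1 - n * q\<close> of
      \<open>F\<close> add up to \<open>1 - (n - 1) * q\<close>, the one that the induction
      hypothesis expects for the \<open>n\<close> variables of \<open>J\<close>.\<close>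
    also have "\<dots> = F x powr (1 - (real n - 1) * q) * (\<Prod>j\<in>J. (\<integral>t. F (x(j := t)) \<partial>M) powr q)"
      unfolding mult.assoc[symmetric] powr_add[symmetric] by (simp add: algebra_simps)
    finally show "(\<integral>y. H (x(i := y)) \<partial>M) \<le> \<dots>" .
  next
    show "integrable (?P J) (\<lambda>x. \<integral>y. H (x(i := y)) \<partial>M)"
      by (rule PJ.bounded_positive_integrable[OF bounded_positive_marginal[OF M pos H]])
    have "bounded_positive (?P J) (\<lambda>x. \<integral>t. F (x(k := t)) \<partial>M)" if k: "k \<in> J" for k
      using bounded_positive_marginal[OF M pos, of k J F] F k by (simp add: insert_absorb)
    then show "integrable (?P J) (\<lambda>x. F x powr (1 - (real n - 1) * q) * (\<Prod>j\<in>J. (\<integral>t. F (x(j := t)) \<partial>M) powr q))"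
      using insert.hyps by (intro PJ.bounded_positive_integrable bounded_positive_mult bounded_positive_prod bounded_positive_powr F) auto
  qed
  also have "\<dots> \<le> (\<integral>x. F x \<partial>?P J) powr (1 + q)"
    unfolding n_def by (rule insert.IH[OF _ F]) (use nq q in \<open>simp add: n_def left_diff_distrib\<close>)
  also have "(\<integral>x. F x \<partial>?P J) = (\<integral>x. f x \<partial>?P (insert i J))"
    unfolding F_def by (rule product_integral_insert[OF insert.hyps PiJ.bounded_positive_integrable[OF f], symmetric])
  finally show ?case unfolding H_def card .
qed

section \<open>The Sobolev inequality\<close>

text \<open>Both measures agree on open boxes, a generator stable under intersection. The
  restriction to a cube keeps every factor finite, as the Loomis-Whitney induction requires.\<close>

lemma distr_PiM_density_interval:
  fixes R :: real
  assumes R: "0 < R"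
  defines "M \<equiv> density lborel (\<lambda>t. ennreal (indicator {-R..R} t))"
  shows "distr (PiM Basis (\<lambda>_. M)) borel (\<lambda>x. \<Sum>b\<in>Basis. x b *\<^sub>R b) =
    density lborel (\<lambda>x::'a::euclidean_space. ennreal (indicator (cbox (- (R *\<^sub>R One)) (R *\<^sub>R One)) x))"
proof (rule measure_eqI_generator_eq)
  let ?E = "range (\<lambda>(a, b). box a b::'a set)"
  let ?T = "\<lambda>x. \<Sum>b\<in>Basis. x b *\<^sub>R (b::'a)"
  let ?D = "density lborel (\<lambda>x::'a. ennreal (indicator (cbox (- (R *\<^sub>R One)) (R *\<^sub>R One)) x))"
  let ?A = "\<lambda>n::nat. box (- (real n *\<^sub>R One)) (real n *\<^sub>R One) :: 'a set"
  show "Int_stable ?E" by (auto simp: Int_stable_def box_Int_box)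
  show "?E \<subseteq> Pow UNIV" "sets (distr (PiM Basis (\<lambda>_. M)) borel ?T) = sigma_sets UNIV ?E"
    "sets ?D = sigma_sets UNIV ?E"
    by (simp_all add: borel_eq_box)
  show "range ?A \<subseteq> ?E" "(\<Union>i. ?A i) = UNIV" unfolding UN_box_eq_UNIV by auto
  have M: "finite_measure M"
  proof
    have "emeasure M (space M) = emeasure lborel {-R..R}"
      by (simp add: M_def emeasure_density ennreal_indicator)
    then show "emeasure M (space M) \<noteq> \<infinity>" using R by simp
  qed
  interpret finite_measure M by (rule M)
  interpret product_sigma_finite "\<lambda>_::'a. M" by standard
  have T[measurable]: "?T \<in> PiM Basis (\<lambda>_. M) \<rightarrow>\<^sub>M borel"
    by (intro borel_measurable_sum borel_measurable_scaleR borel_measurable_const measurable_compose[OF measurable_component_singleton])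
      (auto simp: M_def)
  have TM: "finite_measure (distr (PiM Basis (\<lambda>_. M)) borel ?T)"
    by (intro finite_measure.finite_measure_distr finite_measure_PiM M) auto
  show "emeasure (distr (PiM Basis (\<lambda>_. M)) borel ?T) (?A i) \<noteq> \<infinity>" for i
    using finite_measure.emeasure_finite[OF TM] by simp
  fix X assume "X \<in> ?E"
  then obtain l u where X: "X = box l u" by auto
  have "?T -` X \<inter> space (PiM Basis (\<lambda>_. M)) = (\<Pi>\<^sub>E b\<in>Basis. {l \<bullet> b<..<u \<bullet> b})"
    by (auto simp: X box_def space_PiM PiE_iff inner_sum_left inner_Basis if_distrib sum.delta M_def cong: if_cong)
  then have "emeasure (distr (PiM Basis (\<lambda>_. M)) borel ?T) X = emeasure (PiM Basis (\<lambda>_. M)) (\<Pi>\<^sub>E b\<in>Basis. {l \<bullet> b<..<u \<bullet> b})"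
    by (subst emeasure_distr) (auto simp: X)
  also have "\<dots> = (\<Prod>b\<in>Basis. emeasure M {l \<bullet> b<..<u \<bullet> b})"
    by (rule emeasure_PiM) (auto simp: M_def)
  also have "\<dots> = (\<Prod>b\<in>Basis. \<integral>\<^sup>+t. indicator ({-R..R} \<inter> {l \<bullet> b<..<u \<bullet> b}) t \<partial>lborel)"
    by (intro prod.cong refl) (auto simp: M_def emeasure_density indicator_def intro!: nn_integral_cong)
  also have "\<dots> = (\<integral>\<^sup>+x. (\<Prod>b\<in>Basis. indicator ({-R..R} \<inter> {l \<bullet> b<..<u \<bullet> b}) (x \<bullet> b)) \<partial>lborel)"
    by (rule nn_integral_lborel_prod[symmetric]) auto
  also have "\<dots> = (\<integral>\<^sup>+x. ennreal (indicator (cbox (- (R *\<^sub>R One)) (R *\<^sub>R One)) x) * indicator X x \<partial>lborel)"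
  proof (rule nn_integral_cong)
    fix x :: 'a
    show "(\<Prod>b\<in>Basis. indicator ({-R..R} \<inter> {l \<bullet> b<..<u \<bullet> b}) (x \<bullet> b)) =
       ennreal (indicator (cbox (- (R *\<^sub>R One)) (R *\<^sub>R One)) x) * indicator X x"
    proof (cases "\<forall>b\<in>Basis. x \<bullet> b \<in> {-R..R} \<inter> {l \<bullet> b<..<u \<bullet> b}")
      case True
      then show ?thesis by (simp add: X cbox_def box_def)
    next
      case False
      then obtain b where b: "b \<in> Basis" "x \<bullet> b \<notin> {-R..R} \<inter> {l \<bullet> b<..<u \<bullet> b}" by blast
      then have "(\<Prod>b\<in>Basis. indicator ({-R..R} \<inter> {l \<bullet> b<..<u \<bullet> b}) (x \<bullet> b)) = (0::ennreal)"
        by (intro prod_zero) (auto simp: indicator_def)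
      moreover have "x \<notin> cbox (- (R *\<^sub>R One)) (R *\<^sub>R One) \<inter> X"
        using b by (force simp: X cbox_def box_def)
      ultimately show ?thesis by (auto simp: indicator_def)
    qed
  qed
  also have "\<dots> = emeasure ?D X"
    by (subst emeasure_density) (auto simp: X)
  finally show "emeasure (distr (PiM Basis (\<lambda>_. M)) borel ?T) X = emeasure ?D X" .
qed

text \<open>Loomis-Whitney is used with \<open>q = 1 / (N - 1)\<close>, where the exponent of
  \<open>f\<close> itself becomes 0 and only the marginals remain. Writing the power of
  \<open>v\<close> as a product of \<open>N\<close> equal factors, one per coordinate,
  \<open>line\<close> bounds each factor by the marginal in its direction.\<close>

lemma gagliardo_inequality:
  fixes f v :: "'a::euclidean_space \<Rightarrow> real"
  assumes dim: "2 \<le> DIM('a)" and R: "0 < R"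
    and f: "continuous_on UNIV f" "\<And>x. 0 \<le> f x" "\<And>x. x \<notin> cbox (- (R *\<^sub>R One)) (R *\<^sub>R One) \<Longrightarrow> f x = 0"
    and v: "continuous_on UNIV v" "\<And>x. 0 \<le> v x" "\<And>x. x \<notin> cbox (- (R *\<^sub>R One)) (R *\<^sub>R One) \<Longrightarrow> v x = 0"
    and line: "\<And>x b. b \<in> Basis \<Longrightarrow> v x \<le> (\<integral>t. indicator {-R..R} t * f (x + (t - x \<bullet> b) *\<^sub>R b) \<partial>lborel)"
  shows "(\<integral>x. v x powr (real DIM('a) / (real DIM('a) - 1)) \<partial>lborel) \<le> (\<integral>x. f x \<partial>lborel) powr (real DIM('a) / (real DIM('a) - 1))"
proof -
  define N where "N = real DIM('a)"
  have N: "2 \<le> N" using dim by (simp add: N_def)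
  define q where "q = 1 / (N - 1)"
  have q: "0 < q" "1 + q = N / (N - 1)" "(N - 1) * q = 1" "N * q = N / (N - 1)"
    using N by (auto simp: q_def field_simps)
  let ?Q = "cbox (- (R *\<^sub>R One)) (R *\<^sub>R One) :: 'a set"
  let ?T = "\<lambda>x. \<Sum>b\<in>Basis. x b *\<^sub>R (b::'a)"
  define M where "M = density lborel (\<lambda>t. ennreal (indicator {-R..R} t))"
  have eM: "emeasure M (space M) = ennreal (2 * R)"
    using R by (simp add: M_def emeasure_density ennreal_indicator)
  have M: "finite_measure M" by standard (simp add: eM)
  have pos: "0 < measure M (space M)" using R by (simp add: measure_def eM)
  let ?P = "PiM (Basis :: 'a set) (\<lambda>_. M)"
  interpret P: finite_measure ?P by (rule finite_measure_PiM[OF M]) simp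
  interpret M: finite_measure M by (rule M)
  have spaceP: "space ?P = extensional Basis" by (auto simp: space_PiM M_def PiE_def)
  have T: "?T \<in> ?P \<rightarrow>\<^sub>M borel"
    by (intro borel_measurable_sum borel_measurable_scaleR borel_measurable_const measurable_compose[OF measurable_component_singleton])
      (auto simp: M_def)
  have comp: "compact ?Q" by simp
  obtain B where B: "0 < B" "\<And>x. f x \<le> B"
    using bounded_continuous_compact_support[OF f(1) comp f(3)] by (metis abs_le_D1 real_norm_def)
  have [measurable]: "f \<in> borel_measurable borel" "v \<in> borel_measurable borel"
    using f v by (auto intro: borel_measurable_continuous_onI)
  have trans: "(\<integral>x. h (?T x) \<partial>?P) = (\<integral>x. indicator ?Q x * h x \<partial>lborel)" if [measurable]: "h \<in> borel_measurable borel" for h :: "'a \<Rightarrow> real"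
  proof -
    have "(\<integral>x. h (?T x) \<partial>?P) = (\<integral>x. h x \<partial>(distr ?P borel ?T))"
      by (rule integral_distr[OF T, symmetric]) simp
    also have "\<dots> = (\<integral>x. indicator ?Q x * h x \<partial>lborel)"
      unfolding M_def distr_PiM_density_interval[OF R] by (subst integral_density) auto
    finally show ?thesis .
  qed
  have upd: "?T (x(b := t)) = ?T x + (t - ?T x \<bullet> b) *\<^sub>R b" if b: "b \<in> Basis" for x b t
  proof -
    have "?T x \<bullet> b = x b" using b by (simp add: inner_sum_left inner_Basis if_distrib sum.delta cong: if_cong)
    moreover have "?T (x(b := t)) = t *\<^sub>R b + (\<Sum>c\<in>Basis - {b}. x c *\<^sub>R c)"
      using b by (subst sum.remove[of _ b]) (auto intro!: sum.cong)
    moreover have "?T x = x b *\<^sub>R b + (\<Sum>c\<in>Basis - {b}. x c *\<^sub>R c)"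
      using b by (subst sum.remove[of _ b]) auto
    ultimately show ?thesis by (simp add: algebra_simps)
  qed
  have intf: "integrable lborel f" by (rule integrable_continuous_compact_support[OF f(1) comp f(3)])
  \<comment> \<open>The shift by \<open>d\<close> bounds the integrand away from 0 on the cube. It
    costs \<open>d\<close> times the volume of the cube and disappears as \<open>d\<close> tends to
    0.\<close>
  have main: "(\<integral>x. v x powr (N * q) \<partial>lborel) \<le> ((\<integral>x. f x \<partial>lborel) + d * measure lborel ?Q) powr (1 + q)" if d: "0 < d" for d
  proof -
    have bp: "bounded_positive ?P (\<lambda>x. f (?T x) + d)"
      unfolding bounded_positive_def
      by (intro conjI exI[of _ d] exI[of _ "B + d"] ballI borel_measurable_add measurable_compose[OF T])
        (use f B d in auto)
    have le: "v (?T x) \<le> (\<integral>t. f (?T (x(b := t))) + d \<partial>M)" if x: "x \<in> space ?P" and b: "b \<in> Basis" for x b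
    proof -
      have eq: "f (?T (x(b := t))) = f (?T x + (t - ?T x \<bullet> b) *\<^sub>R b)" for t by (simp only: upd[OF b])
      have [measurable]: "(\<lambda>t. f (?T x + (t - ?T x \<bullet> b) *\<^sub>R b)) \<in> borel_measurable borel" by measurable
      have i: "integrable M (\<lambda>t. f (?T (x(b := t))))"
      proof (rule M.integrable_const_bound[where B=B])
        show "(\<lambda>t. f (?T (x(b := t)))) \<in> borel_measurable M" unfolding eq by (simp add: M_def)
      qed (use f(2) B in auto)
      have "v (?T x) \<le> (\<integral>t. f (?T x + (t - ?T x \<bullet> b) *\<^sub>R b) \<partial>M)"
        using line[OF b, of "?T x"] unfolding M_def by (subst integral_density) auto
      also have "\<dots> = (\<integral>t. f (?T (x(b := t))) \<partial>M)" unfolding eq ..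
      also have "\<dots> \<le> (\<integral>t. f (?T (x(b := t))) + d \<partial>M)"
        using i d by (intro integral_mono) auto
      finally show ?thesis .
    qed
    have "(\<integral>x. v x powr (N * q) \<partial>lborel) = (\<integral>x. indicator ?Q x * v x powr (N * q) \<partial>lborel)"
      using v(3) by (intro Bochner_Integration.integral_cong refl) (auto simp: indicator_def)
    also have "\<dots> = (\<integral>x. v (?T x) powr (N * q) \<partial>?P)"
      by (rule trans[symmetric]) measurable
    also have "\<dots> \<le> (\<integral>x. (f (?T x) + d) powr (1 - (real (card (Basis :: 'a set)) - 1) * q) *
        (\<Prod>b\<in>Basis. (\<integral>t. f (?T (x(b := t))) + d \<partial>M) powr q) \<partial>?P)"
    proof (rule integral_mono)
      fix x assume x: "x \<in> space ?P"
      have "v (?T x) powr (N * q) = (\<Prod>b\<in>(Basis::'a set). v (?T x) powr q)"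
        using powr_power[of "v (?T x)" q "DIM('a)"] by (cases "v (?T x) = 0") (simp_all add: N_def)
      also have "\<dots> \<le> (\<Prod>b\<in>Basis. (\<integral>t. f (?T (x(b := t))) + d \<partial>M) powr q)"
        using v(2) le[OF x] q by (intro prod_mono conjI powr_mono2) auto
      also have "\<dots> = (f (?T x) + d) powr (1 - (real (card (Basis :: 'a set)) - 1) * q) *
        (\<Prod>b\<in>Basis. (\<integral>t. f (?T (x(b := t))) + d \<partial>M) powr q)"
      proof -
        have "f (?T x) + d > 0" using f(2)[of "?T x"] d by linarith
        moreover have "1 - (real (card (Basis :: 'a set)) - 1) * q = 0" using q by (simp add: N_def)
        ultimately show ?thesis by simp
      qed
      finally show "v (?T x) powr (N * q) \<le> \<dots>" .
    next
      obtain B2 where B2: "0 < B2" "\<And>x. v x \<le> B2"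
        using bounded_continuous_compact_support[OF v(1) comp v(3)] by (metis abs_le_D1 real_norm_def)
      show "integrable ?P (\<lambda>x. v (?T x) powr (N * q))"
      proof (rule P.integrable_const_bound[where B="B2 powr (N * q)"])
        show "AE x in ?P. norm (v (?T x) powr (N * q)) \<le> B2 powr (N * q)"
          using v(2) B2 N q by (auto intro!: powr_mono2)
        show "(\<lambda>x. v (?T x) powr (N * q)) \<in> borel_measurable ?P"
          by (rule measurable_compose[OF T]) measurable
      qed
      have "bounded_positive ?P (\<lambda>x. \<integral>t. f (?T (x(b := t))) + d \<partial>M)" if "b \<in> Basis" for b
        using bounded_positive_marginal[OF M pos, of b Basis "\<lambda>x. f (?T x) + d"] bp that by (simp add: insert_absorb)
      then show "integrable ?P (\<lambda>x. (f (?T x) + d) powr (1 - (real (card (Basis :: 'a set)) - 1) * q) *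
        (\<Prod>b\<in>Basis. (\<integral>t. f (?T (x(b := t))) + d \<partial>M) powr q))"
        by (intro P.bounded_positive_integrable bounded_positive_mult bounded_positive_prod bounded_positive_powr bp finite_Basis)
    qed
    also have "\<dots> \<le> (\<integral>x. f (?T x) + d \<partial>?P) powr (1 + q)"
      by (rule loomis_whitney_marginals[OF M pos _ finite_Basis _ bp]) (use q in \<open>auto simp: N_def\<close>)
    also have "(\<integral>x. f (?T x) + d \<partial>?P) = (\<integral>x. indicator ?Q x * (f x + d) \<partial>lborel)"
      by (rule trans) measurable
    also have "\<dots> = (\<integral>x. f x + d * indicator ?Q x \<partial>lborel)"
      using f(3) by (intro Bochner_Integration.integral_cong refl) (auto simp: indicator_def)
    also have "\<dots> = (\<integral>x. f x \<partial>lborel) + d * measure lborel ?Q"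
    proof (subst Bochner_Integration.integral_add[OF intf])
      show "integrable lborel (\<lambda>x. d * indicator ?Q x)"
        by (intro integrable_mult_right integrable_real_indicator) (use emeasure_compact_finite[OF comp] in auto)
    qed simp
    finally show ?thesis .
  qed
  have "(\<integral>x. v x powr (N * q) \<partial>lborel) \<le> (\<integral>x. f x \<partial>lborel) powr (1 + q)"
  proof (rule tendsto_lowerbound)
    have "((\<lambda>d. ((\<integral>x. f x \<partial>lborel) + d * measure lborel ?Q) powr (1 + q)) \<longlongrightarrow> ((\<integral>x. f x \<partial>lborel) + 0 * measure lborel ?Q) powr (1 + q)) (at_right 0)"
    proof (rule tendsto_powr2)
      show "\<forall>\<^sub>F d in at_right 0. 0 \<le> (\<integral>x. f x \<partial>lborel) + d * measure lborel ?Q"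
        using f(2) by (auto simp: eventually_at_filter intro!: always_eventually add_nonneg_nonneg integral_nonneg)
      show "((\<lambda>d. (\<integral>x. f x \<partial>lborel) + d * measure lborel ?Q) \<longlongrightarrow> (\<integral>x. f x \<partial>lborel) + 0 * measure lborel ?Q) (at_right 0)"
        by (intro tendsto_intros)
    qed (use q in auto)
    then show "((\<lambda>d. ((\<integral>x. f x \<partial>lborel) + d * measure lborel ?Q) powr (1 + q)) \<longlongrightarrow> (\<integral>x. f x \<partial>lborel) powr (1 + q)) (at_right 0)" by simp
    show "\<forall>\<^sub>F d in at_right 0. (\<integral>x. v x powr (N * q) \<partial>lborel) \<le> ((\<integral>x. f x \<partial>lborel) + d * measure lborel ?Q) powr (1 + q)"
      using main by (auto simp: eventually_at_filter)
  qed simp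
  then show ?thesis using q by (simp add: N_def)
qed

section \<open>Sobolev's inequality for test functions and their limits\<close>

lemma has_real_derivative_abs_powr:
  fixes s c :: real
  assumes c: "1 < c"
  shows "((\<lambda>s. \<bar>s\<bar> powr c) has_real_derivative c * \<bar>s\<bar> powr (c - 1) * sgn s) (at s)"
proof -
  consider "s > 0" | "s < 0" | "s = 0" by linarith
  then show ?thesis
  proof cases
    case 1
    have "((\<lambda>s. s powr c) has_real_derivative c * \<bar>s\<bar> powr (c - 1) * sgn s) (at s)"
      using 1 by (auto intro!: derivative_eq_intros)
    then show ?thesis
      by (rule has_field_derivative_transform_within_open[where S="{0<..}"]) (use 1 in auto)
  next
    case 2
    have "((\<lambda>s. (- s) powr c) has_real_derivative c * \<bar>s\<bar> powr (c - 1) * sgn s) (at s)"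
      using 2 by (auto intro!: derivative_eq_intros)
    then show ?thesis
      by (rule has_field_derivative_transform_within_open[where S="{..<0}"]) (use 2 in auto)
  next
    case 3
    have "((\<lambda>h. \<bar>h\<bar> powr (c - 1)) \<longlongrightarrow> \<bar>0\<bar> powr (c - 1)) (at (0::real))"
      using c by (intro tendsto_powr2 tendsto_intros) auto
    then have "((\<lambda>h. \<bar>h\<bar> powr c / h) \<longlongrightarrow> 0) (at 0)"
    proof (rule Lim_null_comparison[rotated, OF tendsto_eq_rhs])
      show "\<forall>\<^sub>F h in at 0. norm (\<bar>h\<bar> powr c / h) \<le> \<bar>h\<bar> powr (c - 1)"
        by (auto simp: eventually_at_filter powr_diff)
    qed simp
    then show ?thesis using 3 by (simp add: has_field_derivative_iff)
  qed
qed

lemma classical_grad_bound: "b \<in> Basis \<Longrightarrow> \<bar>frechet_derivative \<phi> (at x) b\<bar> \<le> norm (classical_grad \<phi> x)"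
  using Basis_le_norm[of b "classical_grad \<phi> x"] by (simp add: classical_grad_inner)

text \<open>The fundamental theorem of calculus along the line through \<open>x\<close> in direction
  \<open>b\<close>, started on the face of the cube at coordinate \<open>- R\<close>, where the test
  function vanishes. The exponent \<open>c > 1\<close> makes the power of the absolute value
  differentiable also at zeros.\<close>

lemma test_function_line_bound:
  fixes \<phi> :: "'a::euclidean_space \<Rightarrow> real"
  assumes \<phi>: "\<phi> \<in> test_functions \<Omega>" and c: "1 < c" and b: "b \<in> Basis"
    and R: "\<And>x. \<phi> x \<noteq> 0 \<Longrightarrow> x \<in> box (- (R *\<^sub>R One)) (R *\<^sub>R One)"
  defines "f \<equiv> \<lambda>x. c * \<bar>\<phi> x\<bar> powr (c - 1) * norm (classical_grad \<phi> x)"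
  shows "\<bar>\<phi> x\<bar> powr c \<le> (\<integral>t. indicator {-R..R} t * f (x + (t - x \<bullet> b) *\<^sub>R b) \<partial>lborel)"
proof (cases "\<phi> x = 0")
  case True
  then show ?thesis using c by (auto simp: f_def intro!: integral_nonneg)
next
  case False
  define s where "s = x \<bullet> b"
  define z where "z = x - s *\<^sub>R b"
  have zt: "x + (t - x \<bullet> b) *\<^sub>R b = z + t *\<^sub>R b" for t by (simp add: z_def s_def algebra_simps)
  have zb: "(z + t *\<^sub>R b) \<bullet> b = t" for t using b by (simp add: z_def s_def inner_diff_left inner_add_left)
  have s: "-R < s" "s < R" using R[OF False] b by (auto simp: s_def box_def)
  have fc: "continuous_on UNIV f"
    unfolding f_def using c continuous_on_test_function[OF \<phi>] continuous_on_classical_grad[OF \<phi>]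
    by (intro continuous_on_mult continuous_on_const continuous_on_powr' continuous_on_norm) (auto intro: continuous_intros)
  have gc: "continuous_on A (\<lambda>t. f (z + t *\<^sub>R b))" for A
    by (rule continuous_on_compose2[OF fc]) (auto intro!: continuous_intros)
  define h' where "h' t = c * \<bar>\<phi> (z + t *\<^sub>R b)\<bar> powr (c - 1) * sgn (\<phi> (z + t *\<^sub>R b)) * frechet_derivative \<phi> (at (z + t *\<^sub>R b)) b" for t
  have der: "((\<lambda>t. \<bar>\<phi> (z + t *\<^sub>R b)\<bar> powr c) has_real_derivative h' t) (at t)" for t
    unfolding h'_def
    using DERIV_chain2[OF has_real_derivative_abs_powr[OF c] has_derivative_along_line[OF test_function_has_derivative[OF \<phi>]]] .
  have "(h' has_integral (\<bar>\<phi> (z + s *\<^sub>R b)\<bar> powr c - \<bar>\<phi> (z + (-R) *\<^sub>R b)\<bar> powr c)) {-R..s}"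
    using s by (intro fundamental_theorem_of_calculus)
      (auto intro: has_vector_derivative_at_within der[unfolded has_real_derivative_iff_has_vector_derivative])
  moreover have "\<phi> (z + (-R) *\<^sub>R b) = 0"
  proof (rule ccontr)
    assume "\<phi> (z + (-R) *\<^sub>R b) \<noteq> 0"
    then have "(- (R *\<^sub>R One)) \<bullet> b < (z + (-R) *\<^sub>R b) \<bullet> b" using R b unfolding box_def by blast
    then show False using b unfolding zb by simp
  qed
  moreover have "z + s *\<^sub>R b = x" by (simp add: z_def)
  ultimately have int: "(h' has_integral \<bar>\<phi> x\<bar> powr c) {-R..s}" by simp
  have fi: "(\<lambda>t. f (z + t *\<^sub>R b)) integrable_on {u..w}" for u w by (rule integrable_continuous_interval[OF gc])
  have "\<bar>\<phi> x\<bar> powr c \<le> integral {-R..s} (\<lambda>t. f (z + t *\<^sub>R b))"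
  proof (rule has_integral_le[OF int integrable_integral[OF fi]])
    fix t
    have "h' t \<le> \<bar>h' t\<bar>" by simp
    also have "\<dots> \<le> c * \<bar>\<phi> (z + t *\<^sub>R b)\<bar> powr (c - 1) * 1 * norm (classical_grad \<phi> (z + t *\<^sub>R b))"
      unfolding h'_def abs_mult using c classical_grad_bound[OF b]
      by (intro mult_mono) (auto simp: sgn_if)
    finally show "h' t \<le> f (z + t *\<^sub>R b)" by (simp add: f_def)
  qed
  \<comment> \<open>The integrand is nonnegative, so the range may be enlarged until it no longer
    depends on \<open>x\<close>.\<close>
  also have "\<dots> \<le> integral {-R..R} (\<lambda>t. f (z + t *\<^sub>R b))"
    using s c by (intro integral_subset_le fi) (auto simp: f_def)
  also have "\<dots> = (LINT t:{-R..R}|lborel. f (z + t *\<^sub>R b))"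
    by (rule set_borel_integral_eq_integral(2)[symmetric]) (rule borel_integrable_atLeastAtMost'[OF gc])
  finally show ?thesis unfolding zt by (simp add: set_lebesgue_integral_def)
qed

text \<open>The exponent \<open>c\<close> is chosen so that \<open>c * N / (N - 1)\<close> and
  \<open>(c - 1) * p / (p - 1)\<close> both equal \<open>ps\<close>. The Gagliardo inequality for
  the \<open>c\<close>-th power of \<open>|\<phi>|\<close>, followed by Hoelder, then yields the
  same integral \<open>X\<close> on both sides, with a smaller total power on the right.\<close>

lemma sobolev_test_function:
  fixes \<phi> :: "'a::euclidean_space \<Rightarrow> real" and p :: real
  assumes p: "1 < p" "p < DIM('a)" and \<phi>: "\<phi> \<in> test_functions \<Omega>"
  defines "ps \<equiv> sobolev_exponent DIM('a) p" and "c \<equiv> p * (real DIM('a) - 1) / (real DIM('a) - p)"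
  shows "(\<integral>x. \<bar>\<phi> x\<bar> powr ps \<partial>lborel) powr (p / ps) \<le> c powr p * (\<integral>x. norm (classical_grad \<phi> x) powr p \<partial>lborel)"
proof -
  define N where "N = real DIM('a)"
  have "2 \<le> DIM('a)" using p by linarith
  then have N: "1 < p" "p < N" "2 \<le> N" using p by (auto simp: N_def)
  have ps: "ps = N * p / (N - p)" by (simp add: ps_def sobolev_exponent_def N_def)
  have cN: "c = p * (N - 1) / (N - p)" by (simp add: c_def N_def)
  have c: "1 < c" using N by (simp add: cN field_simps)
  have exps: "c * (N / (N - 1)) = ps" "(c - 1) * (p / (p - 1)) = ps" "p / ps = (N - p) / N" "0 < ps"
    using N by (simp_all add: ps cN divide_simps) (simp_all add: algebra_simps)
  obtain K where K: "compact K" "K \<subseteq> \<Omega>" "\<And>x. x \<notin> K \<Longrightarrow> \<phi> x = 0"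
    "\<And>x. x \<notin> K \<Longrightarrow> frechet_derivative \<phi> (at x) = (\<lambda>_. 0)"
    using test_function_support[OF \<phi>] by metis
  obtain B where B: "0 < B" "\<And>x. x \<in> K \<Longrightarrow> norm x \<le> B"
    using compact_imp_bounded[OF K(1)] by (auto simp: bounded_pos)
  define R where "R = B + 1"
  have R: "0 < R" "\<And>x. x \<in> K \<Longrightarrow> norm x < R" using B by (force simp: R_def)+
  have KR: "x \<in> box (- (R *\<^sub>R One)) (R *\<^sub>R One)" if "x \<in> K" for x :: 'a
    unfolding box_def mem_Collect_eq
  proof
    fix b :: 'a assume b: "b \<in> Basis"
    have "\<bar>x \<bullet> b\<bar> < R" using Basis_le_norm[OF b, of x] R(2)[OF that] by linarith
    then show "- (R *\<^sub>R One) \<bullet> b < x \<bullet> b \<and> x \<bullet> b < R *\<^sub>R One \<bullet> b" using b by (auto simp: abs_less_iff)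
  qed
  define f where "f x = c * \<bar>\<phi> x\<bar> powr (c - 1) * norm (classical_grad \<phi> x)" for x
  note c\<phi> = continuous_on_test_function[OF \<phi>] continuous_on_classical_grad[OF \<phi>]
  have cont: "continuous_on UNIV f" "continuous_on UNIV (\<lambda>x. \<bar>\<phi> x\<bar> powr e)"
    "continuous_on UNIV (\<lambda>x. norm (classical_grad \<phi> x) powr e)" if "0 < e" for e
    unfolding f_def using c c\<phi> that
    by (intro continuous_on_mult continuous_on_const continuous_on_powr' continuous_on_norm; auto intro: continuous_intros)+
  have meas[measurable]: "\<phi> \<in> borel_measurable borel" "classical_grad \<phi> \<in> borel_measurable borel"
    using c\<phi> by (auto intro: borel_measurable_continuous_onI)
  define X where "X = (\<integral>x. \<bar>\<phi> x\<bar> powr ps \<partial>lborel)"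
  define Y where "Y = (\<integral>x. norm (classical_grad \<phi> x) powr p \<partial>lborel)"
  have XY: "0 \<le> X" "0 \<le> Y" by (auto simp: X_def Y_def)
  have "X = (\<integral>x. (\<bar>\<phi> x\<bar> powr c) powr (N / (N - 1)) \<partial>lborel)"
    by (simp only: X_def powr_powr exps)
  also have "\<dots> \<le> (\<integral>x. f x \<partial>lborel) powr (N / (N - 1))"
    unfolding N_def
  proof (rule gagliardo_inequality[OF _ R(1)])
    show "\<bar>\<phi> x\<bar> powr c \<le> (\<integral>t. indicator {-R..R} t * f (x + (t - x \<bullet> b) *\<^sub>R b) \<partial>lborel)" if "b \<in> Basis" for x b
      unfolding f_def by (rule test_function_line_bound[OF \<phi> c that]) (use K(3) KR in blast)
    show "f x = 0" if "x \<notin> cbox (- (R *\<^sub>R One)) (R *\<^sub>R One)" for x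
      using that K(3)[of x] KR[of x] box_subset_cbox c unfolding f_def by fastforce
    show "\<bar>\<phi> x\<bar> powr c = 0" if "x \<notin> cbox (- (R *\<^sub>R One)) (R *\<^sub>R One)" for x
      using that K(3)[of x] KR[of x] box_subset_cbox by fastforce
  qed (use \<open>2 \<le> DIM('a)\<close> cont[of c] c in \<open>auto simp: f_def\<close>)
  finally have 1: "X \<le> (\<integral>x. f x \<partial>lborel) powr (N / (N - 1))" .
  have abp: "1 < p / (p - 1)" "1 / (p / (p - 1)) + 1 / p = 1" using N by (auto simp: field_simps)
  have iX: "integrable lborel (\<lambda>x. \<bar>\<bar>\<phi> x\<bar> powr (c - 1)\<bar> powr (p / (p - 1)))"
    unfolding abs_of_nonneg[OF powr_ge_zero] powr_powr exps
    using cont(2)[OF exps(4)] K by (auto intro: integrable_continuous_compact_support)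
  have iY: "integrable lborel (\<lambda>x. \<bar>norm (classical_grad \<phi> x)\<bar> powr p)"
    using cont(3)[of p] K N by (auto intro!: integrable_continuous_compact_support[OF _ K(1)] simp: classical_grad_def)
  have "(\<integral>x. f x \<partial>lborel) = c * (\<integral>x. \<bar>\<bar>\<phi> x\<bar> powr (c - 1) * norm (classical_grad \<phi> x)\<bar> \<partial>lborel)"
    by (simp add: f_def mult.assoc)
  also have "\<dots> \<le> c * (X powr (1 / (p / (p - 1))) * Y powr (1 / p))"
    using Holder_inequality(2)[OF abp(1) N(1) abp(2) _ _ iX iY] c
    unfolding abs_of_nonneg[OF powr_ge_zero] abs_norm_cancel powr_powr exps X_def Y_def
    by (intro mult_left_mono) simp_all
  finally have 2: "(\<integral>x. f x \<partial>lborel) \<le> c * (X powr ((p - 1) / p) * Y powr (1 / p))" by simp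
  show ?thesis
  proof (cases "X = 0")
    case True
    then show ?thesis using XY by (simp add: X_def[symmetric] Y_def[symmetric])
  next
    case False
    then have X: "0 < X" using XY by simp
    have "X \<le> (c * (X powr ((p - 1) / p) * Y powr (1 / p))) powr (N / (N - 1))"
      using 1 2 N c by (auto intro!: order_trans[OF 1] powr_mono2 integral_nonneg simp: f_def)
    \<comment> \<open>This power turns the outer exponent \<open>N / (N - 1)\<close> into
      \<open>p\<close>. The right-hand side then contains \<open>X\<close> to the power
      \<open>p - 1\<close>, which is divided out since \<open>X > 0\<close>; the exponent left over
      is \<open>p / ps\<close>.\<close>
    then have "X powr ((N - 1) / N * p) \<le> ((c * (X powr ((p - 1) / p) * Y powr (1 / p))) powr (N / (N - 1))) powr ((N - 1) / N * p)"
      using N X by (intro powr_mono2) auto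
    also have "\<dots> = (c * (X powr ((p - 1) / p) * Y powr (1 / p))) powr p"
      using N by (simp add: powr_powr)
    also have "\<dots> = c powr p * X powr (p - 1) * Y"
      using N c XY by (simp add: powr_mult powr_powr)
    finally have "X powr ((N - 1) / N * p) / X powr (p - 1) \<le> c powr p * Y"
      using X by (simp add: divide_le_eq mult_ac)
    moreover have "(N - 1) / N * p - (p - 1) = p / ps" using N by (simp add: exps field_simps)
    ultimately show ?thesis using X by (simp add: powr_diff[symmetric] X_def[symmetric] Y_def[symmetric])
  qed
qed

text \<open>Constants do not matter below, so the triangle inequality in \<open>L\<^sup>p\<close> is replaced by the
  cruder bound with the factor \<open>2 powr p\<close>.\<close>

lemma sobolev_Lp_limit:
  fixes w :: "'a::euclidean_space \<Rightarrow> real" and p :: real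
  assumes \<Omega>: "open \<Omega>" "bounded \<Omega>" and p: "1 < p" "p < DIM('a)" and \<psi>: "\<And>n::nat. \<psi> n \<in> test_functions \<Omega>"
    and ae: "AE x in lebesgue_on \<Omega>. (\<lambda>n. \<psi> n x) \<longlonglongrightarrow> w x" and g: "g \<in> L_space \<Omega> (ereal p)"
    and ng: "Lp_null (lebesgue_on \<Omega>) p (\<lambda>n x. g x - classical_grad (\<psi> n) x)"
  defines "ps \<equiv> sobolev_exponent DIM('a) p" and "c \<equiv> p * (real DIM('a) - 1) / (real DIM('a) - p)"
  shows "(\<integral>\<^sup>+x. ennreal (\<bar>w x\<bar> powr ps) \<partial>(lebesgue_on \<Omega>)) \<le>
     ennreal ((c powr p * 2 powr p * (\<integral>x. norm (g x) powr p \<partial>(lebesgue_on \<Omega>))) powr (ps / p))"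
proof -
  have ps: "0 < ps" using p by (simp add: ps_def sobolev_exponent_def)
  have c0: "0 < c" using p by (simp add: c_def)
  let ?M = "lebesgue_on \<Omega>"
  define Y where "Y = (\<integral>x. norm (g x) powr p \<partial>?M)"
  define e where "e n = (\<integral>x. norm (g x - classical_grad (\<psi> n) x) powr p \<partial>?M)" for n
  have e: "e \<longlonglongrightarrow> 0" "\<And>n. 0 \<le> e n" and Y: "0 \<le> Y" using ng by (auto simp: e_def[abs_def] Y_def Lp_null_def)
  define b where "b n = (c powr p * 2 powr p * (Y + e n)) powr (ps / p)" for n
  have le: "(\<integral>\<^sup>+x. ennreal (\<bar>\<psi> n x\<bar> powr ps) \<partial>?M) \<le> ennreal (b n)" for n
  proof -
    obtain K where K: "compact K" "K \<subseteq> \<Omega>" "\<And>x. x \<notin> K \<Longrightarrow> \<psi> n x = 0"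
      "\<And>x. x \<notin> K \<Longrightarrow> frechet_derivative (\<psi> n) (at x) = (\<lambda>_. 0)"
      using test_function_support[OF \<psi>] by metis
    note cont = continuous_on_test_function[OF \<psi>[of n]] continuous_on_classical_grad[OF \<psi>[of n]]
    have m[measurable]: "\<psi> n \<in> borel_measurable borel" "classical_grad (\<psi> n) \<in> borel_measurable borel"
      using cont by (auto intro: borel_measurable_continuous_onI)
    have \<Omega>s: "\<Omega> \<in> sets lebesgue" using \<Omega> by auto
    have out: "x \<notin> K" if "x \<notin> \<Omega>" for x using that K(2) by blast
    have g0: "classical_grad (\<psi> n) x = 0" if "x \<notin> K" for x using K(4)[OF that] by (simp add: classical_grad_def)
    have X: "(\<integral>x. \<bar>\<psi> n x\<bar> powr ps \<partial>?M) = (\<integral>x. \<bar>\<psi> n x\<bar> powr ps \<partial>lborel)"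
      by (rule integral_lebesgue_on_eq_lborel[OF \<Omega>s]) (use K(3) out in auto)
    have Z: "(\<integral>x. norm (classical_grad (\<psi> n) x) powr p \<partial>?M) = (\<integral>x. norm (classical_grad (\<psi> n) x) powr p \<partial>lborel)"
      by (rule integral_lebesgue_on_eq_lborel[OF \<Omega>s]) (use g0 out in auto)
    have gi: "g \<in> borel_measurable ?M" "integrable ?M (\<lambda>x. norm (g x) powr p)" using g by (auto simp: L_space_iff)
    have hi: "(\<lambda>x. - (g x - classical_grad (\<psi> n) x)) \<in> borel_measurable ?M" "integrable ?M (\<lambda>x. norm (- (g x - classical_grad (\<psi> n) x)) powr p)"
      using ng by (simp_all only: Lp_null_def norm_minus_cancel borel_measurable_uminus)
    have Z2: "(\<integral>x. norm (classical_grad (\<psi> n) x) powr p \<partial>?M) \<le> 2 powr p * (Y + e n)"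
      using integrable_norm_powr_add(2)[OF gi(1) hi(1) gi(2) hi(2)] p
      by (simp add: Y_def e_def norm_minus_commute)
    have "(\<integral>x. \<bar>\<psi> n x\<bar> powr ps \<partial>?M) powr (p / ps) \<le> c powr p * (2 powr p * (Y + e n))"
      using sobolev_test_function[OF p \<psi>[of n]] Z2 unfolding X Z ps_def[symmetric] c_def[symmetric]
      by (meson mult_left_mono order_trans powr_ge_zero)
    then have "((\<integral>x. \<bar>\<psi> n x\<bar> powr ps \<partial>?M) powr (p / ps)) powr (ps / p) \<le> b n"
      unfolding b_def using p ps by (intro powr_mono2) (auto simp: mult.assoc)
    then have "(\<integral>x. \<bar>\<psi> n x\<bar> powr ps \<partial>?M) \<le> b n" using p ps by (simp add: powr_powr)
    moreover have "integrable ?M (\<lambda>x. \<bar>\<psi> n x\<bar> powr ps)"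
      using test_function_L_space(1)[OF \<Omega> \<psi>[of n], of ps] ps by (simp add: L_space_iff)
    ultimately show ?thesis by (subst nn_integral_eq_integral) (auto intro: ennreal_leI)
  qed
  have "b \<longlonglongrightarrow> (c powr p * 2 powr p * (Y + 0)) powr (ps / p)"
    unfolding b_def using e Y p ps c0 by (intro tendsto_powr2 tendsto_intros always_eventually allI) auto
  then have b: "(\<lambda>n. ennreal (b n)) \<longlonglongrightarrow> ennreal ((c powr p * 2 powr p * Y) powr (ps / p))"
    by (intro tendsto_ennrealI) simp
  \<comment> \<open>Fatou's lemma with nonnegative integrals, so that the integrability of the limit
    is a result and not an assumption.\<close>
  have "(\<integral>\<^sup>+x. ennreal (\<bar>w x\<bar> powr ps) \<partial>?M) = (\<integral>\<^sup>+x. liminf (\<lambda>n. ennreal (\<bar>\<psi> n x\<bar> powr ps)) \<partial>?M)"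
  proof (rule nn_integral_cong_AE)
    show "AE x in ?M. ennreal (\<bar>w x\<bar> powr ps) = liminf (\<lambda>n. ennreal (\<bar>\<psi> n x\<bar> powr ps))"
      using ae
    proof eventually_elim
      case (elim x)
      have "(\<lambda>n. ennreal (\<bar>\<psi> n x\<bar> powr ps)) \<longlonglongrightarrow> ennreal (\<bar>w x\<bar> powr ps)"
        using elim ps by (intro tendsto_ennrealI tendsto_powr2 tendsto_rabs) auto
      then show ?case by (intro lim_imp_Liminf[symmetric]) auto
    qed
  qed
  also have "\<dots> \<le> liminf (\<lambda>n. \<integral>\<^sup>+x. ennreal (\<bar>\<psi> n x\<bar> powr ps) \<partial>?M)"
  proof (rule nn_integral_liminf)
    show "(\<lambda>x. ennreal (\<bar>\<psi> n x\<bar> powr ps)) \<in> borel_measurable ?M" for n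
      using test_function_L_space(1)[OF \<Omega> \<psi>[of n], of ps] ps by (auto simp: L_space_iff)
  qed
  also have "\<dots> \<le> liminf (\<lambda>n. ennreal (b n))"
    by (intro Liminf_mono always_eventually allI le)
  also have "\<dots> = ennreal ((c powr p * 2 powr p * Y) powr (ps / p))"
    by (intro lim_imp_Liminf b) simp
  finally show ?thesis by (simp add: Y_def)
qed

section \<open>The energy inequality\<close>

text \<open>With \<open>w = G(u)\<close> as test function the left side of the equation has
  integrand \<open>G'(u) |\<nabla>u|^p\<close>. As the slope lies in \<open>[0, 1]\<close> and
  \<open>p > 1\<close>, this dominates \<open>|\<nabla>w|^p = G'(u)^p |\<nabla>u|^p\<close>. So
  \<open>J\<close> bounds the gradient norm of \<open>w\<close>, and Sobolev's inequality
  finishes.\<close>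

lemma (in smooth_contraction) weak_solution_energy:
  fixes u :: "'a::euclidean_space \<Rightarrow> real" and p :: real
  assumes \<Omega>: "open \<Omega>" "bounded \<Omega>" and p: "1 < p" "p < DIM('a)" and sol: "p_laplace_weak_solution \<Omega> p f u"
    and J: "0 \<le> J" "(\<integral>\<^sup>+x. ennreal \<bar>f x (u x) * G (u x)\<bar> \<partial>(lebesgue_on \<Omega>)) \<le> ennreal J"
  defines "ps \<equiv> sobolev_exponent DIM('a) p" and "c \<equiv> p * (real DIM('a) - 1) / (real DIM('a) - p)"
  shows "(\<integral>\<^sup>+x. ennreal (\<bar>G (u x)\<bar> powr ps) \<partial>(lebesgue_on \<Omega>)) \<le> ennreal ((c powr p * 2 powr p * J) powr (ps / p))"
proof -
  let ?M = "lebesgue_on \<Omega>"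
  have p1: "1 \<le> p" using p by simp
  have u: "u \<in> W1_0 \<Omega> p" using sol by (simp add: p_laplace_weak_solution_def)
  obtain \<psi> where w: "(\<lambda>x. G (u x)) \<in> W1_0 \<Omega> p"
    and ae: "AE x in ?M. weak_grad \<Omega> (\<lambda>x. G (u x)) x = deriv G (u x) *\<^sub>R weak_grad \<Omega> u x"
    and \<psi>: "\<And>n::nat. \<psi> n \<in> test_functions \<Omega>" "AE x in ?M. (\<lambda>n. \<psi> n x) \<longlonglongrightarrow> G (u x)"
    "Lp_null ?M p (\<lambda>n x. deriv G (u x) *\<^sub>R weak_grad \<Omega> u x - classical_grad (\<psi> n) x)"
    using W1_0_compose[OF \<Omega> p1 u] by blast
  define g where "g = weak_grad \<Omega> u"
  have uL: "u \<in> L_space \<Omega> (ereal p)" "g \<in> L_space \<Omega> (ereal p)" "weak_grad \<Omega> (\<lambda>x. G (u x)) \<in> L_space \<Omega> (ereal p)"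
    using u w by (auto simp: g_def W1_0_def W1_def)
  have um: "u \<in> borel_measurable ?M" and gm[measurable]: "g \<in> borel_measurable ?M"
    and wm[measurable]: "weak_grad \<Omega> (\<lambda>x. G (u x)) \<in> borel_measurable ?M"
    using uL by (auto simp: L_space_iff)
  have Gm[measurable]: "(\<lambda>x. deriv G (u x)) \<in> borel_measurable ?M"
    by (intro borel_measurable_continuous_on[OF _ um] continuous_on_deriv)
  have gi: "integrable ?M (\<lambda>x. norm (g x) powr p)" using uL by (simp add: L_space_iff)
  have bd: "norm (deriv G (u x) *\<^sub>R g x) powr p \<le> deriv G (u x) * norm (g x) powr p" for x
  proof -
    have "deriv G (u x) powr p \<le> deriv G (u x) powr 1"
      using p deriv_bounds by (intro powr_mono') auto
    then show ?thesis using deriv_bounds by (simp add: powr_mult mult_right_mono abs_of_nonneg)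
  qed
  have i1: "integrable ?M (\<lambda>x. deriv G (u x) * norm (g x) powr p)"
    by (rule Bochner_Integration.integrable_bound[OF gi]) (use deriv_bounds in \<open>auto simp: abs_mult intro!: mult_left_le_one_le\<close>)
  have i2: "integrable ?M (\<lambda>x. norm (deriv G (u x) *\<^sub>R g x) powr p)"
    by (rule Bochner_Integration.integrable_bound[OF i1]) (use bd deriv_bounds in \<open>auto simp: abs_of_nonneg\<close>)
  have "(\<integral>x. norm (deriv G (u x) *\<^sub>R g x) powr p \<partial>?M) \<le> (\<integral>x. deriv G (u x) * norm (g x) powr p \<partial>?M)"
    by (rule integral_mono[OF i2 i1 bd])
  also have "\<dots> = (\<integral>x. (norm (g x) powr (p - 2) *\<^sub>R g x) \<bullet> weak_grad \<Omega> (\<lambda>x. G (u x)) x \<partial>?M)"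
  proof (rule integral_cong_AE)
    show "AE x in ?M. deriv G (u x) * norm (g x) powr p = (norm (g x) powr (p - 2) *\<^sub>R g x) \<bullet> weak_grad \<Omega> (\<lambda>x. G (u x)) x"
      using ae
    proof eventually_elim
      case (elim x)
      have "norm (g x) powr (p - 2) * (g x \<bullet> g x) = norm (g x) powr p"
      proof (cases "g x = 0")
        case False
        then show ?thesis by (simp add: powr_diff dot_square_norm)
      qed simp
      then show ?case unfolding elim by (simp add: g_def)
    qed
  qed measurable
  also have "\<dots> = (\<integral>x. f x (u x) * G (u x) \<partial>?M)"
    using sol w by (simp add: p_laplace_weak_solution_def g_def)
  also have "\<dots> \<le> J"
  \<comment> \<open>Without integrability the Bochner integral has the default value 0, which is at
    most \<open>J\<close>.\<close>
  proof (cases "integrable ?M (\<lambda>x. f x (u x) * G (u x))")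
    case True
    then have "ennreal (\<integral>x. \<bar>f x (u x) * G (u x)\<bar> \<partial>?M) \<le> ennreal J"
      using J by (subst nn_integral_eq_integral[symmetric]) auto
    then have "(\<integral>x. \<bar>f x (u x) * G (u x)\<bar> \<partial>?M) \<le> J" using J by (simp add: ennreal_le_iff)
    then show ?thesis using integral_abs_bound[of ?M "\<lambda>x. f x (u x) * G (u x)"] by linarith
  qed (use J in \<open>simp add: not_integrable_integral_eq\<close>)
  finally have le: "(\<integral>x. norm (deriv G (u x) *\<^sub>R g x) powr p \<partial>?M) \<le> J" .
  have gL: "(\<lambda>x. deriv G (u x) *\<^sub>R g x) \<in> L_space \<Omega> (ereal p)" using i2 by (simp add: L_space_iff)
  have "(\<integral>\<^sup>+x. ennreal (\<bar>G (u x)\<bar> powr ps) \<partial>?M) \<le>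
     ennreal ((c powr p * 2 powr p * (\<integral>x. norm (deriv G (u x) *\<^sub>R g x) powr p \<partial>?M)) powr (ps / p))"
    unfolding ps_def c_def by (rule sobolev_Lp_limit[OF \<Omega> p \<psi>(1,2) gL \<psi>(3)[folded g_def]])
  also have "\<dots> \<le> ennreal ((c powr p * 2 powr p * J) powr (ps / p))"
    using le p by (intro ennreal_leI powr_mono2 mult_left_mono) (auto simp: ps_def sobolev_exponent_def)
  finally show ?thesis .
qed

text \<open>The function \<open>x * exp (- 1 / x)\<close> has slope in \<open>[0, 1]\<close> and lies above \<open>x - 1\<close>, so its
  rescaling by \<open>h\<close> replaces the positive part by a smooth function, up to an error \<open>h\<close>. Test functions
  have to be smooth, and with \<open>soft_threshold\<close> no chain rule for Lipschitz functions is needed.\<close>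

definition soft_threshold :: "real \<Rightarrow> real \<Rightarrow> real \<Rightarrow> real" where
  "soft_threshold k h s = h * flat_exp 1 (inverse h * (s - k)) - h * flat_exp 1 (inverse h * (- s - k))"

text \<open>The lower bound is \<open>1 + y \<le> exp y\<close> at \<open>y = - 1 / x\<close>; the
  slope bound of the next lemma is the same inequality at \<open>y = 1 / x\<close>.\<close>

lemma flat_exp_1_bounds: "x - 1 \<le> flat_exp 1 x" "x \<le> 0 \<Longrightarrow> flat_exp 1 x = 0"
proof -
  show "x - 1 \<le> flat_exp 1 x"
  proof (cases "0 < x")
    case True
    have "x * (1 + (- 1 / x)) \<le> x * exp (- 1 / x)"
      using True by (intro mult_left_mono exp_ge_add_one_self) auto
    then show ?thesis using True by (simp add: flat_exp_def algebra_simps)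
  qed (simp add: flat_exp_def)
qed (simp add: flat_exp_def)

lemma flat_exp_1_derivative:
  obtains d where "(flat_exp 1 has_real_derivative d) (at x)" "0 \<le> d" "d \<le> 1" "x \<le> 0 \<Longrightarrow> d = 0"
proof
  let ?d = "flat_exp 0 x + flat_exp (- 1) x"
  show "(flat_exp 1 has_real_derivative ?d) (at x)" using flat_exp_derivative[of 1 x] by simp
  show "0 \<le> ?d" "x \<le> 0 \<Longrightarrow> ?d = 0" by (auto simp: flat_exp_def)
  show "?d \<le> 1"
  proof (cases "0 < x")
    case True
    have "(1 + 1 / x) * exp (- 1 / x) \<le> exp (1 / x) * exp (- 1 / x)"
      by (intro mult_right_mono exp_ge_add_one_self) auto
    also have "\<dots> = 1" by (simp flip: exp_add)
    finally show ?thesis using True by (simp add: flat_exp_def algebra_simps power_int_minus divide_inverse)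
  qed (simp add: flat_exp_def)
qed

lemma soft_threshold_smooth_contraction:
  assumes "0 \<le> k" "0 < h"
  shows "smooth_contraction (soft_threshold k h)"
proof
  fix j and s :: real
  show "soft_threshold k h 0 = 0" by (simp add: soft_threshold_def)
  have id: "Ck j (\<lambda>s::real. s)" using Ck_inner[of j "1::real"] by simp
  have eq: "soft_threshold k h = (\<lambda>s. h * flat_exp 1 (inverse h * (s + (- k))) + (- h) * flat_exp 1 (inverse h * ((- 1) * s + (- k))))"
    by (auto simp: soft_threshold_def)
  show "Ck j (soft_threshold k h)"
    unfolding eq by (intro Ck_add Ck_mult Ck_const Ck_compose[OF Ck_flat_exp] id)
  obtain d1 where d1: "(flat_exp 1 has_real_derivative d1) (at (inverse h * (s - k)))" "0 \<le> d1" "d1 \<le> 1" "inverse h * (s - k) \<le> 0 \<Longrightarrow> d1 = 0"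
    using flat_exp_1_derivative[of "inverse h * (s - k)"] by blast
  obtain d2 where d2: "(flat_exp 1 has_real_derivative d2) (at (inverse h * (- s - k)))" "0 \<le> d2" "d2 \<le> 1" "inverse h * (- s - k) \<le> 0 \<Longrightarrow> d2 = 0"
    using flat_exp_1_derivative[of "inverse h * (- s - k)"] by blast
  have "(soft_threshold k h has_real_derivative (h * (d1 * inverse h) - h * (d2 * (- inverse h)))) (at s)"
    unfolding soft_threshold_def[abs_def] using assms
    by (intro DERIV_diff DERIV_cmult DERIV_chain2[where g="\<lambda>s. inverse h * (s - k)", OF d1(1)]
      DERIV_chain2[where g="\<lambda>s. inverse h * (- s - k)", OF d2(1)]) (auto intro!: derivative_eq_intros)
  then have "deriv (soft_threshold k h) s = d1 + d2"
    using assms by (intro DERIV_imp_deriv) (simp add: field_simps)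
  \<comment> \<open>Since \<open>k \<ge> 0\<close>, at most one of the two branches is active at a
    given \<open>s\<close>, so the two slopes never add up to more than 1.\<close>
  moreover have "s - k \<le> 0 \<or> - s - k \<le> 0" using assms by linarith
  then have "d1 = 0 \<or> d2 = 0"
    using d1(4) d2(4) assms by (auto simp: mult_le_0_iff)
  ultimately show "0 \<le> deriv (soft_threshold k h) s" "deriv (soft_threshold k h) s \<le> 1"
    using d1 d2 by auto
qed

lemma soft_threshold_bounds:
  assumes "0 \<le> k" "0 < h"
  shows "\<bar>s\<bar> \<le> k \<Longrightarrow> soft_threshold k h s = 0" "\<bar>s\<bar> - k - h \<le> \<bar>soft_threshold k h s\<bar>"
proof -
  show "soft_threshold k h s = 0" if "\<bar>s\<bar> \<le> k"
  proof -
    have "inverse h * (s - k) \<le> 0" "inverse h * (- s - k) \<le> 0"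
      using that assms by (auto simp: mult_le_0_iff)
    then show ?thesis by (simp add: soft_threshold_def flat_exp_1_bounds(2))
  qed
  have *: "h * (inverse h * (x - k) - 1) \<le> h * flat_exp 1 (inverse h * (x - k))" for x
    using assms by (intro mult_left_mono flat_exp_1_bounds(1)) auto
  have **: "x - k - h \<le> h * flat_exp 1 (inverse h * (x - k))" for x
    using *[of x] assms by (simp add: right_diff_distrib mult.assoc[symmetric])
  show "\<bar>s\<bar> - k - h \<le> \<bar>soft_threshold k h s\<bar>"
  proof (cases "0 \<le> s")
    case True
    then have "flat_exp 1 (inverse h * (- s - k)) = 0"
      using assms by (intro flat_exp_1_bounds(2)) (auto simp: mult_le_0_iff)
    then show ?thesis using **[of s] True by (simp add: soft_threshold_def)
  next
    case False
    then have "flat_exp 1 (inverse h * (s - k)) = 0"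
      using assms by (intro flat_exp_1_bounds(2)) (auto simp: mult_le_0_iff)
    then show ?thesis using **[of "- s"] False by (simp add: soft_threshold_def)
  qed
qed

section \<open>De Giorgi iteration\<close>

text \<open>The claim along the levels \<open>k0 * (2 - 2^(-n))\<close> is \<Phi> \<le>
  \<open>L * l ^ n\<close>. The ratio \<open>l\<close> satisfies
  \<open>l powr (\<sigma> - 1) = 2 powr (- s)\<close>, so the surplus power \<sigma> - 1 of
  \<open>l ^ n\<close> cancels exactly the growth \<open>2 ^ n\<close> to the power \<open>s\<close>
  caused by the shrinking gaps. What remains is a constant, and the hypothesis on \<open>D\<close>
  bounds it by one further factor \<open>l\<close>.\<close>

lemma superlinear_iteration:
  fixes \<Phi> :: "real \<Rightarrow> real"
  assumes k0: "0 < k0" and \<Phi>: "\<And>k. 0 \<le> \<Phi> k" "\<And>k k'. k \<le> k' \<Longrightarrow> \<Phi> k' \<le> \<Phi> k" "\<And>k. \<Phi> k \<le> L" and L: "0 < L"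
    and s: "0 < s" and \<sigma>: "1 < \<sigma>" and D: "0 \<le> D" "8 powr s * D * L powr (\<sigma> - 1) \<le> 2 powr (- s / (\<sigma> - 1))"
    and step: "\<And>k k'. k0 \<le> k \<Longrightarrow> k < k' \<Longrightarrow> \<Phi> k' \<le> (2 * k' / (k' - k)) powr s * D * \<Phi> k powr \<sigma>"
  shows "\<Phi> (2 * k0) = 0"
proof -
  define l where "l = 2 powr (- s / (\<sigma> - 1))"
  have "2 powr (- s / (\<sigma> - 1)) < 2 powr (0::real)"
    using s \<sigma> by (intro powr_less_mono divide_neg_pos) auto
  then have l: "0 < l" "l < 1" by (auto simp: l_def)
  have ls: "l powr (\<sigma> - 1) = 2 powr (- s)" using \<sigma> by (simp add: l_def powr_powr)
  define k where "k n = k0 * (2 - (1/2) ^ n)" for n :: nat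
  have k: "k0 \<le> k n" "k n < k (Suc n)" "k n \<le> 2 * k0" for n
  proof -
    have "0 < (1/2::real) ^ n" "(1/2::real) ^ n \<le> 1" by (auto intro: power_le_one)
    then have "k0 * 1 \<le> k0 * (2 - (1/2) ^ n)" "k0 * (2 - (1/2) ^ n) < k0 * (2 - (1/2) ^ Suc n)" "k0 * (2 - (1/2) ^ n) \<le> k0 * 2"
      using k0 by (auto simp del: mult_1_right)
    then show "k0 \<le> k n" "k n < k (Suc n)" "k n \<le> 2 * k0" by (simp_all add: k_def mult.commute)
  qed
  \<comment> \<open>The gap is \<open>k0 * 2^(-n) / 2\<close> and the upper level at most
    \<open>2 * k0\<close>; the three factors 2 make up the 8.\<close>
  have ratio: "2 * k (Suc n) / (k (Suc n) - k n) \<le> 8 * 2 ^ n" for n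
  proof -
    have eq: "k (Suc n) - k n = k0 * (1/2) ^ n / 2" by (simp add: k_def algebra_simps)
    have "2 * k (Suc n) / (k (Suc n) - k n) \<le> 2 * (2 * k0) / (k0 * (1/2) ^ n / 2)"
      unfolding eq by (rule divide_right_mono) (use k(3)[of "Suc n"] k0 in auto)
    also have "\<dots> = 8 * 2 ^ n" using k0 by (simp add: power_divide)
    finally show ?thesis .
  qed
  have "\<Phi> (k n) \<le> L * l ^ n" for n
  proof (induction n)
    case 0
    then show ?case using \<Phi>(3) by simp
  next
    case (Suc n)
    have kn: "0 < k (Suc n)" "0 < k (Suc n) - k n" using k[of n] k[of "Suc n"] k0 by linarith+
    have "\<Phi> (k (Suc n)) \<le> (2 * k (Suc n) / (k (Suc n) - k n)) powr s * D * \<Phi> (k n) powr \<sigma>"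
      by (rule step[OF k(1,2)])
    also have "\<dots> \<le> (8 * 2 ^ n) powr s * D * (L * l ^ n) powr \<sigma>"
      using ratio[of n] kn s D \<sigma> Suc \<Phi>(1) by (intro mult_mono powr_mono2) auto
    also have "\<dots> = (8 powr s * D * L powr (\<sigma> - 1)) * ((2 ^ n) powr s * (l ^ n) powr (\<sigma> - 1)) * (L * l ^ n)"
    proof -
      have "(L * l ^ n) powr \<sigma> = (L * l ^ n) powr (\<sigma> - 1) * (L * l ^ n)"
        using L l by (simp add: powr_diff)
      then show ?thesis using L l by (simp add: powr_mult mult_ac)
    qed
    also have "(2 ^ n) powr s * (l ^ n) powr (\<sigma> - 1) = 1"
    proof -
      have "(2 ^ n) powr s = (2 powr s) ^ n" using powr_power[of "2::real" s n] by (simp add: powr_realpow[symmetric] powr_powr)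
      moreover have "(l ^ n) powr (\<sigma> - 1) = (l powr (\<sigma> - 1)) ^ n"
        using powr_power[of l "\<sigma> - 1" n] l by (simp add: powr_realpow[symmetric] powr_powr)
      ultimately show ?thesis by (simp add: ls power_mult_distrib[symmetric] powr_minus)
    qed
    also have "8 powr s * D * L powr (\<sigma> - 1) * 1 * (L * l ^ n) \<le> l * 1 * (L * l ^ n)"
      using D(2) L l by (intro mult_right_mono) (auto simp: l_def)
    finally show ?case by (simp add: mult_ac)
  qed
  then have le: "\<Phi> (2 * k0) \<le> L * l ^ n" for n using \<Phi>(2)[OF k(3)[of n]] order_trans by blast
  have "(\<lambda>n. L * l ^ n) \<longlonglongrightarrow> L * 0" using l by (intro tendsto_intros LIMSEQ_realpow_zero) auto
  then have "\<Phi> (2 * k0) \<le> L * 0" by (rule LIMSEQ_le_const) (use le in blast)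
  then show ?thesis using \<Phi>(1)[of "2 * k0"] by simp
qed

text \<open>Hoelder with exponents \<open>r\<close> and \<open>r / (r - 1) = 1 / \<theta>\<close>,
  the latter turning the power of \<open>v\<close> back into \<open>v\<close>. For infinite
  \<open>r\<close> the quotient \<open>1 / r\<close> is 0, so \<theta> = 1 and the essential
  supremum takes the place of Hoelder. The constant \<open>A\<close> does not depend on
  \<open>v\<close>, hence serves all levels and all solutions.\<close>

lemma L_space_weighted_bound:
  fixes a :: "'a::euclidean_space \<Rightarrow> real" and r :: ereal
  assumes a: "a \<in> L_space \<Omega> r" and r: "1 < r"
  defines "\<theta> \<equiv> 1 - real_of_ereal (1 / r)"
  obtains A where "0 \<le> A" "\<And>v. integrable (lebesgue_on \<Omega>) v \<Longrightarrow> (\<And>x. 0 \<le> v x) \<Longrightarrow>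
    (\<integral>\<^sup>+x. ennreal (\<bar>a x\<bar> * v x powr \<theta>) \<partial>(lebesgue_on \<Omega>)) \<le> ennreal (A * (\<integral>x. v x \<partial>(lebesgue_on \<Omega>)) powr \<theta>)"
proof -
  let ?M = "lebesgue_on \<Omega>"
  consider (real) \<rho> where "r = ereal \<rho>" "1 < \<rho>" | (inf) "r = \<infinity>" using r by (cases r) auto
  then show ?thesis
  proof cases
    case real
    have \<theta>: "\<theta> = (\<rho> - 1) / \<rho>" using real by (simp add: \<theta>_def one_ereal_def diff_divide_distrib)
    have ab: "1 < \<rho>" "1 < \<rho> / (\<rho> - 1)" "1 / \<rho> + 1 / (\<rho> / (\<rho> - 1)) = 1" using real(2) by (auto simp: field_simps)
    have am: "a \<in> borel_measurable ?M" and ai: "integrable ?M (\<lambda>x. \<bar>a x\<bar> powr \<rho>)" using a real by (auto simp: L_space_iff)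
    show ?thesis
    proof (rule that[of "(\<integral>x. \<bar>a x\<bar> powr \<rho> \<partial>?M) powr (1 / \<rho>)"])
      fix v :: "'a \<Rightarrow> real" assume v: "integrable ?M v" "\<And>x. 0 \<le> v x"
      have eq: "\<bar>v x powr \<theta>\<bar> powr (\<rho> / (\<rho> - 1)) = v x" for x
        using v(2)[of x] real(2) by (simp add: powr_powr \<theta>)
      have vm: "(\<lambda>x. v x powr \<theta>) \<in> borel_measurable ?M" using v by measurable
      have vi: "integrable ?M (\<lambda>x. \<bar>v x powr \<theta>\<bar> powr (\<rho> / (\<rho> - 1)))" unfolding eq by (rule v(1))
      note H = Holder_inequality[OF ab am vm ai vi]
      have "(\<integral>\<^sup>+x. ennreal (\<bar>a x\<bar> * v x powr \<theta>) \<partial>?M) = (\<integral>\<^sup>+x. ennreal \<bar>a x * v x powr \<theta>\<bar> \<partial>?M)"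
        by (simp add: abs_mult)
      also have "\<dots> = ennreal (\<integral>x. \<bar>a x * v x powr \<theta>\<bar> \<partial>?M)"
        using H(1) by (intro nn_integral_eq_integral) auto
      also have "\<dots> \<le> ennreal ((\<integral>x. \<bar>a x\<bar> powr \<rho> \<partial>?M) powr (1 / \<rho>) * (\<integral>x. v x \<partial>?M) powr \<theta>)"
        using H(2) unfolding eq by (intro ennreal_leI) (simp add: \<theta>)
      finally show "(\<integral>\<^sup>+x. ennreal (\<bar>a x\<bar> * v x powr \<theta>) \<partial>?M) \<le> \<dots>" .
    qed simp
  next
    case inf
    have \<theta>: "\<theta> = 1" using inf by (simp add: \<theta>_def)
    define E where "E = esssup ?M (\<lambda>x. ereal (norm (a x)))"
    have am: "a \<in> borel_measurable ?M" and E: "E < \<infinity>"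
      using a inf by (auto simp: L_space_def Lnorm_def E_def split: if_splits)
    have ae: "AE x in ?M. ereal (norm (a x)) \<le> E" unfolding E_def by (rule esssup_AE)
    define A where "A = max 0 (real_of_ereal E)"
    have aA: "AE x in ?M. \<bar>a x\<bar> \<le> A"
      using ae by eventually_elim (use E in \<open>cases E; auto simp: A_def\<close>)
    show ?thesis
    proof (rule that[of A])
      show "0 \<le> A" by (simp add: A_def)
      fix v :: "'a \<Rightarrow> real" assume v: "integrable ?M v" "\<And>x. 0 \<le> v x"
      have "(\<integral>\<^sup>+x. ennreal (\<bar>a x\<bar> * v x powr \<theta>) \<partial>?M) \<le> (\<integral>\<^sup>+x. ennreal (A * v x) \<partial>?M)"
      proof (rule nn_integral_mono_AE)
        show "AE x in ?M. ennreal (\<bar>a x\<bar> * v x powr \<theta>) \<le> ennreal (A * v x)"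
          using aA by eventually_elim (use v in \<open>auto simp: \<theta> intro!: ennreal_leI mult_right_mono\<close>)
      qed
      also have "\<dots> = ennreal (\<integral>x. A * v x \<partial>?M)"
        using v by (intro nn_integral_eq_integral) (auto simp: A_def)
      also have "\<dots> = ennreal (A * (\<integral>x. v x \<partial>?M) powr \<theta>)"
        using v by (simp add: \<theta> integral_nonneg)
      finally show "(\<integral>\<^sup>+x. ennreal (\<bar>a x\<bar> * v x powr \<theta>) \<partial>?M) \<le> \<dots>" .
    qed
  qed
qed

lemma integrable_superlevel_set:
  fixes u h :: "'a \<Rightarrow> real"
  assumes [measurable]: "u \<in> borel_measurable M" and h: "integrable M h"
  shows "integrable M (\<lambda>x. indicator {x. k < \<bar>u x\<bar>} x * h x)"
proof (rule Bochner_Integration.integrable_bound[OF h])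
  have [measurable]: "h \<in> borel_measurable M" using h by simp
  have eq: "indicator {x. k < \<bar>u x\<bar>} x * h x = (if k < \<bar>u x\<bar> then h x else 0)" for x
    by (simp add: indicator_def)
  show "(\<lambda>x. indicator {x. k < \<bar>u x\<bar>} x * h x) \<in> borel_measurable M" unfolding eq by measurable
qed (auto simp: indicator_def)

text \<open>One step of the recursion, from level \<open>k\<close> to level \<open>k'\<close>. The
  truncation starts at \<open>k\<close>, so the right-hand side of the equation sees only
  \<open>V k\<close>; beyond \<open>k'\<close> the truncation is comparable with \<open>|u|\<close>,
  so the left-hand side controls \<open>V k'\<close>. The power \<open>ps / p\<close> from Sobolev,
  applied to \<Phi>(k) to the power \<theta>, produces the superlinear exponent.\<close>

lemma weak_solution_level_sets:
  fixes u :: "'a::euclidean_space \<Rightarrow> real" and p :: real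
  assumes \<Omega>: "open \<Omega>" "bounded \<Omega>" and p: "1 < p" "p < DIM('a)" and sol: "p_laplace_weak_solution \<Omega> p f u"
    and f: "AE x in lebesgue_on \<Omega>. \<forall>s. \<bar>f x s\<bar> \<le> \<bar>a x\<bar> * ft s"
  defines "ps \<equiv> sobolev_exponent DIM('a) p" and "c \<equiv> p * (real DIM('a) - 1) / (real DIM('a) - p)"
  assumes \<Phi>_eq: "\<And>k. \<Phi> k = (\<integral>x. indicator {x. k < \<bar>u x\<bar>} x * \<bar>u x\<bar> powr ps \<partial>(lebesgue_on \<Omega>))"
    and ft: "\<And>s. k0 \<le> \<bar>s\<bar> \<Longrightarrow> ft s \<le> e * \<bar>s\<bar> powr (ps * \<theta> - 1)" and \<theta>: "0 < \<theta>" and e: "0 < e"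
    and A: "0 \<le> A" "\<And>v. integrable (lebesgue_on \<Omega>) v \<Longrightarrow> (\<And>x. 0 \<le> v x) \<Longrightarrow>
      (\<integral>\<^sup>+x. ennreal (\<bar>a x\<bar> * v x powr \<theta>) \<partial>(lebesgue_on \<Omega>)) \<le> ennreal (A * (\<integral>x. v x \<partial>(lebesgue_on \<Omega>)) powr \<theta>)"
    and a: "a \<in> borel_measurable (lebesgue_on \<Omega>)"
    and u: "u \<in> borel_measurable (lebesgue_on \<Omega>)" "integrable (lebesgue_on \<Omega>) (\<lambda>x. \<bar>u x\<bar> powr ps)"
    and k: "0 < k0" "k0 \<le> k" "k < k'"
  shows "\<Phi> k' \<le> (2 * k' / (k' - k)) powr ps * (c powr p * 2 powr p * e * A) powr (ps / p) * \<Phi> k powr (\<theta> * ps / p)"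
proof -
  let ?M = "lebesgue_on \<Omega>"
  note [measurable] = u(1) a
  have ps: "0 < ps" using p by (simp add: ps_def sobolev_exponent_def)
  have c0: "0 < c" using p by (simp add: c_def)
  define V where "V k x = indicator {x. k < \<bar>u x\<bar>} x * \<bar>u x\<bar> powr ps" for k x
  have V: "integrable ?M (V k)" "0 \<le> V k x" for k x
    unfolding V_def[abs_def] by (rule integrable_superlevel_set[OF u]) simp
  have \<Phi>: "\<Phi> k = (\<integral>x. V k x \<partial>?M)" for k by (simp add: \<Phi>_eq V_def)
  have \<Phi>0: "0 \<le> \<Phi> k" for k unfolding \<Phi> by (intro Bochner_Integration.integral_nonneg V)
  \<comment> \<open>Half of the gap pays for the smoothing error, the other half keeps the
    truncation positive beyond \<open>k'\<close>.\<close>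
  define h where "h = (k' - k) / 2"
  have kh: "0 \<le> k" "0 < h" using k by (auto simp: h_def)
  interpret smooth_contraction "soft_threshold k h" by (rule soft_threshold_smooth_contraction[OF kh])
  define J where "J = e * (A * \<Phi> k powr \<theta>)"
  have "(\<integral>\<^sup>+x. ennreal \<bar>f x (u x) * soft_threshold k h (u x)\<bar> \<partial>?M) \<le> (\<integral>\<^sup>+x. ennreal e * ennreal (\<bar>a x\<bar> * V k x powr \<theta>) \<partial>?M)"
  proof (rule nn_integral_mono_AE)
    show "AE x in ?M. ennreal \<bar>f x (u x) * soft_threshold k h (u x)\<bar> \<le> ennreal e * ennreal (\<bar>a x\<bar> * V k x powr \<theta>)"
      using f
    proof eventually_elim
      case (elim x)
      show ?case
      proof (cases "k < \<bar>u x\<bar>")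
        case False
        then show ?thesis using soft_threshold_bounds(1)[OF kh] by simp
      next
        case True
        then have ux: "0 < \<bar>u x\<bar>" "k0 \<le> \<bar>u x\<bar>" using k by linarith+
        \<comment> \<open>The truncation is bounded by \<open>|u|\<close>. This factor raises the
          exponent \<open>ps * \<theta> - 1\<close> of the growth condition to
          \<open>ps * \<theta>\<close>, which makes the integrand a multiple of \<open>V k\<close>
          to the power \<theta>.\<close>
        have "\<bar>f x (u x) * soft_threshold k h (u x)\<bar> \<le> (\<bar>a x\<bar> * ft (u x)) * \<bar>u x\<bar>"
          unfolding abs_mult using elim bound[of "u x"] by (intro mult_mono) (auto intro: order_trans[OF abs_ge_zero])
        also have "\<dots> \<le> (\<bar>a x\<bar> * (e * \<bar>u x\<bar> powr (ps * \<theta> - 1))) * \<bar>u x\<bar>"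
          using ft[OF ux(2)] by (intro mult_right_mono mult_left_mono) auto
        also have "\<dots> = e * (\<bar>a x\<bar> * V k x powr \<theta>)"
          using ux True by (simp add: V_def powr_diff powr_powr)
        finally show ?thesis using e by (simp add: ennreal_mult'[symmetric] ennreal_leI)
      qed
    qed
  qed
  also have "\<dots> = ennreal e * (\<integral>\<^sup>+x. ennreal (\<bar>a x\<bar> * V k x powr \<theta>) \<partial>?M)"
  proof (rule nn_integral_cmult)
    have [measurable]: "V k \<in> borel_measurable ?M" using V(1) by (rule borel_measurable_integrable)
    show "(\<lambda>x. ennreal (\<bar>a x\<bar> * V k x powr \<theta>)) \<in> borel_measurable ?M" by measurable
  qed
  also have "\<dots> \<le> ennreal e * ennreal (A * \<Phi> k powr \<theta>)"
    unfolding \<Phi> by (intro mult_left_mono A V) simp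
  also have "\<dots> = ennreal J" using e by (simp add: J_def ennreal_mult')
  finally have J: "(\<integral>\<^sup>+x. ennreal \<bar>f x (u x) * soft_threshold k h (u x)\<bar> \<partial>?M) \<le> ennreal J" .
  have J0: "0 \<le> J" using e A by (simp add: J_def)
  define q where "q = (2 * k' / (k' - k)) powr ps"
  have q: "0 \<le> q" by (simp add: q_def)
  have le: "V k' x \<le> q * \<bar>soft_threshold k h (u x)\<bar> powr ps" for x
  proof (cases "k' < \<bar>u x\<bar>")
    case False
    then show ?thesis using q by (simp add: V_def)
  next
    case True
    have "\<bar>u x\<bar> * (k' - k) \<le> (\<bar>u x\<bar> - k - h) * (2 * k')"
    proof -
      \<comment> \<open>The ratio of \<open>|u|\<close> to \<open>|u| - k - h\<close> is largest at
        \<open>|u| = k'\<close>, where it equals \<open>2 * k' / (k' - k)\<close>; the inequality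
        says that this product is nonnegative.\<close>
      have "0 \<le> (\<bar>u x\<bar> - k') * (k + k')" using True k by (intro mult_nonneg_nonneg) auto
      then show ?thesis by (simp add: h_def field_simps)
    qed
    then have "\<bar>u x\<bar> \<le> (2 * k' / (k' - k)) * (\<bar>u x\<bar> - k - h)"
      using k by (simp add: field_simps)
    also have "\<dots> \<le> (2 * k' / (k' - k)) * \<bar>soft_threshold k h (u x)\<bar>"
      using soft_threshold_bounds(2)[OF kh] k by (intro mult_left_mono) auto
    finally have "\<bar>u x\<bar> powr ps \<le> ((2 * k' / (k' - k)) * \<bar>soft_threshold k h (u x)\<bar>) powr ps"
      using ps by (intro powr_mono2) auto
    also have "\<dots> = q * \<bar>soft_threshold k h (u x)\<bar> powr ps" using k by (simp add: q_def powr_mult del: times_divide_eq_left)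
    finally show ?thesis using True by (simp add: V_def)
  qed
  have "ennreal (\<Phi> k') = (\<integral>\<^sup>+x. ennreal (V k' x) \<partial>?M)"
    unfolding \<Phi> using V by (intro nn_integral_eq_integral[symmetric]) auto
  also have "\<dots> \<le> (\<integral>\<^sup>+x. ennreal q * ennreal (\<bar>soft_threshold k h (u x)\<bar> powr ps) \<partial>?M)"
    using le q by (intro nn_integral_mono) (simp add: ennreal_mult'[symmetric] ennreal_leI)
  also have "\<dots> = ennreal q * (\<integral>\<^sup>+x. ennreal (\<bar>soft_threshold k h (u x)\<bar> powr ps) \<partial>?M)"
    using borel_measurable_continuous_on[OF continuous_on u(1)] by (intro nn_integral_cmult) auto
  also have "\<dots> \<le> ennreal q * ennreal ((c powr p * 2 powr p * J) powr (ps / p))"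
    unfolding ps_def c_def by (intro mult_left_mono weak_solution_energy[OF \<Omega> p sol J0 J]) simp
  also have "\<dots> = ennreal (q * (c powr p * 2 powr p * J) powr (ps / p))"
    using q by (simp add: ennreal_mult)
  finally have "\<Phi> k' \<le> q * (c powr p * 2 powr p * J) powr (ps / p)"
    using q by (simp add: ennreal_le_iff)
  also have "c powr p * 2 powr p * J = (c powr p * 2 powr p * e * A) * \<Phi> k powr \<theta>"
    by (simp add: J_def mult_ac)
  also have "\<dots> powr (ps / p) = (c powr p * 2 powr p * e * A) powr (ps / p) * \<Phi> k powr (\<theta> * ps / p)"
    using e A \<Phi>0 by (simp add: powr_mult powr_powr)
  finally show ?thesis by (simp add: q_def mult.assoc)
qed

theorem corollary3p1:
  fixes \<Omega> :: "'a::euclidean_space set"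
    and p c\<^sub>0 s\<^sub>0 C\<^sub>0 :: real
    and r :: ereal
    and f :: "'a \<Rightarrow> real \<Rightarrow> real"
    and a :: "'a \<Rightarrow> real"
    and ft :: "real \<Rightarrow> real"
    and u :: "nat \<Rightarrow> 'a \<Rightarrow> real"
  defines "pstar \<equiv> sobolev_exponent (DIM('a)) p"
  assumes p: "1 < p" "p < DIM('a)"
    and domain: "open \<Omega>" "bounded \<Omega>" "strictly_convex \<Omega>" "C2_boundary \<Omega>"
    and f_car: "caratheodory \<Omega> f"
    and H0_bound: "AE x in lebesgue_on \<Omega>. \<forall>s. \<bar>f x s\<bar> \<le> \<bar>a x\<bar> * ft s"
    and H0_r: "r > ereal (DIM('a) / p)"
    and H0_a: "a \<in> L_space \<Omega> r"
    and H0_cont: "continuous_on UNIV ft"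
    and H0_nonneg: "\<And>s. ft s \<ge> 0"
    and H0_s0: "s\<^sub>0 \<ge> 0"
    and H0_pos: "\<And>s. \<bar>s\<bar> > s\<^sub>0 \<Longrightarrow> ft s > 0"
    and H0_top: "((\<lambda>s. ft s / \<bar>s\<bar> powr (pstar * (1 - real_of_ereal (1 / r)) - 1)) \<longlongrightarrow> 0) at_top"
    and H0_bot: "((\<lambda>s. ft s / \<bar>s\<bar> powr (pstar * (1 - real_of_ereal (1 / r)) - 1)) \<longlongrightarrow> 0) at_bot"
    and H1_c0: "c\<^sub>0 > 0"
    and H1: "Limsup at_top (\<lambda>s. ereal ((SUP t\<in>{-s..s}. ft t) / max (ft (-s)) (ft s))) \<le> ereal c\<^sub>0"
    and sol: "\<And>k. p_laplace_weak_solution \<Omega> p f (u k)"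
    and C0: "C\<^sub>0 > 0"
    and bound: "\<And>k. Lnorm \<Omega> pstar (u k) \<le> ereal C\<^sub>0"
  shows "\<exists>C::real. C > 0 \<and> (\<forall>k. Lnorm \<Omega> \<infinity> (u k) \<le> ereal C)"
proof -
  define N where "N = real DIM('a)"
  define \<theta> where "\<theta> = 1 - real_of_ereal (1 / r)"
  define c where "c = p * (real DIM('a) - 1) / (real DIM('a) - p)"
  define \<sigma> where "\<sigma> = \<theta> * pstar / p"
  have N: "1 < p" "p < N" using p by (auto simp: N_def)
  have ps: "pstar = N * p / (N - p)" "0 < pstar" using N by (auto simp: pstar_def sobolev_exponent_def N_def)
  have c0: "0 < c" using N by (simp add: c_def N_def)
  have rN: "ereal (N / p) < r" using H0_r by (simp add: N_def)
  moreover have "1 < N / p" using N by simp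
  ultimately have r1: "1 < r" by (cases r) (auto simp: one_ereal_def)
  \<comment> \<open>This is \<open>r > N / p\<close> in terms of \<theta>, and equality here would
    give \<sigma> = 1 exactly, since \<open>pstar / p = N / (N - p)\<close>.\<close>
  have \<theta>N: "1 - p / N < \<theta>"
  proof (cases r)
    case (real \<rho>)
    then have \<rho>: "N / p < \<rho>" using rN by simp
    moreover have "0 < N / p" using N by simp
    ultimately have "0 < \<rho>" by linarith
    then have "1 / \<rho> < p / N" using \<rho> N by (simp add: divide_less_eq less_divide_eq mult.commute)
    moreover have "\<theta> = 1 - 1 / \<rho>" using real by (simp add: \<theta>_def one_ereal_def)
    ultimately show ?thesis by simp
  next
    case PInf
    then show ?thesis using N by (simp add: \<theta>_def)
  next
    case MInf
    then show ?thesis using rN by simp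
  qed
  moreover have "p / N < 1" using N by simp
  ultimately have \<theta>: "0 < \<theta>" by linarith
  have \<sigma>: "1 < \<sigma>"
  proof -
    have "(1 - p / N) * (N / (N - p)) < \<theta> * (N / (N - p))"
      using \<theta>N N by (intro mult_strict_right_mono) auto
    moreover have "(1 - p / N) * (N / (N - p)) = 1" using N by (simp add: field_simps)
    moreover have "\<theta> * (N / (N - p)) = \<sigma>" using N by (simp add: \<sigma>_def ps)
    ultimately show ?thesis by linarith
  qed
  have am: "a \<in> borel_measurable (lebesgue_on \<Omega>)"
    using H0_a unfolding L_space_def Lnorm_def by (auto split: if_split_asm)
  obtain A where A: "0 \<le> A" "\<And>v. integrable (lebesgue_on \<Omega>) v \<Longrightarrow> (\<And>x. 0 \<le> v x) \<Longrightarrow>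
    (\<integral>\<^sup>+x. ennreal (\<bar>a x\<bar> * v x powr \<theta>) \<partial>(lebesgue_on \<Omega>)) \<le> ennreal (A * (\<integral>x. v x \<partial>(lebesgue_on \<Omega>)) powr \<theta>)"
    using L_space_weighted_bound[OF H0_a r1] unfolding \<theta>_def by blast
  define L where "L = C\<^sub>0 powr pstar"
  have L: "0 < L" using C0 by (simp add: L_def)
  define S where "S = c powr p * 2 powr p"
  have S: "0 < S" using c0 by (simp add: S_def)
  \<comment> \<open>The largest \<open>D\<close> that the smallness condition of the iteration
    admits for the starting bound \<open>L\<close>.\<close>
  define T where "T = 2 powr (- pstar / (\<sigma> - 1)) / (8 powr pstar * L powr (\<sigma> - 1))"
  have T: "0 < T" using L by (simp add: T_def)
  \<comment> \<open>Solves \<open>D \<le> T\<close> for the growth constant; \<open>A + 1\<close>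
    replaces \<open>A\<close>, which may be 0.\<close>
  define e where "e = T powr (p / pstar) / (S * (A + 1))"
  have e: "0 < e" using T S A by (simp add: e_def)
  define D where "D = (S * e * A) powr (pstar / p)"
  have D: "0 \<le> D" "8 powr pstar * D * L powr (\<sigma> - 1) \<le> 2 powr (- pstar / (\<sigma> - 1))"
  proof -
    have "S * e * A = T powr (p / pstar) * (A / (A + 1))" using S A by (simp add: e_def)
    also have "\<dots> \<le> T powr (p / pstar)" using A by (intro mult_left_le) auto
    finally have "D \<le> (T powr (p / pstar)) powr (pstar / p)"
      unfolding D_def using S e A N ps by (intro powr_mono2) auto
    then have "D \<le> T" using N ps(2) T by (simp add: powr_powr)
    then have "D * (8 powr pstar * L powr (\<sigma> - 1)) \<le> 2 powr (- pstar / (\<sigma> - 1))"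
      unfolding T_def using L by (subst (asm) pos_le_divide_eq) simp_all
    then show "8 powr pstar * D * L powr (\<sigma> - 1) \<le> 2 powr (- pstar / (\<sigma> - 1))"
      by (simp only: mult_ac)
  qed (simp add: D_def)
  obtain K1 where K1: "\<And>s. K1 \<le> s \<Longrightarrow> ft s / \<bar>s\<bar> powr (pstar * \<theta> - 1) < e"
    using order_tendstoD(2)[OF H0_top e] by (auto simp: eventually_at_top_linorder \<theta>_def)
  obtain K2 where K2: "\<And>s. s \<le> K2 \<Longrightarrow> ft s / \<bar>s\<bar> powr (pstar * \<theta> - 1) < e"
    using order_tendstoD(2)[OF H0_bot e] by (auto simp: eventually_at_bot_linorder \<theta>_def)
  \<comment> \<open>Beyond this level the growth condition holds with constant \<open>e\<close> on
    both sides of the axis; the 1 makes the level positive. No solution enters the choice.\<close>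
  define k0 where "k0 = max 1 (max K1 (- K2))"
  have k0: "0 < k0" by (simp add: k0_def)
  have ft: "ft s \<le> e * \<bar>s\<bar> powr (pstar * \<theta> - 1)" if s: "k0 \<le> \<bar>s\<bar>" for s
  proof -
    have "0 < \<bar>s\<bar>" using s k0 by linarith
    moreover have "K1 \<le> s \<or> s \<le> K2" using s unfolding k0_def by linarith
    then have "ft s / \<bar>s\<bar> powr (pstar * \<theta> - 1) < e" using K1 K2 by blast
    ultimately show ?thesis by (simp add: divide_less_eq)
  qed
  have "Lnorm \<Omega> \<infinity> (u k) \<le> ereal (2 * k0)" for k
  proof -
    let ?M = "lebesgue_on \<Omega>"
    have uL: "u k \<in> L_space \<Omega> (ereal pstar)"
      using bound[of k] by (auto simp: L_space_def intro: le_less_trans)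
    then have um: "u k \<in> borel_measurable ?M" and ui: "integrable ?M (\<lambda>x. \<bar>u k x\<bar> powr pstar)"
      by (auto simp: L_space_iff)
    define \<Phi> where "\<Phi> t = (\<integral>x. indicator {x. t < \<bar>u k x\<bar>} x * \<bar>u k x\<bar> powr pstar \<partial>?M)" for t
    note Vi = integrable_superlevel_set[OF um ui]
    have uI: "(\<integral>x. \<bar>u k x\<bar> powr pstar \<partial>?M) \<le> L"
    proof -
      have "(\<integral>x. \<bar>u k x\<bar> powr pstar \<partial>?M) powr (1 / pstar) \<le> C\<^sub>0"
        using bound[of k] Lnorm_eq[OF uL] by simp
      then have "((\<integral>x. \<bar>u k x\<bar> powr pstar \<partial>?M) powr (1 / pstar)) powr pstar \<le> L"
        unfolding L_def using ps by (intro powr_mono2) auto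
      then show ?thesis using ps(2) by (simp add: powr_powr)
    qed
    have "\<Phi> (2 * k0) = 0"
    proof (rule superlinear_iteration[OF k0 _ _ _ L ps(2) \<sigma> D])
      show "0 \<le> \<Phi> t" for t unfolding \<Phi>_def by (intro Bochner_Integration.integral_nonneg) auto
      show "\<Phi> t' \<le> \<Phi> t" if "t \<le> t'" for t t'
        unfolding \<Phi>_def by (intro integral_mono Vi) (use that in \<open>auto simp: indicator_def\<close>)
      show "\<Phi> t \<le> L" for t
      proof -
        have "\<Phi> t \<le> (\<integral>x. \<bar>u k x\<bar> powr pstar \<partial>?M)"
          unfolding \<Phi>_def by (intro integral_mono Vi ui) (auto simp: indicator_def)
        then show ?thesis using uI by linarith
      qed
      show "\<Phi> t' \<le> (2 * t' / (t' - t)) powr pstar * D * \<Phi> t powr \<sigma>" if "k0 \<le> t" "t < t'" for t t'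
        unfolding D_def S_def \<sigma>_def c_def pstar_def
        by (rule weak_solution_level_sets[where \<theta>=\<theta>, OF domain(1,2) p sol H0_bound _ ft[unfolded pstar_def] \<theta> e A am um ui[unfolded pstar_def] k0 that])
          (simp add: \<Phi>_def pstar_def)
    qed
    \<comment> \<open>A nonnegative integrand with integral 0 vanishes almost everywhere. Where
      \<open>|u|\<close> exceeds \<open>2 * k0\<close> its power is positive, so that set is
      null.\<close>
    then have "AE x in ?M. indicator {x. 2 * k0 < \<bar>u k x\<bar>} x * \<bar>u k x\<bar> powr pstar = 0"
      unfolding \<Phi>_def by (subst (asm) integral_nonneg_eq_0_iff_AE[OF Vi]) auto
    then have "AE x in ?M. ereal (norm (u k x)) \<le> ereal (2 * k0)"
      by eventually_elim (use k0 in \<open>auto simp: indicator_def split: if_splits\<close>)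
    then have "esssup ?M (\<lambda>x. ereal (norm (u k x))) \<le> ereal (2 * k0)"
      using um by (intro esssup_I) auto
    then show ?thesis using um by (simp add: Lnorm_def)
  qed
  then show ?thesis using k0 by (intro exI[of _ "2 * k0"]) auto
qed

end
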